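(* Let $K$ be a finite extension of $\mathbb{Q}_3$ that is a Frobenius field, and consider $$\mathfrak{h}(z)=\sum_{n\geq0}\frac{1}{64^n}\binom{2n}{n}^3z^n,\quad \mathfrak{f}(z)=\sum_{n\geq0}\frac{-1}{(2n-1)64^n}\binom{2n}{n}^3z^n,\quad \mathfrak{A}(z)=\sum_{n\geq0}\left(\sum_{k=0}^n\binom{n}{k}^2\binom{n+k}{k}^2\right)z^n.$$ Then: (i) $\mathfrak{h}(z)$ and $\mathfrak{f}(z)$ are algebraically dependent over $E_K$; moreover $\mathfrak{f}(z)/\mathfrak{h}(z)\in E_K$; (ii) $\mathfrak{h}(z)$ and $\mathfrak{A}(z)$ are algebraically independent over $E_K$; (iii) $\mathfrak{f}(z)$ and $\mathfrak{A}(z)$ are algebraically independent over $E_K$.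
   Context: $\mathbb{C}_3$ is the completion of an algebraic closure of $\mathbb{Q}_3$. A Frobenius field is a finite extension $K$ of $\mathbb{Q}_3$ such that $|x-x^3|<1$ for all $x\in K$ with $|x|\le1$. The Gauss norm on $K(z)$ is $|P/Q|_{\mathcal{G}}=\max_i|a_i|/\max_j|b_j|$ for $P=\sum a_iz^i$, $Q=\sum b_jz^j$; $E_K$ (the field of analytic elements) is the completion of $K(z)$ for this norm. Elements of $E_K$ without poles in the open unit disc are identified with power series; algebraic (in)dependence of power series over $E_K$ is meant in a common field containing both. *)

theory Defs
  imports
    "HOL-Analysis.Analysis"
    "HOL-Algebra.Algebraic_Closure_Type"
    "HOL-Algebra.QuotRing"
begin

section \<open>Ultrametric fields and p-adic fields\<close>

class ultrametric_field = field_char_0 + metric_space +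
  fixes absval :: "'a \<Rightarrow> real"
  assumes dist_absval: "dist x y = absval (x - y)"
    and ultrametric_absval_mult: "absval (x * y) = absval x * absval y"
    and ultrametric_absval_add: "absval (x + y) \<le> max (absval x) (absval y)"

definition padic_abs :: "nat \<Rightarrow> rat \<Rightarrow> real" where
  "padic_abs p q = (if q = 0 then 0 else
     (case quotient_of q of (a, b) \<Rightarrow>
        real p powi (int (multiplicity (int p) b) - int (multiplicity (int p) a))))"

text \<open>In a complete field whose absolute value extends the p-adic absolute value of the rationals,
  the closure of the prime field is a completion of it, that is, a copy of the field of
  p-adic numbers. (No mention of p is needed: p is determined by the absolute value.)\<close>

definition padic_numbers :: "'c::ultrametric_field set" where
  "padic_numbers = closure \<rat>"

text \<open>The type \<open>'c\<close> is the completion of an algebraic closure \<open>A\<close> of the p-adic numbers.\<close>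

definition is_Cp :: "nat \<Rightarrow> 'c::ultrametric_field itself \<Rightarrow> bool" where
  "is_Cp p _ \<longleftrightarrow>
     (\<forall>q. absval (of_rat q :: 'c) = padic_abs p q) \<and>
     complete (UNIV :: 'c set) \<and>
     (\<exists>A :: 'c set. algebraic_closure (ring_of_type_algebra\<lparr>carrier := A\<rparr>) padic_numbers \<and>
        closure A = UNIV)"

definition finite_padic_extension :: "'c::ultrametric_field set \<Rightarrow> bool" where
  "finite_padic_extension K \<longleftrightarrow>
     subfield K ring_of_type_algebra \<and> padic_numbers \<subseteq> K \<and>
     ring.finite_dimension ring_of_type_algebra padic_numbers K"

definition frobenius_field :: "nat \<Rightarrow> 'c::ultrametric_field set \<Rightarrow> bool" where
  "frobenius_field p K \<longleftrightarrow>
     finite_padic_extension K \<and> (\<forall>x\<in>K. absval x \<le> 1 \<longrightarrow> absval (x - x ^ p) < 1)"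


section \<open>The Gauss norm\<close>

text \<open>Rational functions and power series are both viewed inside the field of formal Laurent
  series; \<open>bounded_quotients K\<close> is the field of fractions of the ring of power series with
  bounded coefficients in \<open>K\<close>, and it contains \<open>K(z)\<close>.\<close>

definition bounded_series :: "'c::ultrametric_field set \<Rightarrow> 'c fps set" where
  "bounded_series K = {F. (\<forall>n. fps_nth F n \<in> K) \<and> bdd_above (range (\<lambda>n. absval (fps_nth F n)))}"

definition bounded_quotients :: "'c::ultrametric_field set \<Rightarrow> 'c fls set" where
  "bounded_quotients K =
     {fps_to_fls F / fps_to_fls G | F G. F \<in> bounded_series K \<and> G \<in> bounded_series K \<and> G \<noteq> 0}"

definition poly_to_fls :: "'c::ultrametric_field poly \<Rightarrow> 'c fls" where
  "poly_to_fls P = fps_to_fls (fps_of_poly P)"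

definition rational_functions :: "'c::ultrametric_field set \<Rightarrow> 'c fls set" where
  "rational_functions K =
     {poly_to_fls P / poly_to_fls Q | P Q.
        (\<forall>i. poly.coeff P i \<in> K) \<and> (\<forall>i. poly.coeff Q i \<in> K) \<and> Q \<noteq> 0}"

definition sup_norm :: "'c::ultrametric_field fps \<Rightarrow> real" where
  "sup_norm F = (SUP n. absval (fps_nth F n))"

text \<open>The Gauss norm, extended from rational functions to quotients of bounded power series by
  the same formula; \<open>gauss_norm_quotient\<close> and \<open>gauss_norm_rational\<close> below show that
  this is well defined and that on rational functions it is the usual quotient of maxima.\<close>

definition gauss_norm :: "'c::ultrametric_field fls \<Rightarrow> real" where
  "gauss_norm f = (THE r. \<exists>F\<in>bounded_series UNIV. \<exists>G\<in>bounded_series UNIV.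
     G \<noteq> 0 \<and> f = fps_to_fls F / fps_to_fls G \<and> r = sup_norm F / sup_norm G)"


section \<open>Completions\<close>

text \<open>The completion of a subfield \<open>S\<close> with respect to an absolute value \<open>N\<close>: Cauchy sequences
  modulo null sequences.\<close>

definition cauchy_seqs :: "'a::field set \<Rightarrow> ('a \<Rightarrow> real) \<Rightarrow> (nat \<Rightarrow> 'a) set" where
  "cauchy_seqs S N =
     {s. range s \<subseteq> S \<and> (\<forall>e>0. \<exists>M. \<forall>m\<ge>M. \<forall>n\<ge>M. N (s m - s n) < e)}"

definition null_seqs :: "'a::field set \<Rightarrow> ('a \<Rightarrow> real) \<Rightarrow> (nat \<Rightarrow> 'a) set" where
  "null_seqs S N = {s \<in> cauchy_seqs S N. (\<lambda>n. N (s n)) \<longlonglongrightarrow> 0}"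

definition cauchy_ring :: "'a::field set \<Rightarrow> ('a \<Rightarrow> real) \<Rightarrow> (nat \<Rightarrow> 'a) ring" where
  "cauchy_ring S N =
     \<lparr>carrier = cauchy_seqs S N, monoid.mult = (\<lambda>s t n. s n * t n), one = (\<lambda>_. 1),
      ring.zero = (\<lambda>_. 0), add = (\<lambda>s t n. s n + t n)\<rparr>"

definition valued_completion :: "'a::field set \<Rightarrow> ('a \<Rightarrow> real) \<Rightarrow> (nat \<Rightarrow> 'a) set ring" where
  "valued_completion S N = cauchy_ring S N Quot null_seqs S N"

definition seq_class :: "'a::field set \<Rightarrow> ('a \<Rightarrow> real) \<Rightarrow> (nat \<Rightarrow> 'a) \<Rightarrow> (nat \<Rightarrow> 'a) set" where
  "seq_class S N s = null_seqs S N +>\<^bsub>cauchy_ring S N\<^esub> s"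


section \<open>Analytic elements and algebraic independence\<close>

text \<open>The common field containing the analytic elements and the bounded power series is the
  completion of the field of quotients of bounded power series for the Gauss norm. (It is the
  field of bounded two-sided Laurent series whose coefficients tend to 0 at minus infinity.)
  Since the Gauss norm there extends the one of \<open>K(z)\<close>, the classes of Cauchy sequences of
  rational functions form the completion of \<open>K(z)\<close>; an analytic element without poles in the
  open unit disc is thereby identified with its power series.\<close>

definition ambient_field :: "'c::ultrametric_field set \<Rightarrow> (nat \<Rightarrow> 'c fls) set ring" where
  "ambient_field K = valued_completion (bounded_quotients K) gauss_norm"

definition embed_ambient :: "'c::ultrametric_field set \<Rightarrow> 'c fls \<Rightarrow> (nat \<Rightarrow> 'c fls) set" where
  "embed_ambient K f = seq_class (bounded_quotients K) gauss_norm (\<lambda>_. f)"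

definition analytic_elements :: "'c::ultrametric_field set \<Rightarrow> (nat \<Rightarrow> 'c fls) set set" where
  "analytic_elements K =
     seq_class (bounded_quotients K) gauss_norm ` cauchy_seqs (rational_functions K) gauss_norm"

text \<open>Algebraic independence of the pair \<open>x\<close>, \<open>y\<close> of elements of \<open>L\<close> over the subset \<open>E\<close>;
  \<open>c (i, j)\<close> is the coefficient of the monomial of degree \<open>i\<close> in \<open>x\<close> and \<open>j\<close> in \<open>y\<close>.\<close>

definition alg_independent2 :: "('a, 'b) ring_scheme \<Rightarrow> 'a set \<Rightarrow> 'a \<Rightarrow> 'a \<Rightarrow> bool" where
  "alg_independent2 L E x y \<longleftrightarrow>
     (\<forall>I c. finite I \<and> c \<in> I \<rightarrow> E \<and>
        finsum L (\<lambda>(i, j). c (i, j) \<otimes>\<^bsub>L\<^esub> (x [^]\<^bsub>L\<^esub> (i::nat)) \<otimes>\<^bsub>L\<^esub> (y [^]\<^bsub>L\<^esub> (j::nat))) I = \<zero>\<^bsub>L\<^esub>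
        \<longrightarrow> (\<forall>ij\<in>I. c ij = \<zero>\<^bsub>L\<^esub>))"

definition alg_independent_over_analytic ::
    "'c::ultrametric_field set \<Rightarrow> 'c fps \<Rightarrow> 'c fps \<Rightarrow> bool" where
  "alg_independent_over_analytic K f g \<longleftrightarrow>
     alg_independent2 (ambient_field K) (analytic_elements K)
       (embed_ambient K (fps_to_fls f)) (embed_ambient K (fps_to_fls g))"


section \<open>The three power series\<close>

definition h_series :: "'c::field_char_0 fps" where
  "h_series = Abs_fps (\<lambda>n. 1 / 64 ^ n * of_nat ((2 * n) choose n) ^ 3)"

definition f_series :: "'c::field_char_0 fps" where
  "f_series = Abs_fps (\<lambda>n. - 1 / ((2 * of_nat n - 1) * 64 ^ n) * of_nat ((2 * n) choose n) ^ 3)"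

definition A_series :: "'c::field_char_0 fps" where
  "A_series = Abs_fps (\<lambda>n. \<Sum>k=0..n. of_nat (n choose k) ^ 2 * of_nat ((n + k) choose k) ^ 2)"


section \<open>The Gauss norm is well defined\<close>

lemma ultra_absval_zero [simp]: "absval (0::'c::ultrametric_field) = 0"
  using dist_absval[of "0::'c" 0] by simp

lemma ultra_absval_eq_0 [simp]: "absval (x::'c::ultrametric_field) = 0 \<longleftrightarrow> x = 0"
  using dist_absval[of x 0] by (metis diff_zero dist_eq_0_iff)

lemma ultra_absval_ge_0 [simp]: "0 \<le> absval (x::'c::ultrametric_field)"
  using dist_absval[of x 0] by (metis diff_zero zero_le_dist)

lemma ultra_absval_minus [simp]: "absval (- x) = absval (x::'c::ultrametric_field)"
  by (metis diff_0 diff_zero dist_commute dist_absval)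

lemma ultra_absval_sum_less:
  fixes f :: "'a \<Rightarrow> 'c::ultrametric_field"
  assumes "finite A" "0 < B" "\<And>x. x \<in> A \<Longrightarrow> absval (f x) < B"
  shows "absval (sum f A) < B"
  using assms
proof (induction A rule: finite_induct)
  case (insert x A)
  then show ?case
    using ultrametric_absval_add[of "f x" "sum f A"] by fastforce
qed auto

lemma ultra_absval_sum_le:
  fixes f :: "'a \<Rightarrow> 'c::ultrametric_field"
  assumes "finite A" "0 \<le> B" "\<And>x. x \<in> A \<Longrightarrow> absval (f x) \<le> B"
  shows "absval (sum f A) \<le> B"
  using assms
proof (induction A rule: finite_induct)
  case (insert x A)
  then show ?case
    using ultrametric_absval_add[of "f x" "sum f A"] by fastforce
qed auto

lemma ultra_absval_add_eq:
  fixes x y :: "'c::ultrametric_field"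
  assumes "absval y < absval x"
  shows "absval (x + y) = absval x"
  using assms ultrametric_absval_add[of x y] ultrametric_absval_add[of "x + y" "- y"] by auto

lemma sup_norm_upper:
  assumes "F \<in> bounded_series K"
  shows "absval (fps_nth F n) \<le> sup_norm F"
  using assms unfolding bounded_series_def sup_norm_def by (auto intro: cSUP_upper)

lemma sup_norm_least:
  assumes "\<And>n. absval (fps_nth F n) \<le> B"
  shows "sup_norm F \<le> B"
  unfolding sup_norm_def using assms by (intro cSUP_least) auto

lemma sup_norm_pos:
  assumes "F \<in> bounded_series K" "F \<noteq> 0"
  shows "0 < sup_norm F"
proof -
  obtain n where "fps_nth F n \<noteq> 0"
    using assms(2) by (auto simp: fps_eq_iff)
  then have "0 < absval (fps_nth F n)"
    using ultra_absval_ge_0[of "fps_nth F n"] ultra_absval_eq_0[of "fps_nth F n"] by linarith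
  then show ?thesis
    using sup_norm_upper[OF assms(1), of n] by linarith
qed

lemma weighted_first_max:
  fixes F :: "'c::ultrametric_field fps" and r :: real
  assumes F: "F \<in> bounded_series K" "F \<noteq> 0" and r: "0 < r" "r < 1"
  shows "\<exists>i. (\<forall>k. absval (fps_nth F k) * r ^ k \<le> absval (fps_nth F i) * r ^ i) \<and>
             (\<forall>k<i. absval (fps_nth F k) * r ^ k < absval (fps_nth F i) * r ^ i) \<and>
             0 < absval (fps_nth F i) * r ^ i"
proof -
  define w where "w k = absval (fps_nth F k) * r ^ k" for k
  have w0: "0 \<le> w k" for k using r by (simp add: w_def)
  obtain m where m: "fps_nth F m \<noteq> 0"
    using F(2) by (auto simp: fps_eq_iff)
  have "w m \<noteq> 0" using m r by (simp add: w_def)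
  then have wm: "0 < w m" using w0[of m] by linarith
  have "(\<lambda>k. sup_norm F * r ^ k) \<longlonglongrightarrow> sup_norm F * 0"
    using r by (intro tendsto_mult tendsto_const LIMSEQ_realpow_zero) auto
  then have "\<forall>\<^sub>F k in sequentially. sup_norm F * r ^ k < w m"
    using wm by (intro order_tendstoD(2)) auto
  then obtain N where N: "\<And>k. k \<ge> N \<Longrightarrow> sup_norm F * r ^ k < w m"
    unfolding eventually_sequentially by blast
  have big: "w k < w m" if "k \<ge> N" for k
  proof -
    have "w k \<le> sup_norm F * r ^ k"
      unfolding w_def using r by (intro mult_right_mono sup_norm_upper[OF F(1)]) auto
    then show ?thesis using N[OF that] by linarith
  qed
  define M where "M = Max (w ` {..max N m})"
  have Min: "M \<in> w ` {..max N m}" unfolding M_def by (intro Max_in) auto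
  have le: "w k \<le> M" for k
  proof (cases "k \<le> max N m")
    case True
    then show ?thesis unfolding M_def by (intro Max_ge) auto
  next
    case False
    then have "w k < w m" using big by auto
    moreover have "w m \<le> M" unfolding M_def by (intro Max_ge) auto
    ultimately show ?thesis by linarith
  qed
  define i where "i = (LEAST k. w k = M)"
  have wi: "w i = M"
    unfolding i_def using Min by (metis (mono_tags, lifting) LeastI imageE)
  have "w k < w i" if "k < i" for k
    using le[of k] not_less_Least[of k "\<lambda>k. w k = M"] that wi unfolding i_def by force
  moreover have "w k \<le> w i" for k using le wi by simp
  moreover have "0 < w i" using wm le[of m] wi by linarith
  ultimately show ?thesis unfolding w_def by blast
qed

lemma sup_norm_mult:
  fixes F G :: "'c::ultrametric_field fps"
  assumes F: "F \<in> bounded_series UNIV" and G: "G \<in> bounded_series UNIV"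
  shows "F * G \<in> bounded_series UNIV" "sup_norm (F * G) = sup_norm F * sup_norm G"
proof -
  have nn: "0 \<le> sup_norm F" "0 \<le> sup_norm G"
    using sup_norm_upper[OF F, of 0] sup_norm_upper[OF G, of 0]
      ultra_absval_ge_0[of "fps_nth F 0"] ultra_absval_ge_0[of "fps_nth G 0"] by linarith+
  have up: "absval (fps_nth (F * G) n) \<le> sup_norm F * sup_norm G" for n
    unfolding fps_mult_nth using nn
    by (intro ultra_absval_sum_le)
       (auto simp: ultrametric_absval_mult intro!: mult_mono sup_norm_upper[OF F] sup_norm_upper[OF G])
  show FG: "F * G \<in> bounded_series UNIV"
    unfolding bounded_series_def using up by (auto intro!: bdd_aboveI)
  have le: "sup_norm (F * G) \<le> sup_norm F * sup_norm G"
    by (rule sup_norm_least) (rule up)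
  have ge: "sup_norm F * sup_norm G \<le> sup_norm (F * G)"
  proof (cases "F = 0 \<or> G = 0")
    case True
    then show ?thesis by (auto simp: sup_norm_def)
  next
    case False
    then have F0: "F \<noteq> 0" and G0: "G \<noteq> 0" by auto
    have key: "absval (fps_nth F m) * r ^ m * (absval (fps_nth G n) * r ^ n) \<le> sup_norm (F * G)"
      if r: "0 < r" "r < 1" for r m n
    proof -
      obtain i where i: "\<And>k. absval (fps_nth F k) * r ^ k \<le> absval (fps_nth F i) * r ^ i"
        "\<And>k. k < i \<Longrightarrow> absval (fps_nth F k) * r ^ k < absval (fps_nth F i) * r ^ i"
        "0 < absval (fps_nth F i) * r ^ i"
        using weighted_first_max[OF F F0 r] by blast
      obtain j where j: "\<And>k. absval (fps_nth G k) * r ^ k \<le> absval (fps_nth G j) * r ^ j"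
        "\<And>k. k < j \<Longrightarrow> absval (fps_nth G k) * r ^ k < absval (fps_nth G j) * r ^ j"
        "0 < absval (fps_nth G j) * r ^ j"
        using weighted_first_max[OF G G0 r] by blast
      define T where "T k = fps_nth F k * fps_nth G (i + j - k)" for k
      have rij: "0 < r ^ (i + j)" using r by simp
      have small: "absval (T k) < absval (T i)" if k: "k \<in> {0..i+j} - {i}" for k
      proof -
        have pw: "r ^ (i + j) = r ^ k * r ^ (i + j - k)"
          using k by (simp flip: power_add)
        have e1: "absval (T k) * r ^ (i + j) =
            (absval (fps_nth F k) * r ^ k) * (absval (fps_nth G (i + j - k)) * r ^ (i + j - k))"
          unfolding T_def pw ultrametric_absval_mult by (simp add: mult_ac)
        have e2: "absval (T i) * r ^ (i + j) =
            (absval (fps_nth F i) * r ^ i) * (absval (fps_nth G j) * r ^ j)"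
          unfolding T_def ultrametric_absval_mult power_add by (simp add: mult_ac)
        have "absval (T k) * r ^ (i + j) < absval (T i) * r ^ (i + j)"
        proof (cases "k < i")
          case True
          have "absval (T k) * r ^ (i + j) \<le>
              (absval (fps_nth F k) * r ^ k) * (absval (fps_nth G j) * r ^ j)"
            unfolding e1 using r by (intro mult_left_mono j(1)) auto
          also have "\<dots> < absval (T i) * r ^ (i + j)"
            unfolding e2 by (intro mult_strict_right_mono i(2) True j(3))
          finally show ?thesis .
        next
          case False
          then have lt: "i + j - k < j" using k by auto
          have "absval (T k) * r ^ (i + j) \<le>
              (absval (fps_nth F i) * r ^ i) * (absval (fps_nth G (i + j - k)) * r ^ (i + j - k))"
            unfolding e1 using r by (intro mult_right_mono i(1)) auto
          also have "\<dots> < absval (T i) * r ^ (i + j)"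
            unfolding e2 by (intro mult_strict_left_mono j(2) lt i(3))
          finally show ?thesis .
        qed
        then show ?thesis using rij by simp
      qed
      have Ti: "absval (T i) * r ^ (i + j) =
          (absval (fps_nth F i) * r ^ i) * (absval (fps_nth G j) * r ^ j)"
        unfolding T_def ultrametric_absval_mult power_add by (simp add: mult_ac)
      have "0 < absval (T i) * r ^ (i + j)"
        unfolding Ti using i(3) j(3) by simp
      then have Tpos: "0 < absval (T i)"
        using zero_less_mult_pos2[OF _ rij] by blast
      have "fps_nth (F * G) (i + j) = T i + sum T ({0..i+j} - {i})"
        unfolding fps_mult_nth T_def[symmetric] by (subst sum.remove[of _ i]) auto
      moreover have "absval (sum T ({0..i+j} - {i})) < absval (T i)"
        using Tpos small by (intro ultra_absval_sum_less) auto
      ultimately have eq: "absval (fps_nth (F * G) (i + j)) = absval (T i)"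
        by (simp add: ultra_absval_add_eq)
      have "absval (fps_nth F m) * r ^ m * (absval (fps_nth G n) * r ^ n)
          \<le> absval (T i) * r ^ (i + j)"
        unfolding Ti by (rule mult_mono[OF i(1) j(1)]) (use i(3) r in auto)
      also have "\<dots> \<le> absval (T i) * 1"
        using r by (intro mult_left_mono power_le_one) auto
      also have "\<dots> \<le> sup_norm (F * G)"
        using sup_norm_upper[OF FG, of "i + j"] eq by simp
      finally show ?thesis .
    qed
    have prod: "absval (fps_nth F m) * absval (fps_nth G n) \<le> sup_norm (F * G)" for m n
    proof -
      have "((\<lambda>r. absval (fps_nth F m) * r ^ m * (absval (fps_nth G n) * r ^ n)) \<longlongrightarrow>
          absval (fps_nth F m) * 1 ^ m * (absval (fps_nth G n) * 1 ^ n)) (at_left (1::real))"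
        by (intro tendsto_intros)
      moreover have "\<forall>\<^sub>F r in at_left (1::real).
          absval (fps_nth F m) * r ^ m * (absval (fps_nth G n) * r ^ n) \<le> sup_norm (F * G)"
        by (rule eventually_mono[OF eventually_at_left_real[OF zero_less_one]]) (use key in auto)
      ultimately show ?thesis
        using tendsto_upperbound[of _ _ "at_left (1::real)"] by fastforce
    qed
    have Gp: "0 < sup_norm G" using sup_norm_pos[OF G G0] .
    have "absval (fps_nth F m) * sup_norm G \<le> sup_norm (F * G)" for m
    proof (cases "fps_nth F m = 0")
      case True
      then show ?thesis
        using order_trans[OF ultra_absval_ge_0 sup_norm_upper[OF FG, of 0]] by simp
    next
      case False
      then have p: "0 < absval (fps_nth F m)"
        by (metis order_le_less ultra_absval_eq_0 ultra_absval_ge_0)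
      have "sup_norm G \<le> sup_norm (F * G) / absval (fps_nth F m)"
        using prod[of m] p by (intro sup_norm_least) (simp add: field_simps)
      then show ?thesis using p by (simp add: field_simps)
    qed
    then have "sup_norm F \<le> sup_norm (F * G) / sup_norm G"
      using Gp by (intro sup_norm_least) (simp add: field_simps)
    then show ?thesis using Gp by (simp add: field_simps)
  qed
  show "sup_norm (F * G) = sup_norm F * sup_norm G"
    using le ge by (rule antisym)
qed

lemma gauss_norm_quotient:
  fixes F G :: "'c::ultrametric_field fps"
  assumes F: "F \<in> bounded_series UNIV" and G: "G \<in> bounded_series UNIV" and G0: "G \<noteq> 0"
  shows "gauss_norm (fps_to_fls F / fps_to_fls G) = sup_norm F / sup_norm G"
  unfolding gauss_norm_def
proof (rule the_equality)
  fix r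
  assume "\<exists>F'\<in>bounded_series UNIV. \<exists>G'\<in>bounded_series UNIV. G' \<noteq> 0 \<and>
    fps_to_fls F / fps_to_fls G = fps_to_fls F' / fps_to_fls G' \<and> r = sup_norm F' / sup_norm G'"
  then obtain F' G' where F': "F' \<in> bounded_series UNIV" and G': "G' \<in> bounded_series UNIV"
    and G0': "G' \<noteq> 0" and eq: "fps_to_fls F / fps_to_fls G = fps_to_fls F' / fps_to_fls G'"
    and r: "r = sup_norm F' / sup_norm G'" by blast
  have "fps_to_fls F * fps_to_fls G' = fps_to_fls F' * fps_to_fls G"
    using eq G0 G0' by (simp add: frac_eq_eq)
  then have "F * G' = F' * G"
    by (simp flip: fls_times_fps_to_fls)
  then have "sup_norm F * sup_norm G' = sup_norm F' * sup_norm G"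
    using sup_norm_mult(2)[OF F G'] sup_norm_mult(2)[OF F' G] by simp
  then show "r = sup_norm F / sup_norm G"
    unfolding r using sup_norm_pos[OF G G0] sup_norm_pos[OF G' G0'] by (simp add: field_simps)
qed (use assms in blast)

lemma fps_of_poly_bounded:
  fixes P :: "'c::ultrametric_field poly"
  shows "fps_of_poly P \<in> bounded_series UNIV"
    and "sup_norm (fps_of_poly P) = (MAX i\<in>{..Polynomial.degree P}. absval (poly.coeff P i))"
proof -
  let ?M = "MAX i\<in>{..Polynomial.degree P}. absval (poly.coeff P i)"
  have in_le: "absval (poly.coeff P i) \<le> ?M" if "i \<le> Polynomial.degree P" for i
    using that by (intro Max_ge) auto
  have le: "absval (fps_nth (fps_of_poly P) i) \<le> ?M" for i
  proof (cases "i \<le> Polynomial.degree P")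
    case False
    then have "poly.coeff P i = 0" by (simp add: coeff_eq_0)
    moreover have "0 \<le> ?M"
      using in_le[of 0] ultra_absval_ge_0[of "poly.coeff P 0"] by linarith
    ultimately show ?thesis by simp
  qed (use in_le in auto)
  show b: "fps_of_poly P \<in> bounded_series UNIV"
    unfolding bounded_series_def using le by (auto intro!: bdd_aboveI)
  have "?M \<in> (\<lambda>i. absval (poly.coeff P i)) ` {..Polynomial.degree P}"
    by (intro Max_in) auto
  then obtain i where "?M = absval (poly.coeff P i)" by (rule imageE)
  then show "sup_norm (fps_of_poly P) = ?M"
    using sup_norm_upper[OF b, of i] by (intro antisym sup_norm_least le) simp
qed

lemma gauss_norm_rational:
  fixes P Q :: "'c::ultrametric_field poly"
  assumes "Q \<noteq> 0"
  shows "gauss_norm (poly_to_fls P / poly_to_fls Q) =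
    (MAX i\<in>{..Polynomial.degree P}. absval (poly.coeff P i)) / (MAX j\<in>{..Polynomial.degree Q}. absval (poly.coeff Q j))"
  unfolding poly_to_fls_def
  using gauss_norm_quotient[OF fps_of_poly_bounded(1) fps_of_poly_bounded(1)] assms
  by (simp add: fps_of_poly_bounded(2))

section \<open>The ambient ring is a field containing the bounded power series\<close>

locale valued_subfield =
  fixes S :: "'a::Fields.field set" and N :: "'a \<Rightarrow> real"
  assumes one_S: "1 \<in> S" and diff_S: "x \<in> S \<Longrightarrow> y \<in> S \<Longrightarrow> x - y \<in> S"
    and mult_S: "x \<in> S \<Longrightarrow> y \<in> S \<Longrightarrow> x * y \<in> S" and inverse_S: "x \<in> S \<Longrightarrow> inverse x \<in> S"
    and N_eq_0: "x \<in> S \<Longrightarrow> N x = 0 \<longleftrightarrow> x = 0"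
    and N_mult: "x \<in> S \<Longrightarrow> y \<in> S \<Longrightarrow> N (x * y) = N x * N y"
    and N_diff: "x \<in> S \<Longrightarrow> y \<in> S \<Longrightarrow> N (x - y) \<le> N x + N y"
begin

lemma zero_S: "0 \<in> S" using diff_S[OF one_S one_S] by simp
lemma minus_S: "x \<in> S \<Longrightarrow> - x \<in> S" using diff_S[OF zero_S] by force
lemma add_S: "x \<in> S \<Longrightarrow> y \<in> S \<Longrightarrow> x + y \<in> S" using diff_S[of x "- y"] minus_S by force
lemma N_0: "N 0 = 0" using N_eq_0[OF zero_S] by simp
lemma N_ge_0: "x \<in> S \<Longrightarrow> 0 \<le> N x" using N_diff[of x x] N_0 by force
lemma N_1: "N 1 = 1" using N_mult[OF one_S one_S] N_eq_0[OF one_S] by simp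
lemma N_minus: assumes "x \<in> S" shows "N (- x) = N x"
  using N_diff[OF zero_S assms] N_diff[OF zero_S minus_S[OF assms]] N_0 by simp
lemma N_add: "x \<in> S \<Longrightarrow> y \<in> S \<Longrightarrow> N (x + y) \<le> N x + N y"
  using N_diff[of x "- y"] minus_S N_minus by force
lemma N_commute: "x \<in> S \<Longrightarrow> y \<in> S \<Longrightarrow> N (x - y) = N (y - x)"
  using N_minus[OF diff_S[of x y]] by simp
lemma N_inverse: assumes "x \<in> S" shows "N (inverse x) = inverse (N x)"
proof (cases "x = 0")
  case False
  then show ?thesis using N_mult[OF assms inverse_S[OF assms]] N_1 by (metis inverse_unique right_inverse)
qed (simp add: N_0)

abbreviation "C \<equiv> cauchy_seqs S N"
abbreviation "Z \<equiv> null_seqs S N"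
abbreviation "R \<equiv> cauchy_ring S N"

lemma C_S: "s \<in> C \<Longrightarrow> s n \<in> S" unfolding cauchy_seqs_def by auto
lemma C_D: "s \<in> C \<Longrightarrow> e > 0 \<Longrightarrow> \<exists>M. \<forall>m\<ge>M. \<forall>n\<ge>M. N (s m - s n) < e"
  unfolding cauchy_seqs_def by auto
lemma C_I: "(\<And>n. s n \<in> S) \<Longrightarrow> (\<And>e. e > 0 \<Longrightarrow> \<exists>M. \<forall>m\<ge>M. \<forall>n\<ge>M. N (s m - s n) < e) \<Longrightarrow> s \<in> C"
  unfolding cauchy_seqs_def by auto

lemma C_const: "x \<in> S \<Longrightarrow> (\<lambda>_. x) \<in> C" by (rule C_I) (auto simp: N_0)

lemma C_add: assumes "s \<in> C" "t \<in> C" shows "(\<lambda>n. s n + t n) \<in> C"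
proof (rule C_I)
  fix e :: real assume e: "e > 0"
  obtain M1 where M1: "\<forall>m\<ge>M1. \<forall>n\<ge>M1. N (s m - s n) < e/2" using C_D[OF assms(1)] e half_gt_zero by blast
  obtain M2 where M2: "\<forall>m\<ge>M2. \<forall>n\<ge>M2. N (t m - t n) < e/2" using C_D[OF assms(2)] e half_gt_zero by blast
  have "N (s m + t m - (s n + t n)) < e" if "m \<ge> max M1 M2" "n \<ge> max M1 M2" for m n
  proof -
    have "N ((s m - s n) + (t m - t n)) \<le> N (s m - s n) + N (t m - t n)"
      by (intro N_add diff_S C_S assms)
    also have "\<dots> < e" using M1 M2 that by (smt (verit) field_sum_of_halves max.boundedE)
    finally show ?thesis by (simp add: algebra_simps)
  qed
  then show "\<exists>M. \<forall>m\<ge>M. \<forall>n\<ge>M. N (s m + t m - (s n + t n)) < e" by blast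
qed (use assms C_S add_S in auto)

lemma C_bounded: assumes "s \<in> C" shows "\<exists>B>0. \<forall>n. N (s n) \<le> B"
proof -
  obtain M where M: "\<forall>m\<ge>M. \<forall>n\<ge>M. N (s m - s n) < 1" using C_D[OF assms] zero_less_one by blast
  define B where "B = Max ((\<lambda>n. N (s n)) ` {..M}) + 1"
  have a: "N (s n) \<le> B - 1" if "n \<le> M" for n unfolding B_def using that by (simp add: Max_ge)
  have "N (s n) \<le> B" for n
  proof (cases "n \<le> M")
    case False
    have "N (s M + (s n - s M)) \<le> N (s M) + N (s n - s M)" by (intro N_add diff_S C_S assms)
    moreover have "N (s n - s M) < 1" using M False by auto
    ultimately show ?thesis using a[of M] by simp
  qed (use a[of n] in simp)
  moreover have "B > 0" using a[of 0] N_ge_0[OF C_S[OF assms]] by (smt (verit) le0)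
  ultimately show ?thesis by blast
qed

lemma C_mult: assumes "s \<in> C" "t \<in> C" shows "(\<lambda>n. s n * t n) \<in> C"
proof (rule C_I)
  fix e :: real assume e: "e > 0"
  obtain B1 where B1: "B1 > 0" "\<And>n. N (s n) \<le> B1" using C_bounded[OF assms(1)] by blast
  obtain B2 where B2: "B2 > 0" "\<And>n. N (t n) \<le> B2" using C_bounded[OF assms(2)] by blast
  have p: "e / (2*B2) > 0" "e / (2*B1) > 0" using e B1 B2 by auto
  obtain M1 where M1: "\<forall>m\<ge>M1. \<forall>n\<ge>M1. N (s m - s n) < e/(2*B2)" using C_D[OF assms(1) p(1)] by blast
  obtain M2 where M2: "\<forall>m\<ge>M2. \<forall>n\<ge>M2. N (t m - t n) < e/(2*B1)" using C_D[OF assms(2) p(2)] by blast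
  have "N (s m * t m - s n * t n) < e" if "m \<ge> max M1 M2" "n \<ge> max M1 M2" for m n
  proof -
    have "N (s m * (t m - t n) + (s m - s n) * t n) \<le> N (s m * (t m - t n)) + N ((s m - s n) * t n)"
      by (intro N_add mult_S diff_S C_S assms)
    also have "\<dots> = N (s m) * N (t m - t n) + N (s m - s n) * N (t n)"
      by (simp add: N_mult diff_S C_S assms)
    also have "N (s m) * N (t m - t n) \<le> B1 * N (t m - t n)"
      by (intro mult_right_mono B1 N_ge_0 diff_S C_S assms)
    also have "N (s m - s n) * N (t n) \<le> N (s m - s n) * B2"
      by (intro mult_left_mono B2 N_ge_0 diff_S C_S assms)
    also have "B1 * N (t m - t n) < e / 2"
      using M2 that B1(1) by (simp add: field_simps)
    also have "N (s m - s n) * B2 < e / 2"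
      using M1 that B2(1) by (simp add: field_simps)
    finally show ?thesis by (simp add: algebra_simps)
  qed
  then show "\<exists>M. \<forall>m\<ge>M. \<forall>n\<ge>M. N (s m * t m - s n * t n) < e" by blast
qed (use assms C_S mult_S in auto)

lemma C_minus: "s \<in> C \<Longrightarrow> (\<lambda>n. - s n) \<in> C"
  using C_mult[OF C_const[OF minus_S[OF one_S]]] by force

lemma R_simps: "carrier R = C" "s \<oplus>\<^bsub>R\<^esub> t = (\<lambda>n. s n + t n)" "s \<otimes>\<^bsub>R\<^esub> t = (\<lambda>n. s n * t n)"
  "\<zero>\<^bsub>R\<^esub> = (\<lambda>_. 0)" "\<one>\<^bsub>R\<^esub> = (\<lambda>_. 1)"
  by (simp_all add: cauchy_ring_def)

lemma cring_R: "cring R"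
proof (rule cringI)
  show "abelian_group R"
  proof (rule abelian_groupI)
    fix s assume "s \<in> carrier R"
    then show "\<exists>y\<in>carrier R. y \<oplus>\<^bsub>R\<^esub> s = \<zero>\<^bsub>R\<^esub>"
      using C_minus by (intro bexI[of _ "\<lambda>n. - s n"]) (auto simp: R_simps)
  qed (auto simp: R_simps C_add C_const zero_S algebra_simps)
  show "Group.comm_monoid R"
    by (rule comm_monoidI) (auto simp: R_simps C_mult C_const one_S algebra_simps)
qed (auto simp: R_simps algebra_simps)

lemma Z_add: assumes "s \<in> Z" "t \<in> Z" shows "(\<lambda>n. s n + t n) \<in> Z"
proof -
  have st: "s \<in> C" "t \<in> C" "(\<lambda>n. N (s n)) \<longlonglongrightarrow> 0" "(\<lambda>n. N (t n)) \<longlonglongrightarrow> 0"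
    using assms by (auto simp: null_seqs_def)
  have "(\<lambda>n. N (s n) + N (t n)) \<longlonglongrightarrow> 0" using tendsto_add[OF st(3,4)] by simp
  then have "(\<lambda>n. N (s n + t n)) \<longlonglongrightarrow> 0"
    by (rule tendsto_sandwich[OF _ _ tendsto_const, rotated 2])
       (auto intro!: always_eventually N_ge_0[OF add_S[OF C_S[OF st(1)] C_S[OF st(2)]]] N_add[OF C_S[OF st(1)] C_S[OF st(2)]])
  then show ?thesis using C_add[OF st(1,2)] unfolding null_seqs_def by blast
qed

lemma Z_mult: assumes "s \<in> Z" "t \<in> C" shows "(\<lambda>n. t n * s n) \<in> Z"
proof -
  have st: "s \<in> C" "(\<lambda>n. N (s n)) \<longlonglongrightarrow> 0" using assms by (auto simp: null_seqs_def)
  obtain B where B: "B > 0" "\<And>n. N (t n) \<le> B" using C_bounded[OF assms(2)] by blast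
  have le: "N (t n * s n) \<le> B * N (s n)" for n
    unfolding N_mult[OF C_S[OF assms(2)] C_S[OF st(1)]] by (intro mult_right_mono B N_ge_0 C_S st)
  have "(\<lambda>n. B * N (s n)) \<longlonglongrightarrow> 0" using tendsto_mult[OF tendsto_const[of B] st(2)] by simp
  then have "(\<lambda>n. N (t n * s n)) \<longlonglongrightarrow> 0"
    by (rule tendsto_sandwich[OF _ _ tendsto_const, rotated 2])
       (auto intro!: always_eventually N_ge_0[OF mult_S[OF C_S[OF assms(2)] C_S[OF st(1)]]] le)
  then show ?thesis using C_mult[OF assms(2) st(1)] unfolding null_seqs_def by blast
qed

lemma ideal_Z: "ideal Z R"
proof (rule idealI)
  show "ring R" using cring_R cring.axioms(1) by blast
  then interpret R: ring R .
  show "subgroup Z (add_monoid R)"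
  proof (rule group.subgroupI)
    show "Group.group (add_monoid R)" by (rule R.a_group)
    show "Z \<subseteq> carrier (add_monoid R)" by (auto simp: R_simps null_seqs_def)
    show "Z \<noteq> {}" using C_const[OF zero_S] by (auto simp: null_seqs_def N_0 intro!: exI[of _ "\<lambda>_. 0"])
    fix a assume a: "a \<in> Z"
    then have aC: "a \<in> C" by (auto simp: null_seqs_def)
    have "inv\<^bsub>add_monoid R\<^esub> a = (\<lambda>n. - a n)"
      unfolding a_inv_def[symmetric]
      by (rule R.minus_equality) (use C_minus aC in \<open>auto simp: R_simps\<close>)
    moreover have "(\<lambda>n. (-1) * a n) \<in> Z" by (rule Z_mult[OF a C_const[OF minus_S[OF one_S]]])
    ultimately show "inv\<^bsub>add_monoid R\<^esub> a \<in> Z" by simp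
  qed (use Z_add in \<open>auto simp: R_simps\<close>)
next
  fix a x assume "a \<in> Z" "x \<in> carrier R"
  then show "x \<otimes>\<^bsub>R\<^esub> a \<in> Z" "a \<otimes>\<^bsub>R\<^esub> x \<in> Z"
    using Z_mult[of a x] by (auto simp: R_simps mult.commute)
qed


lemma inverse_C: assumes s: "s \<in> C" "s \<notin> Z"
  shows "\<exists>t\<in>C. (\<lambda>n. s n * t n - 1) \<in> Z"
proof -
  have "\<not> (\<lambda>n. N (s n)) \<longlonglongrightarrow> 0" using s by (auto simp: null_seqs_def)
  then obtain e where e: "e > 0" "\<And>M. \<exists>n\<ge>M. e \<le> N (s n)"
    unfolding LIMSEQ_def using N_ge_0[OF C_S[OF s(1)]] by (force simp: not_less)
  obtain M where M: "\<forall>m\<ge>M. \<forall>n\<ge>M. N (s m - s n) < e/2" using C_D[OF s(1)] e half_gt_zero by blast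
  obtain k where k: "k \<ge> M" "e \<le> N (s k)" using e by blast
  have low: "e/2 \<le> N (s n)" if "n \<ge> M" for n
  proof -
    have "N (s n + (s k - s n)) \<le> N (s n) + N (s k - s n)" by (intro N_add diff_S C_S s)
    moreover have "N (s k - s n) < e/2" using M that k by auto
    ultimately show ?thesis using k(2) by (simp add: field_simps)
  qed
  have nz: "s n \<noteq> 0" if "n \<ge> M" for n using low[OF that] e(1) N_0 by auto
  define t where "t n = (if n \<ge> M then inverse (s n) else 0)" for n
  have tS: "t n \<in> S" for n using inverse_S C_S[OF s(1)] zero_S by (auto simp: t_def)
  have tC: "t \<in> C"
  proof (rule C_I)
    fix d :: real assume d: "d > 0"
    have "d * (e/2)^2 > 0" using d e by simp
    then obtain M1 where M1: "\<forall>m\<ge>M1. \<forall>n\<ge>M1. N (s m - s n) < d * (e/2)^2" using C_D[OF s(1)] by blast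
    have "N (t m - t n) < d" if mn: "m \<ge> max M M1" "n \<ge> max M M1" for m n
    proof -
      have "t m - t n = (s n - s m) * (inverse (s m) * inverse (s n))"
        using mn nz by (simp add: t_def field_simps)
      then have "N (t m - t n) = N (s n - s m) * (inverse (N (s m)) * inverse (N (s n)))"
        by (simp add: N_mult N_inverse mult_S inverse_S diff_S C_S s(1))
      also have "\<dots> \<le> N (s n - s m) * (inverse (e/2) * inverse (e/2))"
        using low[of m] low[of n] mn e(1)
        by (intro mult_left_mono mult_mono le_imp_inverse_le N_ge_0 diff_S C_S s(1)) auto
      also have "\<dots> < d * (e/2)^2 * (inverse (e/2) * inverse (e/2))"
        using M1 mn e(1) by (intro mult_strict_right_mono) auto
      also have "\<dots> = d" using e(1) by (simp add: field_simps power2_eq_square)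
      finally show ?thesis .
    qed
    then show "\<exists>M. \<forall>m\<ge>M. \<forall>n\<ge>M. N (t m - t n) < d" by blast
  qed (rule tS)
  have "(\<lambda>n. N (s n * t n - 1)) \<longlonglongrightarrow> 0"
  proof (rule Lim_transform_eventually[OF tendsto_const])
    show "\<forall>\<^sub>F n in sequentially. 0 = N (s n * t n - 1)"
      unfolding eventually_sequentially using nz by (intro exI[of _ M]) (auto simp: t_def N_0)
  qed
  moreover have "(\<lambda>n. s n * t n - 1) \<in> C"
    using C_add[OF C_mult[OF s(1) tC] C_const[OF minus_S[OF one_S]]] by simp
  ultimately show ?thesis using tC by (auto simp: null_seqs_def)
qed

lemma a_minus_R: "s \<in> C \<Longrightarrow> t \<in> C \<Longrightarrow> s \<ominus>\<^bsub>R\<^esub> t = (\<lambda>n. s n - t n)"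
proof -
  assume st: "s \<in> C" "t \<in> C"
  interpret R: cring R by (rule cring_R)
  have "\<ominus>\<^bsub>R\<^esub> t = (\<lambda>n. - t n)"
    by (rule R.minus_equality) (use C_minus st in \<open>auto simp: R_simps\<close>)
  then show ?thesis by (simp add: a_minus_def R_simps)
qed

lemma seq_class_eq_iff:
  "s \<in> C \<Longrightarrow> t \<in> C \<Longrightarrow> seq_class S N s = seq_class S N t \<longleftrightarrow> (\<lambda>n. s n - t n) \<in> Z"
  using ring.quotient_eq_iff_same_a_r_cos[OF cring.axioms(1)[OF cring_R] ideal_Z, of s t] a_minus_R
  by (simp add: seq_class_def R_simps)

lemma seq_class_hom: "seq_class S N \<in> ring_hom R (valued_completion S N)"
  unfolding seq_class_def[abs_def] valued_completion_def by (rule ideal.rcos_ring_hom[OF ideal_Z])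

lemma field_completion: "field (valued_completion S N)"
proof -
  interpret R: cring R by (rule cring_R)
  interpret Q: cring "valued_completion S N"
    unfolding valued_completion_def by (rule ideal.quotient_is_cring[OF ideal_Z cring_R])
  interpret h: ring_hom_cring R "valued_completion S N" "seq_class S N"
    by (unfold_locales) (rule seq_class_hom)
  have zC: "(\<lambda>_. 0) \<in> C" and oC: "(\<lambda>_. 1) \<in> C" using C_const zero_S one_S by auto
  have z: "\<zero>\<^bsub>valued_completion S N\<^esub> = seq_class S N (\<lambda>_. 0)" using h.hom_zero by (simp add: R_simps)
  have o: "\<one>\<^bsub>valued_completion S N\<^esub> = seq_class S N (\<lambda>_. 1)" using h.hom_one by (simp add: R_simps)
  show ?thesis
  proof (rule Q.cring_fieldI2)
    have "\<not> (\<lambda>n::nat. N (0 - 1)) \<longlonglongrightarrow> 0"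
      using N_minus[OF one_S] N_1 by (simp add: LIMSEQ_const_iff)
    then show "\<zero>\<^bsub>valued_completion S N\<^esub> \<noteq> \<one>\<^bsub>valued_completion S N\<^esub>"
      unfolding z o seq_class_eq_iff[OF zC oC] by (simp add: null_seqs_def)
    fix a assume a: "a \<in> carrier (valued_completion S N)" "a \<noteq> \<zero>\<^bsub>valued_completion S N\<^esub>"
    then obtain s where s: "s \<in> C" "a = seq_class S N s"
      unfolding valued_completion_def FactRing_def A_RCOSETS_def' seq_class_def by (auto simp: R_simps)
    have "s \<notin> Z" using a(2) seq_class_eq_iff[OF s(1) zC] unfolding s(2) z by simp
    then obtain t where t: "t \<in> C" "(\<lambda>n. s n * t n - 1) \<in> Z" using inverse_C s by blast
    have "a \<otimes>\<^bsub>valued_completion S N\<^esub> seq_class S N t = seq_class S N (\<lambda>n. s n * t n)"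
      using h.hom_mult[of s t] s t by (simp add: R_simps)
    also have "\<dots> = \<one>\<^bsub>valued_completion S N\<^esub>"
      unfolding o using seq_class_eq_iff[OF C_mult[OF s(1) t(1)] oC] t(2) by simp
    finally show "\<exists>b\<in>carrier (valued_completion S N). a \<otimes>\<^bsub>valued_completion S N\<^esub> b = \<one>\<^bsub>valued_completion S N\<^esub>"
      using h.hom_closed[of t] t(1) by (auto simp: R_simps)
  qed
qed

lemma embed_const: assumes "x \<in> S" "y \<in> S"
  shows "seq_class S N (\<lambda>_. x) = seq_class S N (\<lambda>_. y) \<longleftrightarrow> x = y"
proof -
  have "(\<lambda>_::nat. x - y) \<in> Z \<longleftrightarrow> N (x - y) = 0"
    using C_const[OF diff_S[OF assms]] by (simp add: null_seqs_def LIMSEQ_const_iff)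
  then show ?thesis
    using seq_class_eq_iff[OF C_const C_const, OF assms] N_eq_0[OF diff_S[OF assms]] by simp
qed

end

context
  fixes K :: "'c::ultrametric_field set"
  assumes K: "subfield K (ring_of_type_algebra :: 'c ring)"
begin

lemma K_closed: "0 \<in> K" "1 \<in> K" "x \<in> K \<Longrightarrow> y \<in> K \<Longrightarrow> x + y \<in> K"
  "x \<in> K \<Longrightarrow> y \<in> K \<Longrightarrow> x * y \<in> K" "x \<in> K \<Longrightarrow> - x \<in> K"
proof -
  interpret R: ring "ring_of_type_algebra :: 'c ring" by (rule ring_from_type_algebra)
  have sr: "subring K (ring_of_type_algebra :: 'c ring)" using K by (rule subfieldE(1))
  note E = subringE[OF sr, unfolded ring_of_type_algebra_def, simplified]
  show "0 \<in> K" "1 \<in> K" "x \<in> K \<Longrightarrow> y \<in> K \<Longrightarrow> x + y \<in> K" "x \<in> K \<Longrightarrow> y \<in> K \<Longrightarrow> x * y \<in> K"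
    using E by auto
  have "\<ominus>\<^bsub>ring_of_type_algebra\<^esub> x = - x"
    by (rule R.minus_equality) (auto simp: ring_of_type_algebra_def)
  then show "x \<in> K \<Longrightarrow> - x \<in> K" using subringE(5)[OF sr, of x] by simp
qed

lemma K_sum: "(\<And>i. i \<in> A \<Longrightarrow> f i \<in> K) \<Longrightarrow> sum f A \<in> K"
  by (induction A rule: infinite_finite_induct) (auto simp: K_closed)

lemma bs_UNIV: "F \<in> bounded_series K \<Longrightarrow> F \<in> bounded_series UNIV"
  by (auto simp: bounded_series_def)

lemma bs_mult: "F \<in> bounded_series K \<Longrightarrow> G \<in> bounded_series K \<Longrightarrow> F * G \<in> bounded_series K"
  using sup_norm_mult(1)[OF bs_UNIV bs_UNIV, of F G]
  by (auto simp: bounded_series_def fps_mult_nth intro!: K_sum K_closed)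

lemma bs_diff: "F \<in> bounded_series K \<Longrightarrow> G \<in> bounded_series K \<Longrightarrow>
  F - G \<in> bounded_series K \<and> sup_norm (F - G) \<le> max (sup_norm F) (sup_norm G)"
proof -
  assume FG: "F \<in> bounded_series K" "G \<in> bounded_series K"
  have le: "absval (fps_nth (F - G) n) \<le> max (sup_norm F) (sup_norm G)" for n
    using ultrametric_absval_add[of "fps_nth F n" "- fps_nth G n"]
      sup_norm_upper[OF FG(1), of n] sup_norm_upper[OF FG(2), of n] by auto
  have "fps_nth (F - G) n \<in> K" for n
    using K_closed(3)[of "fps_nth F n" "- fps_nth G n"] K_closed(5) FG by (auto simp: bounded_series_def)
  then show ?thesis using le
    by (auto simp: bounded_series_def intro!: bdd_aboveI sup_norm_least)
qed

lemma bs_1: "1 \<in> bounded_series K"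
  by (auto simp: bounded_series_def K_closed intro!: bdd_aboveI[of _ "absval (1::'c)"])

lemma bq_D: "f \<in> bounded_quotients K \<Longrightarrow> \<exists>F G. F \<in> bounded_series K \<and> G \<in> bounded_series K \<and> G \<noteq> 0 \<and>
    f = fps_to_fls F / fps_to_fls G \<and> gauss_norm f = sup_norm F / sup_norm G"
  unfolding bounded_quotients_def using gauss_norm_quotient[OF bs_UNIV bs_UNIV] by blast

lemma bq_I: "F \<in> bounded_series K \<Longrightarrow> G \<in> bounded_series K \<Longrightarrow> G \<noteq> 0 \<Longrightarrow>
  fps_to_fls F / fps_to_fls G \<in> bounded_quotients K"
  unfolding bounded_quotients_def by blast

lemma valued_subfield_bq: "valued_subfield (bounded_quotients K) gauss_norm"
proof
  show "1 \<in> bounded_quotients K" using bq_I[OF bs_1 bs_1] by simp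
  fix x assume "x \<in> bounded_quotients K"
  then obtain F G where x: "F \<in> bounded_series K" "G \<in> bounded_series K" "G \<noteq> 0"
    "x = fps_to_fls F / fps_to_fls G" "gauss_norm x = sup_norm F / sup_norm G" using bq_D by blast
  show "inverse x \<in> bounded_quotients K"
  proof (cases "F = 0")
    case True
    then show ?thesis using x bq_I[of 0 G] by (auto simp: bounded_quotients_def)
  next
    case False
    then show ?thesis using x bq_I[of G F] by simp
  qed
  show "gauss_norm x = 0 \<longleftrightarrow> x = 0"
    using x sup_norm_pos[OF x(2,3)] sup_norm_pos[OF x(1)]
    by (cases "F = 0") (auto simp: sup_norm_def)
  fix y assume "y \<in> bounded_quotients K"
  then obtain F' G' where y: "F' \<in> bounded_series K" "G' \<in> bounded_series K" "G' \<noteq> 0"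
    "y = fps_to_fls F' / fps_to_fls G'" "gauss_norm y = sup_norm F' / sup_norm G'" using bq_D by blast
  have xy: "x * y = fps_to_fls (F * F') / fps_to_fls (G * G')"
    unfolding x y by (simp add: fls_times_fps_to_fls)
  show "x * y \<in> bounded_quotients K" unfolding xy using x y by (intro bq_I bs_mult) auto
  show "gauss_norm (x * y) = gauss_norm x * gauss_norm y"
    unfolding xy x(5) y(5)
    using gauss_norm_quotient[OF bs_UNIV bs_UNIV, OF bs_mult bs_mult, OF x(1) y(1) x(2) y(2)] x(3) y(3)
      sup_norm_mult(2)[OF bs_UNIV bs_UNIV, OF x(1) y(1)] sup_norm_mult(2)[OF bs_UNIV bs_UNIV, OF x(2) y(2)]
    by simp
  have d: "x - y = fps_to_fls (F * G' - F' * G) / fps_to_fls (G * G')"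
    unfolding x y using x(3) y(3) by (simp add: fls_times_fps_to_fls diff_frac_eq fps_to_fls_minus)
  note D = bs_diff[OF bs_mult[OF x(1) y(2)] bs_mult[OF y(1) x(2)]]
  show "x - y \<in> bounded_quotients K" unfolding d using x y D by (intro bq_I bs_mult) auto
  have pos: "0 < sup_norm G" "0 < sup_norm G'" using sup_norm_pos x y by auto
  have nn: "0 \<le> sup_norm F" "0 \<le> sup_norm F'"
    using sup_norm_upper[OF x(1), of 0] sup_norm_upper[OF y(1), of 0]
     ultra_absval_ge_0[of "fps_nth F 0"] ultra_absval_ge_0[of "fps_nth F' 0"] by linarith+
  have "gauss_norm (x - y) = sup_norm (F * G' - F' * G) / (sup_norm G * sup_norm G')"
    unfolding d using gauss_norm_quotient[OF bs_UNIV bs_UNIV, OF conjunct1[OF D] bs_mult[OF x(2) y(2)]] x(3) y(3)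
      sup_norm_mult(2)[OF bs_UNIV bs_UNIV, OF x(2) y(2)] by simp
  also have "\<dots> \<le> (sup_norm F * sup_norm G' + sup_norm F' * sup_norm G) / (sup_norm G * sup_norm G')"
  proof (rule divide_right_mono)
    have "0 \<le> sup_norm F * sup_norm G'" "0 \<le> sup_norm F' * sup_norm G" using pos nn by simp_all
    then show "sup_norm (F * G' - F' * G) \<le> sup_norm F * sup_norm G' + sup_norm F' * sup_norm G"
      using D unfolding sup_norm_mult(2)[OF bs_UNIV bs_UNIV, OF x(1) y(2)]
      sup_norm_mult(2)[OF bs_UNIV bs_UNIV, OF y(1) x(2)] by linarith
    show "0 \<le> sup_norm G * sup_norm G'" using pos by simp
  qed
  also have "\<dots> = gauss_norm x + gauss_norm y" unfolding x(5) y(5) using pos by (simp add: add_frac_eq)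
  finally show "gauss_norm (x - y) \<le> gauss_norm x + gauss_norm y" .
qed

lemma field_ambient: "field (ambient_field K)"
  unfolding ambient_field_def by (rule valued_subfield.field_completion[OF valued_subfield_bq])

lemma embed_inj: "f \<in> bounded_quotients K \<Longrightarrow> g \<in> bounded_quotients K \<Longrightarrow> embed_ambient K f = embed_ambient K g \<Longrightarrow> f = g"
  unfolding embed_ambient_def using valued_subfield.embed_const[OF valued_subfield_bq] by blast

end

end

theory Submission
  imports Defs "HOL-Library.Poly_Mapping"
begin

text \<open>Let \<open>F\<close> be the substitution \<open>z \<mapsto> z^3\<close>. The coefficients of \<open>h\<close> (up to powers of 64) and \<open>A\<close> are constant
  terms of powers of a Laurent polynomial whose Newton polytope lies in the cube \<open>[-1, 1]^3\<close>, so
  they satisfy the Dwork congruences of Mellit and Vlasenko, and \<open>F h / h\<close>, \<open>F A / A\<close> are analytic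
  elements. Then \<open>h' / h\<close> is one as well, hence so is \<open>f / h\<close>, because \<open>f\<close> is a combination of
  \<open>h\<close>, \<open>h'\<close> and \<open>h''\<close> with polynomial coefficients.

  In a shortest algebraic relation between \<open>h\<close> and \<open>A\<close> the quotient of two terms is fixed by \<open>F\<close>,
  hence constant, so that \<open>h^a A^b\<close> is an analytic element for some \<open>(a, b) \<noteq> (0, 0)\<close>. To exclude
  this, write \<open>h^2 (1 - z) = 1 + 3 u\<close> and \<open>A (1 + z) = 1 + 3 v\<close>. Up to powers of 3 taken out of the
  exponents, a combination of \<open>u\<close> and \<open>v\<close> that is nontrivial modulo 3 would be rational modulo 3,
  hence have eventually periodic coefficients; they are not periodic, since the \<open>n\<close>-th coefficients
  of \<open>u\<close> and \<open>v\<close> are, up to sign, the part of \<open>n\<close> prime to 3.\<close>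

section \<open>Dwork congruences\<close>

text \<open>The obstacle to independence is that it is invisible modulo 3: there h = (1 - z) h^3 and
  A = (1 + z)^2 A^3, so h^2 and A reduce to rational functions. The first information sits modulo 9,
  after normalizing to h^2 (1 - z) and A (1 + z), both congruent to 1 modulo 3; the square is forced
  because h itself reduces to (1 - z)^(-1/2).

  The shortest relation cannot be treated with exact equalities, since its coefficients lie in a
  completion and are given by Cauchy sequences. "Fixed by F, hence constant" therefore becomes
  quantitative: if |F x - x| <= d, then x lies within the same d of a constant. F leaves the
  coefficients of a series alone, so it is an isometry that fixes K.

  The Dwork congruences concern integer sequences, while h has denominators 64^n. To precision 3^M,
  1/64 is replaced by an integer c, and the congruences are proved for all c at once.\<close>

lemma of_nat_dvd_power_diff:
  fixes a b :: "'a::comm_ring_1"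
  assumes "1 \<le> k" "of_nat (p ^ k) dvd a - b"
  shows "of_nat (p ^ Suc k) dvd a ^ p - b ^ p"
proof -
  have pdvd: "of_nat p dvd a - b"
  proof -
    have "(of_nat p :: 'a) dvd of_nat (p ^ k)"
      using assms(1) by (simp add: dvd_power)
    then show ?thesis using assms(2) dvd_trans by blast
  qed
  have pw: "of_nat p dvd a ^ i - b ^ i" for i
  proof -
    have "a - b dvd a ^ i - b ^ i" by (simp add: power_diff_sumr2)
    then show ?thesis using pdvd dvd_trans by blast
  qed
  \<comment> \<open>The cofactor of a - b in a ^ p - b ^ p consists of p summands, each congruent to
    b ^ (p - 1) modulo p; this gives the extra factor p.\<close>
  have "of_nat p dvd (\<Sum>i<p. b ^ (p - Suc i) * (a ^ i - b ^ i)) + of_nat p * b ^ (p - 1)"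
    by (intro dvd_add dvd_sum dvd_mult pw dvd_triv_left)
  also have "(\<Sum>i<p. b ^ (p - Suc i) * (a ^ i - b ^ i)) + of_nat p * b ^ (p - 1) = (\<Sum>i<p. b ^ (p - Suc i) * a ^ i)"
  proof -
    have "(\<Sum>i<p. b ^ (p - Suc i) * b ^ i) = (\<Sum>i<p. b ^ (p - 1))"
      by (intro sum.cong) (auto simp flip: power_add)
    then show ?thesis by (simp add: right_diff_distrib sum_subtractf)
  qed
  finally have "of_nat p dvd (\<Sum>i<p. b ^ (p - Suc i) * a ^ i)" .
  with assms(2) have "of_nat (p ^ k) * of_nat p dvd (a - b) * (\<Sum>i<p. b ^ (p - Suc i) * a ^ i)"
    by (rule mult_dvd_mono)
  then show ?thesis by (simp add: power_diff_sumr2 mult_ac)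
qed

text \<open>Modulo p the hypothesis makes \<open>Y l\<close> congruent to Y 0 ^ (p ^ l); every
  further p-th power taken on both sides gains one factor p.\<close>

lemma frobenius_lift_power:
  fixes Y :: "nat \<Rightarrow> 'a::comm_ring_1"
  assumes Y: "\<And>l. of_nat p dvd Y l ^ p - Y (Suc l)"
  shows "of_nat (p ^ Suc j) dvd Y 0 ^ (p ^ (l + j)) - Y l ^ (p ^ j)"
proof (induction j)
  case 0
  have "of_nat p dvd Y 0 ^ (p ^ l) - Y l"
  proof (induction l)
    case (Suc l)
    have "Y 0 ^ (p ^ l) - Y l dvd (Y 0 ^ (p ^ l)) ^ p - Y l ^ p" by (simp add: power_diff_sumr2)
    with Suc have "of_nat p dvd (Y 0 ^ (p ^ l)) ^ p - Y l ^ p" using dvd_trans by blast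
    from dvd_add[OF this Y[of l]] show ?case by (simp add: power_mult[symmetric] mult.commute)
  qed simp
  then show ?case by simp
next
  case (Suc j)
  have "of_nat (p ^ Suc (Suc j)) dvd (Y 0 ^ (p ^ (l + j))) ^ p - (Y l ^ (p ^ j)) ^ p"
    by (rule of_nat_dvd_power_diff[OF _ Suc]) simp
  then show ?case by (simp add: power_mult[symmetric] mult.commute)
qed

text \<open>The ghost terms of Mellit and Vlasenko: \<open>Y l\<close> plays the part of \<open>\<Lambda>(x^(p^l))\<close>.\<close>

function ghost :: "nat \<Rightarrow> (nat \<Rightarrow> 'a::comm_ring_1) \<Rightarrow> nat \<Rightarrow> nat \<Rightarrow> 'a" where
  "ghost p Y L n = Y 0 ^ n - (\<Sum>l\<in>{1..<L}. ghost p Y l (n mod p ^ l) * Y l ^ (n div p ^ l))"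
  by auto
termination by (relation "inv_image less_than (\<lambda>(p, Y, L, n). L)") auto

declare ghost.simps [simp del]

text \<open>The definition of \<open>ghost\<close> solved for Y 0 ^ n: as n < p ^ L, the summand l =
  L is \<open>ghost p Y L n\<close> itself, the exponent of \<open>Y L\<close> being 0.\<close>

lemma ghost_expansion:
  assumes "1 \<le> L" "n < p ^ L"
  shows "Y 0 ^ n = (\<Sum>l=1..L. ghost p Y l (n mod p ^ l) * Y l ^ (n div p ^ l))"
proof -
  have "{1..L} = insert L {1..<L}" using assms by auto
  then show ?thesis using assms by (simp add: ghost.simps[of p Y L n])
qed

text \<open>Split off the leading digit d, n = n' + p ^ L * d, and expand Y 0 ^ n' instead of Y 0 ^
  n. The summand of level l acquires the factor Y 0 ^ (p ^ L * d) - Y l ^ (p ^ (L - l) * d),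
  divisible by p ^ (L - l + 1), and its ghost term contributes p ^ (l - 1) by induction.\<close>

lemma ghost_dvd:
  fixes Y :: "nat \<Rightarrow> 'a::comm_ring_1"
  assumes Y: "\<And>l. of_nat p dvd Y l ^ p - Y (Suc l)" and "0 < p"
  shows "n < p ^ Suc L \<Longrightarrow> of_nat (p ^ L) dvd ghost p Y (Suc L) n"
proof (induction L arbitrary: n rule: less_induct)
  case (less L)
  show ?case
  proof (cases "L = 0")
    case False
    define n' d where "n' = n mod p ^ L" and "d = n div p ^ L"
    have n: "n = n' + p ^ L * d" by (simp add: n'_def d_def)
    have n': "n' < p ^ L" using \<open>0 < p\<close> by (simp add: n'_def)
    have md: "n mod p ^ l = n' mod p ^ l" "n div p ^ l = n' div p ^ l + p ^ (L - l) * d" if "l \<le> L" for l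
    proof -
      have e: "p ^ L = p ^ l * p ^ (L - l)" using that by (simp flip: power_add)
      show "n mod p ^ l = n' mod p ^ l" unfolding n e by (simp add: mult.assoc)
      show "n div p ^ l = n' div p ^ l + p ^ (L - l) * d"
        unfolding n e using \<open>0 < p\<close> by (simp add: mult.assoc)
    qed
    have "ghost p Y (Suc L) n = Y 0 ^ n' * Y 0 ^ (p ^ L * d)
        - (\<Sum>l=1..L. ghost p Y l (n mod p ^ l) * Y l ^ (n div p ^ l))"
      unfolding ghost.simps[of p Y "Suc L" n] by (simp add: n power_add atLeastLessThanSuc_atLeastAtMost)
    also have "\<dots> = (\<Sum>l=1..L. ghost p Y l (n' mod p ^ l) * Y l ^ (n' div p ^ l)
        * (Y 0 ^ (p ^ L * d) - Y l ^ (p ^ (L - l) * d)))"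
      using ghost_expansion[OF _ n', of Y] False
      by (simp add: md power_add sum_distrib_left right_diff_distrib sum_subtractf mult_ac)
    also have "of_nat (p ^ L) dvd \<dots>"
    proof (rule dvd_sum)
      fix l assume l: "l \<in> {1..L}"
      then obtain k where k: "l = Suc k" "k < L" by (cases l) auto
      have 1: "of_nat (p ^ k) dvd ghost p Y l (n' mod p ^ l)"
        unfolding k(1) by (rule less) (use k \<open>0 < p\<close> in auto)
      have "of_nat (p ^ Suc (L - l)) dvd Y 0 ^ (p ^ (l + (L - l))) - Y l ^ (p ^ (L - l))"
        by (rule frobenius_lift_power[where Y = Y and p = p, OF Y])
      also have "\<dots> dvd (Y 0 ^ (p ^ (l + (L - l)))) ^ d - (Y l ^ (p ^ (L - l))) ^ d"
        by (simp add: power_diff_sumr2)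
      finally have 2: "of_nat (p ^ Suc (L - l)) dvd Y 0 ^ (p ^ L * d) - Y l ^ (p ^ (L - l) * d)"
        using l by (simp add: power_mult)
      have "L = k + Suc (L - l)" using k by simp
      then have "p ^ L = p ^ k * p ^ Suc (L - l)" by (metis power_add)
      then have "(of_nat (p ^ L) :: 'a) = of_nat (p ^ k) * of_nat (p ^ Suc (L - l))" by (metis of_nat_mult)
      then show "of_nat (p ^ L) dvd ghost p Y l (n' mod p ^ l) * Y l ^ (n' div p ^ l)
        * (Y 0 ^ (p ^ L * d) - Y l ^ (p ^ (L - l) * d))"
        using dvd_mult[OF mult_dvd_mono[OF 1 2], of "Y l ^ (n' div p ^ l)"] by (simp only: mult_ac)
    qed
    finally show ?thesis .
  qed simp
qed

text \<open>What remains of the ghost expansion after taking constant terms, with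
  \<open>r l m\<close> the constant term of a ghost term. The Dwork congruences follow from this
  alone, so Laurent polynomials can then be forgotten.\<close>

definition ghost_decomposable :: "nat \<Rightarrow> (nat \<Rightarrow> int) \<Rightarrow> bool" where
  "ghost_decomposable p b \<longleftrightarrow> b 0 = 1 \<and>
     (\<exists>r. (\<forall>l m. m < p ^ Suc l \<longrightarrow> int (p ^ l) dvd r (Suc l) m) \<and>
          (\<forall>L\<ge>1. \<forall>n<p ^ L. b n = (\<Sum>l=1..L. r l (n mod p ^ l) * b (n div p ^ l))))"

text \<open>\<open>ct\<close> stands for the constant term. Additivity carries divisibility by p ^ l
  over to the integers; \<open>ct_mult\<close> is where the shape of the Newton polytope will
  enter.\<close>

lemma ghost_decomposableI:
  fixes Y :: "nat \<Rightarrow> 'a::comm_ring_1" and ct :: "'a \<Rightarrow> int"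
  assumes Y: "\<And>l. of_nat p dvd Y l ^ p - Y (Suc l)" and "0 < p"
    and ct_add: "\<And>f g. ct (f + g) = ct f + ct g" and ct_1: "ct 1 = 1"
    and ct_mult: "\<And>l n m. n < p ^ l \<Longrightarrow> ct (ghost p Y l n * Y l ^ m) = ct (ghost p Y l n) * ct (Y 0 ^ m)"
  shows "ghost_decomposable p (\<lambda>n. ct (Y 0 ^ n))"
proof -
  have ct_0: "ct 0 = 0" using ct_add[of 0 0] by simp
  have ct_sum: "ct (sum f A) = (\<Sum>x\<in>A. ct (f x))" for f :: "nat \<Rightarrow> 'a" and A
    by (induction A rule: infinite_finite_induct) (auto simp: ct_0 ct_add)
  have ct_of_nat: "ct (of_nat k * f) = int k * ct f" for k f
    by (induction k) (auto simp: ct_0 ct_add algebra_simps)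
  show ?thesis
    unfolding ghost_decomposable_def
  proof (intro conjI exI[of _ "\<lambda>l m. ct (ghost p Y l m)"] allI impI)
    fix l m assume "m < p ^ Suc l"
    then show "int (p ^ l) dvd ct (ghost p Y (Suc l) m)"
      using ghost_dvd[where Y = Y and p = p, OF Y \<open>0 < p\<close>] ct_of_nat by (metis dvd_def)
  next
    fix L n assume "1 \<le> L" "n < p ^ L"
    then show "ct (Y 0 ^ n) = (\<Sum>l=1..L. ct (ghost p Y l (n mod p ^ l)) * ct (Y 0 ^ (n div p ^ l)))"
      using \<open>0 < p\<close> by (simp add: ghost_expansion[of L n p Y] ct_sum ct_mult)
  qed (simp add: ct_1)
qed

section \<open>Divisibility, substitution and truncation of integer power series\<close>

lemma of_int_dvd_fps_iff: "(of_int m :: int fps) dvd F \<longleftrightarrow> (\<forall>n. m dvd fps_nth F n)"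
proof
  assume "of_int m dvd F"
  then show "\<forall>n. m dvd fps_nth F n" by (auto simp: dvd_def fps_of_int[symmetric])
next
  assume "\<forall>n. m dvd fps_nth F n"
  then have "F = of_int m * Abs_fps (\<lambda>n. fps_nth F n div m)"
    by (auto simp: fps_eq_iff fps_of_int[symmetric])
  then show "of_int m dvd F" by (metis dvd_triv_left)
qed

abbreviation subst_pow :: "nat \<Rightarrow> 'a::comm_ring_1 fps \<Rightarrow> 'a fps" where
  "subst_pow q F \<equiv> fps_compose F (fps_X ^ q)"

lemma subst_pow_subst_pow: "0 < q \<Longrightarrow> 0 < r \<Longrightarrow> subst_pow q (subst_pow r F) = subst_pow (q * r) F"
  by (auto simp: fps_eq_iff fps_nth_compose_X_power div_mult2_eq elim!: dvdE)

lemma subst_pow_mult: "0 < q \<Longrightarrow> subst_pow q (F * G) = subst_pow q F * subst_pow q (G :: 'a::idom fps)"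
  by (rule fps_compose_mult_distrib) (auto simp: fps_X_power_nth)

lemma subst_pow_diff: "subst_pow q (F - G) = subst_pow q F - subst_pow q (G :: 'a::comm_ring_1 fps)"
  by (simp add: fps_compose_sub_distrib)

lemma of_int_dvd_subst_pow:
  assumes "0 < q" "(of_int m :: int fps) dvd F"
  shows "of_int m dvd subst_pow q F"
  using assms by (auto simp: of_int_dvd_fps_iff fps_nth_compose_X_power)

lemma dvd_fps_unit_cancel:
  fixes F U :: "int fps"
  assumes "m dvd F * U" "fps_nth U 0 = 1"
  shows "m dvd F"
proof -
  have "U * fps_right_inverse U 1 = 1" using assms(2) by (intro fps_right_inverse) auto
  then have "F = F * U * fps_right_inverse U 1" by (simp add: mult.assoc)
  then show ?thesis using assms(1) by (metis dvd_mult2)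
qed

definition trunc :: "nat \<Rightarrow> (nat \<Rightarrow> 'a::zero) \<Rightarrow> 'a fps" where
  "trunc q a = Abs_fps (\<lambda>n. if n < q then a n else 0)"

text \<open>Division with remainder: n = i + q * j with i < q forces i = n mod q. Such a product
  encodes one level of a ghost expansion.\<close>

lemma trunc_mult_subst_pow_nth:
  assumes "0 < q"
  shows "fps_nth (trunc q r * subst_pow q F) n = r (n mod q) * fps_nth (F :: 'a::comm_ring_1 fps) (n div q)"
proof -
  have "fps_nth (trunc q r * subst_pow q F) n =
      (\<Sum>i=0..n. (if i < q then r i else 0) * (if q dvd n - i then fps_nth F ((n - i) div q) else 0))"
    using assms by (simp add: fps_mult_nth trunc_def fps_nth_compose_X_power)
  also have "\<dots> = (\<Sum>i\<in>{n mod q}. (if i < q then r i else 0) * (if q dvd n - i then fps_nth F ((n - i) div q) else 0))"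
  proof (rule sum.mono_neutral_right)
    show "\<forall>i\<in>{0..n} - {n mod q}. (if i < q then r i else 0) * (if q dvd n - i then fps_nth F ((n - i) div q) else 0) = 0"
    proof
      fix i assume i: "i \<in> {0..n} - {n mod q}"
      have "\<not> (i < q \<and> q dvd n - i)"
      proof
        assume a: "i < q \<and> q dvd n - i"
        then have "n mod q = i mod q" using i by (metis DiffE atLeastAtMost_iff mod_eq_dvd_iff_nat)
        then show False using a i by simp
      qed
      then show "(if i < q then r i else 0) * (if q dvd n - i then fps_nth F ((n - i) div q) else 0) = 0" by auto
    qed
  qed auto
  also have "\<dots> = r (n mod q) * fps_nth F (n div q)"
    using assms by (simp add: minus_mod_eq_mult_div)
  finally show ?thesis .
qed

text \<open>Applied to the ghost expansion of \<open>b\<close>, the differences for the truncations of smaller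
  level appear multiplied by complementary powers of \<open>p\<close>.\<close>

lemma dwork_congruence:
  assumes b: "ghost_decomposable p b" and p: "1 < p"
  shows "of_int (int p ^ Suc M) dvd
    Abs_fps b * subst_pow p (trunc (p ^ M) b) - subst_pow p (Abs_fps b) * trunc (p ^ Suc M) b"
proof -
  obtain r where r: "\<And>l m. m < p ^ Suc l \<Longrightarrow> int (p ^ l) dvd r (Suc l) m"
    and rb: "\<And>L n. 1 \<le> L \<Longrightarrow> n < p ^ L \<Longrightarrow> b n = (\<Sum>l=1..L. r l (n mod p ^ l) * b (n div p ^ l))"
    and b0: "b 0 = 1" using b unfolding ghost_decomposable_def by blast
  define B where "B = Abs_fps b"
  define T where "T M = trunc (p ^ M) b" for M
  define \<rho> where "\<rho> l = trunc (p ^ l) (r l)" for l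
  let ?F = "\<lambda>l. subst_pow (p ^ l)"
  have pp: "0 < p ^ l" for l using p by simp
  have F_mult: "?F l (f * g) = ?F l f * ?F l g" for l and f g :: "int fps" by (rule subst_pow_mult[OF pp])
  have F_F: "?F l (?F k f) = ?F (l + k) f" for l k and f :: "int fps"
    using subst_pow_subst_pow[OF pp pp] by (simp add: power_add)
  have F_0: "?F 0 f = f" for f :: "int fps" by simp
  have F_dvd: "of_int m dvd f \<Longrightarrow> of_int m dvd ?F l f" for m l and f :: "int fps"
    by (rule of_int_dvd_subst_pow[OF pp])
  have T0: "fps_nth (?F l (T M)) 0 = 1" for l M
    using pp b0 by (simp add: fps_nth_compose_X_power T_def trunc_def)
  have \<rho>_dvd: "of_int (int p ^ l) dvd \<rho> (Suc l)" for l
    unfolding of_int_dvd_fps_iff using r by (auto simp: \<rho>_def trunc_def)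
  have nth_\<rho>: "fps_nth (\<rho> l * ?F l f) n = r l (n mod p ^ l) * fps_nth f (n div p ^ l)" for l f n
    unfolding \<rho>_def by (rule trunc_mult_subst_pow_nth[OF pp])
  have T_exp: "T M = (\<Sum>l=1..M. \<rho> l * ?F l (T (M - l)))" if "1 \<le> M" for M
  proof (rule fps_ext)
    fix n
    have "n div p ^ l < p ^ (M - l) \<longleftrightarrow> n < p ^ M" if "l \<in> {1..M}" for l
      using pp[of l] that by (simp add: div_less_iff_less_mult flip: power_add)
    then have "(\<Sum>l=1..M. r l (n mod p ^ l) * fps_nth (T (M - l)) (n div p ^ l)) =
      (\<Sum>l=1..M. if n < p ^ M then r l (n mod p ^ l) * b (n div p ^ l) else 0)"
      by (intro sum.cong) (auto simp: T_def trunc_def)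
    then show "fps_nth (T M) n = fps_nth (\<Sum>l=1..M. \<rho> l * ?F l (T (M - l))) n"
      using rb[OF that, of n] by (simp add: fps_sum_nth nth_\<rho>) (simp add: T_def trunc_def)
  qed
  \<comment> \<open>The expansion of b n needs more levels as n grows. Levels beyond M are divisible
    by p ^ M, so modulo p ^ M the first M levels serve all n at once.\<close>
  have B_exp: "of_int (int p ^ M) dvd B - (\<Sum>l=1..M. \<rho> l * ?F l B)" for M
    unfolding of_int_dvd_fps_iff
  proof
    fix n
    have "n < p ^ n" using p by (simp add: power_gt_expt)
    also have "\<dots> \<le> p ^ (M + Suc n)" using p by (intro power_increasing) auto
    finally have n: "n < p ^ (M + Suc n)" .
    have "fps_nth (B - (\<Sum>l=1..M. \<rho> l * ?F l B)) n =
        (\<Sum>l=1..M + Suc n. r l (n mod p ^ l) * b (n div p ^ l)) - (\<Sum>l=1..M. r l (n mod p ^ l) * b (n div p ^ l))"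
      using rb[OF _ n] by (simp add: fps_sum_nth nth_\<rho>) (simp add: B_def)
    also have "\<dots> = (\<Sum>l\<in>{1..M + Suc n} - {1..M}. r l (n mod p ^ l) * b (n div p ^ l))"
      by (rule sum_diff[symmetric]) auto
    also have "int p ^ M dvd \<dots>"
    proof (intro dvd_sum dvd_mult2)
      fix l assume l: "l \<in> {1..M + Suc n} - {1..M}"
      then obtain k where k: "l = Suc k" "M \<le> k" by (cases l) auto
      have "int p ^ M dvd int (p ^ k)" using k by (simp add: le_imp_power_dvd)
      also have "\<dots> dvd r l (n mod p ^ l)" unfolding k(1) by (rule r) (rule mod_less_divisor[OF pp])
      finally show "int p ^ M dvd r l (n mod p ^ l)" .
    qed
    finally show "int p ^ M dvd fps_nth (B - (\<Sum>l=1..M. \<rho> l * ?F l B)) n" .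
  qed
  \<comment> \<open>Telescoping of the congruences known so far. The step from j to j + 1 chains
    with the one of level i = M - Suc j, substituted by \<open>?F j\<close>, and cancels
    \<open>?F j (T (Suc i))\<close>, whose constant term is 1.\<close>
  have iter: "of_int (int p ^ (M + 1 - j)) dvd B * ?F j (T (M - j)) - ?F j B * T M"
    if D: "\<And>i. Suc i \<le> M \<Longrightarrow> of_int (int p ^ Suc i) dvd B * ?F 1 (T i) - ?F 1 B * T (Suc i)" and "j \<le> M" for M j
    using \<open>j \<le> M\<close>
  proof (induction j)
    case (Suc j)
    define i where "i = M - Suc j"
    have i: "M - j = Suc i" "M + 1 - Suc j = Suc i" "M - Suc j = i" "M + 1 - j = Suc (Suc i)"
      using Suc.prems by (auto simp: i_def)
    have "(of_int (int p ^ Suc i) :: int fps) dvd of_int (int p ^ Suc (Suc i))" by simp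
    also have "\<dots> dvd B * ?F j (T (Suc i)) - ?F j B * T M" using Suc i by simp
    finally have 1: "of_int (int p ^ Suc i) dvd B * ?F j (T (Suc i)) - ?F j B * T M" .
    have "of_int (int p ^ Suc i) dvd ?F j (B * ?F 1 (T i) - ?F 1 B * T (Suc i))"
      using Suc.prems i by (intro F_dvd D) auto
    then have 2: "of_int (int p ^ Suc i) dvd ?F j B * ?F (Suc j) (T i) - ?F (Suc j) B * ?F j (T (Suc i))"
      by (simp only: subst_pow_diff F_mult F_F) simp
    have "of_int (int p ^ Suc i) dvd (B * ?F j (T (Suc i)) - ?F j B * T M) * ?F (Suc j) (T i) +
        (?F j B * ?F (Suc j) (T i) - ?F (Suc j) B * ?F j (T (Suc i))) * T M"
      by (intro dvd_add dvd_mult2 1 2)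
    also have "\<dots> = (B * ?F (Suc j) (T i) - ?F (Suc j) B * T M) * ?F j (T (Suc i))" by (simp add: algebra_simps)
    finally show ?case unfolding i by (rule dvd_fps_unit_cancel) (rule T0)
  qed (simp)
  have "of_int (int p ^ Suc M) dvd B * ?F 1 (T M) - ?F 1 B * T (Suc M)" for M
  proof (induction M rule: less_induct)
    case (less M)
    \<comment> \<open>\<open>B\<close> and \<open>T (Suc M)\<close> are expanded with the same
      \<open>\<rho> l\<close>. The differences that arise are, up to sign, the images under
      \<open>?F 1\<close> of \<open>iter\<close> with j = l - 1, and \<open>\<rho> l\<close> makes
      up for the precision p ^ (l - 1) lost there.\<close>
    have S: "(\<Sum>l=1..Suc M. \<rho> l * ?F l B) * ?F 1 (T M) - ?F 1 B * (\<Sum>l=1..Suc M. \<rho> l * ?F l (T (Suc M - l)))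
      = (\<Sum>l=1..Suc M. \<rho> l * (?F l B * ?F 1 (T M) - ?F 1 B * ?F l (T (Suc M - l))))"
      by (simp only: sum_distrib_left sum_distrib_right sum_subtractf[symmetric] right_diff_distrib mult_ac)
    have "of_int (int p ^ Suc M) dvd (\<Sum>l=1..Suc M. \<rho> l * (?F l B * ?F 1 (T M) - ?F 1 B * ?F l (T (Suc M - l))))"
    proof (rule dvd_sum)
      fix l assume l: "l \<in> {1..Suc M}"
      then obtain k where k: "l = Suc k" "k \<le> M" by (cases l) auto
      have "of_int (int p ^ (M + 1 - k)) dvd ?F 1 (B * ?F k (T (M - k)) - ?F k B * T M)"
        using k less by (intro F_dvd iter) auto
      then have "of_int (int p ^ (M + 1 - k)) dvd - ?F 1 (B * ?F k (T (M - k)) - ?F k B * T M)"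
        by (rule dvd_minus_iff[THEN iffD2])
      also have "- ?F 1 (B * ?F k (T (M - k)) - ?F k B * T M) = ?F l B * ?F 1 (T M) - ?F 1 B * ?F l (T (Suc M - l))"
        unfolding subst_pow_diff F_mult F_F k(1) by simp
      finally have "of_int (int p ^ k) * of_int (int p ^ (M + 1 - k)) dvd
          \<rho> l * (?F l B * ?F 1 (T M) - ?F 1 B * ?F l (T (Suc M - l)))"
        using \<rho>_dvd[of k] k(1) by (intro mult_dvd_mono) auto
      moreover have "(of_int (int p ^ k) * of_int (int p ^ (M + 1 - k)) :: int fps) = of_int (int p ^ Suc M)"
        using k by (simp flip: power_add)
      ultimately show "of_int (int p ^ Suc M) dvd \<rho> l * (?F l B * ?F 1 (T M) - ?F 1 B * ?F l (T (Suc M - l)))" by simp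
    qed
    then have "of_int (int p ^ Suc M) dvd (B - (\<Sum>l=1..Suc M. \<rho> l * ?F l B)) * ?F 1 (T M) +
      (\<Sum>l=1..Suc M. \<rho> l * (?F l B * ?F 1 (T M) - ?F 1 B * ?F l (T (Suc M - l))))"
      by (intro dvd_add dvd_mult2 B_exp)
    also have "\<dots> = B * ?F 1 (T M) - ?F 1 B * T (Suc M)"
      unfolding S[symmetric] using T_exp[of "Suc M"] by (simp add: algebra_simps)
    finally show ?case .
  qed
  then show ?thesis by (simp add: B_def T_def)
qed

section \<open>Constant terms of powers of Laurent polynomials in three variables\<close>

type_synonym laurent3 = "(int \<times> int \<times> int) \<Rightarrow>\<^sub>0 int"

definition lmon :: "int \<Rightarrow> int \<Rightarrow> int \<Rightarrow> laurent3" where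
  "lmon i j k = Poly_Mapping.single (i, j, k) 1"

lemma lmon_mult: "lmon i j k * lmon i' j' k' = lmon (i + i') (j + j') (k + k')"
  by (simp add: lmon_def mult_single)

lemma lmon_0: "lmon 0 0 0 = 1"
  by (simp add: lmon_def zero_prod_def[symmetric])

lemma lmon_power: "lmon i j k ^ n = lmon (int n * i) (int n * j) (int n * k)"
  by (induction n) (auto simp: lmon_0 lmon_mult algebra_simps)

lemma of_int_single: "(of_int m :: laurent3) = Poly_Mapping.single 0 m"
  using single_of_int[of m, where 'a = "int \<times> int \<times> int" and 'b = int] by simp

lemma lookup_of_nat_lmon: "Poly_Mapping.lookup (of_nat n * lmon i j k) 0 = (if i = 0 \<and> j = 0 \<and> k = 0 then int n else 0)"
proof -
  have "of_nat n * lmon i j k = Poly_Mapping.single (i, j, k) (int n)"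
    by (simp add: lmon_def mult_single of_nat_single flip: single_of_nat)
  then show ?thesis by (auto simp: lookup_single when_def zero_prod_def)
qed

text \<open>A box around the Newton polytope. The three bounds are kept apart so that a product of
  one-variable factors gets a sharp box through \<open>exps_le_mult3\<close>.\<close>

definition exps_le :: "int \<Rightarrow> int \<Rightarrow> int \<Rightarrow> laurent3 \<Rightarrow> bool" where
  "exps_le a b c f \<longleftrightarrow> (\<forall>(i, j, k) \<in> Poly_Mapping.keys f. \<bar>i\<bar> \<le> a \<and> \<bar>j\<bar> \<le> b \<and> \<bar>k\<bar> \<le> c)"

lemma exps_le_add: "exps_le a b c f \<Longrightarrow> exps_le a b c g \<Longrightarrow> exps_le a b c (f + g)"
  using keys_add[of f g] by (fastforce simp: exps_le_def)

lemma exps_le_uminus: "exps_le a b c f \<Longrightarrow> exps_le a b c (- f)"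
  by (simp add: exps_le_def)

lemma exps_le_diff: "exps_le a b c f \<Longrightarrow> exps_le a b c g \<Longrightarrow> exps_le a b c (f - g)"
  using exps_le_add[OF _ exps_le_uminus] by force

lemma exps_le_mult: "exps_le a b c f \<Longrightarrow> exps_le a' b' c' g \<Longrightarrow> exps_le (a + a') (b + b') (c + c') (f * g)"
  using keys_mult[of f g] by (fastforce simp: exps_le_def)

lemma exps_le_mult3:
  "exps_le a 0 0 f \<Longrightarrow> exps_le 0 b 0 g \<Longrightarrow> exps_le 0 0 c h \<Longrightarrow> exps_le a b c (f * g * h)"
  using exps_le_mult[OF exps_le_mult, of a 0 0 f 0 b 0 g 0 0 c h] by simp

lemma exps_le_lmon: "\<bar>i\<bar> \<le> a \<Longrightarrow> \<bar>j\<bar> \<le> b \<Longrightarrow> \<bar>k\<bar> \<le> c \<Longrightarrow> exps_le a b c (lmon i j k)"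
  by (simp add: exps_le_def lmon_def)

lemma exps_le_of_int: "0 \<le> a \<Longrightarrow> 0 \<le> b \<Longrightarrow> 0 \<le> c \<Longrightarrow> exps_le a b c (of_int n)"
  by (cases "n = 0") (simp_all add: exps_le_def zero_prod_def flip: single_of_int)

lemma exps_le_1: "0 \<le> a \<Longrightarrow> 0 \<le> b \<Longrightarrow> 0 \<le> c \<Longrightarrow> exps_le a b c 1"
  using exps_le_of_int[of a b c 1] by simp

lemma exps_le_power: "exps_le a a a f \<Longrightarrow> exps_le (int n * a) (int n * a) (int n * a) (f ^ n)"
proof (induction n)
  case (Suc n)
  show ?case using exps_le_mult[OF Suc.prems Suc.IH[OF Suc.prems]] by (simp add: algebra_simps)
qed (simp add: exps_le_1)

lemma exps_le_sum:
  assumes "\<And>x. x \<in> A \<Longrightarrow> exps_le a b c (f x)" "0 \<le> a" "0 \<le> b" "0 \<le> c"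
  shows "exps_le a b c (sum f A)"
  using assms(1)
  by (induction A rule: infinite_finite_induct)
     (use assms(2-) exps_le_of_int[of a b c 0] in \<open>auto intro: exps_le_add\<close>)

definition exps_dvd :: "int \<Rightarrow> laurent3 \<Rightarrow> bool" where
  "exps_dvd q f \<longleftrightarrow> (\<forall>(i, j, k) \<in> Poly_Mapping.keys f. q dvd i \<and> q dvd j \<and> q dvd k)"

lemma exps_dvd_add: "exps_dvd q f \<Longrightarrow> exps_dvd q g \<Longrightarrow> exps_dvd q (f + g)"
  using keys_add[of f g] by (fastforce simp: exps_dvd_def)

lemma exps_dvd_mult: "exps_dvd q f \<Longrightarrow> exps_dvd q g \<Longrightarrow> exps_dvd q (f * g)"
  using keys_mult[of f g] by (fastforce simp: exps_dvd_def)

lemma exps_dvd_lmon: "q dvd i \<Longrightarrow> q dvd j \<Longrightarrow> q dvd k \<Longrightarrow> exps_dvd q (lmon i j k)"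
  by (simp add: exps_dvd_def lmon_def)

lemma exps_dvd_of_int: "exps_dvd q (of_int n)"
  by (cases "n = 0") (simp_all add: exps_dvd_def zero_prod_def flip: single_of_int)

lemma exps_dvd_1: "exps_dvd q 1"
  using exps_dvd_of_int[of q 1] by simp

lemma exps_dvd_power: "exps_dvd q f \<Longrightarrow> exps_dvd q (f ^ n)"
  by (induction n) (auto intro: exps_dvd_mult exps_dvd_1)

text \<open>A pair of terms contributing to the constant term has exponents l and - l; the entries
  of l are below q in absolute value and divisible by q, hence 0.\<close>

lemma lookup_mult_0:
  assumes f: "exps_le n n n f" and g: "exps_dvd q g" and "n < q"
  shows "Poly_Mapping.lookup (f * g) 0 = Poly_Mapping.lookup f 0 * Poly_Mapping.lookup g 0"
proof -
  have *: "(0 = l + u) = (u = - l)" for l u :: "int \<times> int \<times> int"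
    by (metis add.inverse_inverse eq_neg_iff_add_eq_0 neg_eq_iff_add_eq_0)
  have "Poly_Mapping.lookup f l * Poly_Mapping.lookup g (- l) = 0" if "l \<noteq> 0" for l
  proof (rule ccontr)
    assume "\<not> ?thesis"
    then have k: "l \<in> Poly_Mapping.keys f" "- l \<in> Poly_Mapping.keys g" by (auto simp: in_keys_iff)
    obtain i j k where l: "l = (i, j, k)" by (cases l)
    have "\<bar>i\<bar> < q" "\<bar>j\<bar> < q" "\<bar>k\<bar> < q" "q dvd i" "q dvd j" "q dvd k"
      using k f g \<open>n < q\<close> by (auto simp: exps_le_def exps_dvd_def l)
    moreover have "m = 0" if "\<bar>m\<bar> < q" "q dvd m" for m
      using that dvd_imp_le_int[of m q] by linarith
    ultimately have "i = 0 \<and> j = 0 \<and> k = 0" by blast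
    then show False using that by (simp add: l zero_prod_def)
  qed
  then have e: "Poly_Mapping.lookup f l * Poly_Mapping.lookup g (- l) =
      (Poly_Mapping.lookup f 0 * Poly_Mapping.lookup g 0 when l = 0)" for l
    by (auto simp: when_def)
  show ?thesis by (simp add: lookup_mult * e)
qed

text \<open>A relation rather than an operation, so that it can be checked factor by factor; in the
  applications \<open>g\<close> is \<open>f\<close> with its variables cubed.\<close>

definition cube_frob :: "'a::comm_ring_1 \<Rightarrow> 'a \<Rightarrow> bool" where
  "cube_frob f g \<longleftrightarrow> 3 dvd f ^ 3 - g"

lemma cube_frob_add: assumes "cube_frob f g" "cube_frob f' g'" shows "cube_frob (f + f') (g + g')"
proof -
  have "3 dvd (f ^ 3 - g) + (f' ^ 3 - g') + 3 * (f * f' * (f + f'))"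
    using assms unfolding cube_frob_def by (intro dvd_add) auto
  also have "\<dots> = (f + f') ^ 3 - (g + g')" by (simp add: power3_eq_cube algebra_simps)
  finally show ?thesis unfolding cube_frob_def .
qed

lemma cube_frob_mult: assumes "cube_frob f g" "cube_frob f' g'" shows "cube_frob (f * f') (g * g')"
proof -
  have "3 dvd (f ^ 3 - g) * f' ^ 3 + g * (f' ^ 3 - g')"
    using assms unfolding cube_frob_def by (intro dvd_add dvd_mult dvd_mult2)
  also have "\<dots> = (f * f') ^ 3 - g * g'" by (simp add: algebra_simps)
  finally show ?thesis unfolding cube_frob_def .
qed

lemma cube_frob_lmon: "cube_frob (lmon i j k) (lmon (3 * i) (3 * j) (3 * k))"
  by (simp add: cube_frob_def lmon_power)

lemma cube_frob_1: "cube_frob 1 1"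
  by (simp add: cube_frob_def)

lemma cube_frob_of_int: "cube_frob (of_int c) (of_int c)"
proof -
  have "3 dvd c - 1 \<or> 3 dvd c \<or> 3 dvd c + 1" by presburger
  then have "(3::int) dvd (c - 1) * c * (c + 1)" by auto
  also have "(c - 1) * c * (c + 1) = c ^ 3 - c" by (simp add: power3_eq_cube algebra_simps)
  finally obtain d where "c ^ 3 - c = 3 * d" by (elim dvdE)
  then have "of_int c ^ 3 - of_int c = (3 * of_int d :: 'a)" by (metis of_int_diff of_int_mult of_int_numeral of_int_power)
  then show ?thesis by (simp add: cube_frob_def)
qed

text \<open>In the expanded product the term of degrees i, j, k has exponent zero only for i =
  \<alpha>, j = \<beta>, k = \<gamma>, because q > 0.\<close>

lemma lookup_binomial_product:
  assumes "0 < q"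
  shows "Poly_Mapping.lookup ((1 + lmon q 0 0) ^ a * (1 + lmon 0 q 0) ^ b * (1 + lmon 0 0 q) ^ c *
      lmon (- (int \<alpha> * q)) (- (int \<beta> * q)) (- (int \<gamma> * q))) 0 = int ((a choose \<alpha>) * (b choose \<beta>) * (c choose \<gamma>))"
    (is "Poly_Mapping.lookup ?P 0 = _")
proof -
  have b: "(1 + t) ^ n = (\<Sum>i\<le>n. of_nat (n choose i) * t ^ i)" for t :: laurent3 and n
    using binomial_ring[of t 1 n] by (simp add: add.commute)
  have "?P = (\<Sum>k\<le>c. \<Sum>j\<le>b. \<Sum>i\<le>a. of_nat (a choose i) * lmon q 0 0 ^ i * (of_nat (b choose j) * lmon 0 q 0 ^ j) *
      (of_nat (c choose k) * lmon 0 0 q ^ k) * lmon (- (int \<alpha> * q)) (- (int \<beta> * q)) (- (int \<gamma> * q)))"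
    unfolding b by (simp only: sum_distrib_left sum_distrib_right mult.assoc)
  also have "\<dots> = (\<Sum>k\<le>c. \<Sum>j\<le>b. \<Sum>i\<le>a. of_nat ((a choose i) * (b choose j) * (c choose k)) *
      (lmon q 0 0 ^ i * lmon 0 q 0 ^ j * lmon 0 0 q ^ k * lmon (- (int \<alpha> * q)) (- (int \<beta> * q)) (- (int \<gamma> * q))))"
    by (intro sum.cong refl) (simp only: of_nat_mult mult_ac)
  also have "\<dots> = (\<Sum>k\<le>c. \<Sum>j\<le>b. \<Sum>i\<le>a. of_nat ((a choose i) * (b choose j) * (c choose k)) *
      lmon ((int i - int \<alpha>) * q) ((int j - int \<beta>) * q) ((int k - int \<gamma>) * q))"
    by (intro sum.cong refl) (simp only: lmon_mult lmon_power, simp add: algebra_simps)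
  finally have "Poly_Mapping.lookup ?P 0 = (\<Sum>k\<le>c. \<Sum>j\<le>b. \<Sum>i\<le>a.
      if i = \<alpha> then if j = \<beta> then if k = \<gamma> then int ((a choose i) * (b choose j) * (c choose k)) else 0 else 0 else 0)"
    using assms by (simp only: lookup_sum lookup_of_nat_lmon) (intro sum.cong refl, auto)
  also have "\<dots> = int ((a choose \<alpha>) * (b choose \<beta>) * (c choose \<gamma>))"
    by (cases "\<alpha> \<le> a"; cases "\<beta> \<le> b"; cases "\<gamma> \<le> c") (simp_all add: binomial_eq_0 not_le)
  finally show ?thesis .
qed

text \<open>As n mod p ^ l + p ^ l * (n div p ^ l) = n, every product subtracted in the recursion
  fits into the same box as Y 0 ^ n.\<close>

lemma ghost_exps_le:
  assumes Y: "\<And>l. exps_le (int p ^ l) (int p ^ l) (int p ^ l) (Y l)"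
  shows "exps_le (int n) (int n) (int n) (ghost p Y L n)"
proof (induction L arbitrary: n rule: less_induct)
  case (less L)
  have e: "exps_le (int n) (int n) (int n) (ghost p Y l (n mod p ^ l) * Y l ^ (n div p ^ l))" if "l < L" for l
  proof -
    have "int (n mod p ^ l) + int (n div p ^ l) * int p ^ l = int n"
      by (metis mod_mult_div_eq mult.commute of_nat_add of_nat_mult of_nat_power)
    then show ?thesis
      using exps_le_mult[OF less[OF that, of "n mod p ^ l"] exps_le_power[OF Y[of l], of "n div p ^ l"]] by simp
  qed
  have "exps_le (int n) (int n) (int n) (Y 0 ^ n)"
    using exps_le_power[OF Y[of 0, simplified], of n] by simp
  then show ?case
    unfolding ghost.simps[of p Y L n] by (intro exps_le_diff exps_le_sum e) auto
qed

text \<open>A ghost term with index n < 3 ^ l has exponents of size at most n, those of powers of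
  \<open>Y l\<close> are multiples of 3 ^ l, so constant terms multiply by
  \<open>lookup_mult_0\<close>. Hypothesis \<open>b\<close> allows \<open>Y l\<close> to be
  exchanged for \<open>Y 0\<close> in constant terms.\<close>

lemma ghost_decomposable_laurent:
  fixes Y :: "nat \<Rightarrow> laurent3"
  assumes frob: "\<And>l. cube_frob (Y l) (Y (Suc l))"
    and le: "\<And>l. exps_le (3 ^ l) (3 ^ l) (3 ^ l) (Y l)"
    and dv: "\<And>l. exps_dvd (3 ^ l) (Y l)"
    and b: "\<And>l n. Poly_Mapping.lookup (Y l ^ n) 0 = b n"
  shows "ghost_decomposable 3 b"
proof -
  have "ghost_decomposable 3 (\<lambda>n. Poly_Mapping.lookup (Y 0 ^ n) 0)"
  proof (rule ghost_decomposableI)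
    show "of_nat 3 dvd Y l ^ 3 - Y (Suc l)" for l using frob[of l] by (simp add: cube_frob_def)
    show "Poly_Mapping.lookup (ghost 3 Y l n * Y l ^ m) 0 =
        Poly_Mapping.lookup (ghost 3 Y l n) 0 * Poly_Mapping.lookup (Y 0 ^ m) 0" if "n < 3 ^ l" for l n m
    proof -
      have "int n < 3 ^ l" using that by (simp add: nat_less_real_le flip: of_nat_less_iff[where 'a=int])
      moreover have "exps_le (int n) (int n) (int n) (ghost 3 Y l n)" by (rule ghost_exps_le) (use le in simp)
      ultimately show ?thesis using lookup_mult_0[OF _ exps_dvd_power[OF dv[of l]]] b by simp
    qed
  qed (auto simp: lookup_add lookup_one)
  then show ?thesis by (simp add: b)
qed

text \<open>Constant terms of powers of \<open>c * (x + 2 + 1/x) * (y + 2 + 1/y) * (z + 2 + 1/z)\<close>.\<close>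

lemma ghost_decomposable_central_binomial_cube:
  "ghost_decomposable 3 (\<lambda>n. c ^ n * int ((2 * n) choose n) ^ 3)"
proof (rule ghost_decomposable_laurent)
  let ?x = "\<lambda>l. lmon (3 ^ l) 0 0" and ?y = "\<lambda>l. lmon 0 (3 ^ l) 0" and ?z = "\<lambda>l. lmon 0 0 (3 ^ l)"
  let ?x' = "\<lambda>l. lmon (- (3 ^ l)) 0 0" and ?y' = "\<lambda>l. lmon 0 (- (3 ^ l)) 0" and ?z' = "\<lambda>l. lmon 0 0 (- (3 ^ l))"
  \<comment> \<open>c stays arbitrary because it later replaces 1/64 to a given precision; 2 is
    written 1 + 1 to fit the closure rules.\<close>
  define Y where "Y l = of_int c * ((?x l + 1 + 1 + ?x' l) * (?y l + 1 + 1 + ?y' l) * (?z l + 1 + 1 + ?z' l))" for l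
  show "cube_frob (Y l) (Y (Suc l))" for l
  proof -
    have m: "cube_frob (?x l) (?x (Suc l))" "cube_frob (?y l) (?y (Suc l))" "cube_frob (?z l) (?z (Suc l))"
       "cube_frob (?x' l) (?x' (Suc l))" "cube_frob (?y' l) (?y' (Suc l))" "cube_frob (?z' l) (?z' (Suc l))"
      using cube_frob_lmon[of "3 ^ l" 0 0] cube_frob_lmon[of 0 "3 ^ l" 0] cube_frob_lmon[of 0 0 "3 ^ l"]
        cube_frob_lmon[of "- (3 ^ l)" 0 0] cube_frob_lmon[of 0 "- (3 ^ l)" 0] cube_frob_lmon[of 0 0 "- (3 ^ l)"]
      by simp_all
    show ?thesis unfolding Y_def by (intro cube_frob_mult cube_frob_add cube_frob_of_int cube_frob_1 m)
  qed
  show "exps_le (3 ^ l) (3 ^ l) (3 ^ l) (Y l)" for l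
  proof -
    have "exps_le (3 ^ l) 0 0 (?x l + 1 + 1 + ?x' l)" "exps_le 0 (3 ^ l) 0 (?y l + 1 + 1 + ?y' l)"
       "exps_le 0 0 (3 ^ l) (?z l + 1 + 1 + ?z' l)" "exps_le 0 0 0 (of_int c)"
      by (intro exps_le_add exps_le_lmon exps_le_1 exps_le_of_int; simp)+
    then show ?thesis
      unfolding Y_def using exps_le_mult[OF \<open>exps_le 0 0 0 _\<close> exps_le_mult3] by simp
  qed
  show "exps_dvd (3 ^ l) (Y l)" for l
    unfolding Y_def
    by (intro exps_dvd_mult exps_dvd_add exps_dvd_of_int exps_dvd_1 exps_dvd_lmon) auto
  show "Poly_Mapping.lookup (Y l ^ n) 0 = c ^ n * int ((2 * n) choose n) ^ 3" for l n
  proof -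
    \<comment> \<open>s + 2 + 1/s = (1 + s)^2 / s turns powers of \<open>Y l\<close> into binomial
      products divided by a monomial.\<close>
    have sq: "s + 1 + 1 + t = (1 + s) ^ 2 * t" if "s * t = 1" for s t :: laurent3
    proof -
      have "(1 + s) ^ 2 * t = t + 2 * (s * t) + s * (s * t)" by (simp add: power2_eq_square algebra_simps)
      then show ?thesis by (simp add: that algebra_simps)
    qed
    have "Y l = of_int c * ((1 + ?x l) ^ 2 * ?x' l * ((1 + ?y l) ^ 2 * ?y' l) * ((1 + ?z l) ^ 2 * ?z' l))"
      unfolding Y_def by (subst (1 2 3) sq) (simp_all add: lmon_mult lmon_0)
    also have "\<dots> = of_int c * ((1 + ?x l) ^ 2 * (1 + ?y l) ^ 2 * (1 + ?z l) ^ 2 * (?x' l * ?y' l * ?z' l))"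
      by (simp only: mult_ac)
    also have "?x' l * ?y' l * ?z' l = lmon (- (3 ^ l)) (- (3 ^ l)) (- (3 ^ l))" by (simp add: lmon_mult)
    finally have "Y l ^ n = of_int (c ^ n) * ((1 + ?x l) ^ (2 * n) * (1 + ?y l) ^ (2 * n) * (1 + ?z l) ^ (2 * n) *
      lmon (- (int n * 3 ^ l)) (- (int n * 3 ^ l)) (- (int n * 3 ^ l)))"
      by (simp add: power_mult_distrib lmon_power power_mult)
    then show ?thesis
      unfolding of_int_single
      using lookup_binomial_product[of "3 ^ l" "2 * n" "2 * n" "2 * n" n n n]
        lookup_mult_0[of 0 "Poly_Mapping.single 0 (c ^ n)"]
      by (simp add: power3_eq_cube flip: mult_map_scale_conv_mult)
         (simp add: map.rep_eq when_def)
  qed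
qed

text \<open>Constant terms of powers of \<open>(1 + x) * (1 + y) * (1 + z) * ((1 + y) * (1 + z) + x * y * z) / (x * y * z)\<close>.\<close>

lemma ghost_decomposable_apery:
  "ghost_decomposable 3 (\<lambda>n. \<Sum>k=0..n. int (n choose k) ^ 2 * int ((n + k) choose k) ^ 2)"
proof (rule ghost_decomposable_laurent)
  let ?x = "\<lambda>l. lmon (3 ^ l) 0 0" and ?y = "\<lambda>l. lmon 0 (3 ^ l) 0" and ?z = "\<lambda>l. lmon 0 0 (3 ^ l)"
  let ?w = "\<lambda>l. lmon (- (3 ^ l)) (- (3 ^ l)) (- (3 ^ l))"
  define Y where "Y l = (1 + ?x l) * (1 + ?y l) * (1 + ?z l) * ((1 + ?y l) * (1 + ?z l) * ?w l + 1)" for l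
  show "cube_frob (Y l) (Y (Suc l))" for l
  proof -
    have m: "cube_frob (?x l) (?x (Suc l))" "cube_frob (?y l) (?y (Suc l))" "cube_frob (?z l) (?z (Suc l))"
       "cube_frob (?w l) (?w (Suc l))"
      using cube_frob_lmon[of "3 ^ l" 0 0] cube_frob_lmon[of 0 "3 ^ l" 0] cube_frob_lmon[of 0 0 "3 ^ l"]
        cube_frob_lmon[of "- (3 ^ l)" "- (3 ^ l)" "- (3 ^ l)"]
      by simp_all
    show ?thesis unfolding Y_def by (intro cube_frob_mult cube_frob_add cube_frob_1 m)
  qed
  show "exps_le (3 ^ l) (3 ^ l) (3 ^ l) (Y l)" for l
  proof -
    let ?x' = "lmon (- (3 ^ l)) 0 0" and ?y' = "lmon 0 (- (3 ^ l)) 0" and ?z' = "lmon 0 0 (- (3 ^ l))"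
    \<comment> \<open>Bounding the given factors separately would only yield a cube of twice the
      size. Multiplied out, the negative exponents cancel: (1 + x) (1 + y)^2 (1 + z)^2 / (x y z) =
      (1/x + 1) (y + 2 + 1/y) (z + 2 + 1/z).\<close>
    have "Y l = (1 + ?x l) * (1 + ?y l) * (1 + ?z l)
        + (?x' + 1) * (?y l + 1 + 1 + ?y') * (?z l + 1 + 1 + ?z')"
      unfolding Y_def by (simp add: algebra_simps lmon_mult lmon_0)
    then show ?thesis
      by (simp only:) (intro exps_le_add exps_le_mult3 exps_le_lmon exps_le_1; simp)
  qed
  show "exps_dvd (3 ^ l) (Y l)" for l
    unfolding Y_def
    by (intro exps_dvd_mult exps_dvd_add exps_dvd_1 exps_dvd_lmon) auto
  show "Poly_Mapping.lookup (Y l ^ n) 0 = (\<Sum>k=0..n. int (n choose k) ^ 2 * int ((n + k) choose k) ^ 2)" for l n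
  proof -
    \<comment> \<open>The binomial theorem is applied to the last factor only. In term k one factor
      n choose k comes from this expansion, the other from (1 + x) ^ n, and y and z give n + k
      choose k each.\<close>
    have "Y l ^ n = (\<Sum>k\<le>n. (1 + ?x l) ^ n * (1 + ?y l) ^ n * (1 + ?z l) ^ n *
        (of_nat (n choose k) * ((1 + ?y l) * (1 + ?z l) * ?w l) ^ k))"
      unfolding Y_def power_mult_distrib[of "_ * _ * (1 + ?z l)"]
        binomial_ring[of "(1 + ?y l) * (1 + ?z l) * ?w l"]
      by (simp add: power_mult_distrib sum_distrib_left)
    also have "\<dots> = (\<Sum>k\<le>n. of_nat (n choose k) * ((1 + ?x l) ^ n * (1 + ?y l) ^ (n + k) * (1 + ?z l) ^ (n + k) * ?w l ^ k))"
      by (simp only: power_mult_distrib power_add mult_ac)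
    finally have "Y l ^ n = (\<Sum>k\<le>n. Poly_Mapping.single 0 (int (n choose k)) *
        ((1 + ?x l) ^ n * (1 + ?y l) ^ (n + k) * (1 + ?z l) ^ (n + k) *
         lmon (- (int k * 3 ^ l)) (- (int k * 3 ^ l)) (- (int k * 3 ^ l))))"
      by (simp add: lmon_power)
    then have "Poly_Mapping.lookup (Y l ^ n) 0 = (\<Sum>k\<le>n. int (n choose k) * int ((n choose k) * (n + k choose k) * (n + k choose k)))"
      using lookup_binomial_product[of "3 ^ l" n _ _ ]
      by (simp only: lookup_sum mult_map_scale_conv_mult[symmetric] map.rep_eq) (simp add: when_def)
    also have "\<dots> = (\<Sum>k=0..n. int (n choose k) ^ 2 * int ((n + k) choose k) ^ 2)"
      by (intro sum.cong) (auto simp: power2_eq_square)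
    finally show ?thesis .
  qed
qed

section \<open>The Gauss norm and the Frobenius substitution\<close>

lemma absval_1 [simp]: "absval (1 :: 'c::ultrametric_field) = 1"
  using ultrametric_absval_mult[of "1::'c" 1] ultra_absval_eq_0[of "1::'c"] by simp

lemma absval_inverse: "absval (inverse x) = inverse (absval (x :: 'c::ultrametric_field))"
proof (cases "x = 0")
  case False
  then have "absval x * absval (inverse x) = 1" by (simp flip: ultrametric_absval_mult)
  then show ?thesis by (metis inverse_unique)
qed simp

lemma absval_divide: "absval (x / y) = absval x / absval (y :: 'c::ultrametric_field)"
  by (simp add: divide_inverse ultrametric_absval_mult absval_inverse)

lemma absval_of_nat_le_1: "absval (of_nat n :: 'c::ultrametric_field) \<le> 1"
proof (induction n)
  case (Suc n)
  then show ?case using ultrametric_absval_add[of "of_nat n :: 'c" 1] by (simp add: add.commute)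
qed simp

lemma absval_of_int_le_1: "absval (of_int n :: 'c::ultrametric_field) \<le> 1"
  by (cases n rule: int_cases2) (simp_all add: absval_of_nat_le_1)

text \<open>In an ultrametric sum a single term above the threshold cannot be cancelled by terms
  below it.\<close>

lemma absval_sum_gt:
  fixes f :: "'a \<Rightarrow> 'c::ultrametric_field"
  assumes "finite A" "a \<in> A" "0 \<le> t" "t < absval (f a)" "\<And>x. x \<in> A \<Longrightarrow> x \<noteq> a \<Longrightarrow> absval (f x) \<le> t"
  shows "t < absval (sum f A)"
proof -
  have s: "sum f A = f a + sum f (A - {a})" using assms(1,2) by (simp add: sum.remove)
  have "absval (sum f (A - {a})) \<le> t" using assms by (intro ultra_absval_sum_le) auto
  then show ?thesis using ultra_absval_add_eq[of "sum f (A - {a})" "f a"] assms(4) s by simp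
qed

text \<open>Compares the first indices at which \<open>y\<close> and \<open>Q\<close> are not small: that of
  \<open>y * subst_pow 3 Q\<close> is \<open>f + 3 * e\<close> and that of \<open>subst_pow 3 y * Q\<close> is \<open>3 * f + e\<close>.\<close>

lemma subst_pow_eigen_small:
  fixes y Q :: "'c::ultrametric_field fps"
  assumes y: "y \<in> bounded_series UNIV" and Q: "\<And>i. absval (fps_nth Q i) \<le> 1" "absval (fps_nth Q e) = 1"
    and \<rho>: "\<rho> < 1" "0 \<le> \<rho>" "\<And>i. i < e \<Longrightarrow> absval (fps_nth Q i) \<le> \<rho>" and ye: "fps_nth y e = 0"
    and d: "0 \<le> d" "\<And>n. absval (fps_nth (y * subst_pow 3 Q - subst_pow 3 y * Q) n) \<le> d"
  shows "absval (fps_nth y n) \<le> d"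
proof -
  define \<epsilon> where "\<epsilon> = sup_norm y"
  have up: "absval (fps_nth y i) \<le> \<epsilon>" for i unfolding \<epsilon>_def by (rule sup_norm_upper[OF y])
  have "\<epsilon> \<le> d"
  proof (rule ccontr)
    assume "\<not> \<epsilon> \<le> d"
    \<comment> \<open>A threshold strictly below the norm of y, yet at least d, so that the two
      products are indistinguishable at this scale, and at least \<open>\<rho> * \<epsilon>\<close>,
      so that the coefficients of Q before e count as small.\<close>
    define \<tau> where "\<tau> = max d (\<rho> * \<epsilon>)"
    have "0 < \<epsilon>" using \<open>\<not> \<epsilon> \<le> d\<close> d(1) by linarith
    then have "\<tau> < \<epsilon>" using \<open>\<not> \<epsilon> \<le> d\<close> \<rho>(1) by (simp add: \<tau>_def)
    then have "\<exists>i. \<tau> < absval (fps_nth y i)"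
      using sup_norm_least[of y \<tau>] unfolding \<epsilon>_def by (meson not_le)
    then obtain f where f: "\<tau> < absval (fps_nth y f)" "\<And>i. i < f \<Longrightarrow> absval (fps_nth y i) \<le> \<tau>"
      using exists_least_iff[of "\<lambda>i. \<tau> < absval (fps_nth y i)"] by (auto simp: not_less)
    have \<tau>0: "0 \<le> \<tau>" "d \<le> \<tau>" using d(1) by (auto simp: \<tau>_def)
    have small: "absval (fps_nth y i * fps_nth Q j) \<le> \<tau>" if "i < f \<or> j < e" for i j
    proof (cases "j < e")
      case True
      have "absval (fps_nth y i * fps_nth Q j) \<le> \<epsilon> * \<rho>"
        unfolding ultrametric_absval_mult by (intro mult_mono up \<rho> True) (use \<open>0 < \<epsilon>\<close> in auto)
      then show ?thesis by (simp add: \<tau>_def mult.commute)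
    next
      case False
      then have "absval (fps_nth y i * fps_nth Q j) \<le> \<tau> * 1"
        unfolding ultrametric_absval_mult using that \<tau>0 by (intro mult_mono f(2) Q) auto
      then show ?thesis by simp
    qed
    have big: "\<tau> < absval (fps_nth y f * fps_nth Q e)"
      using f(1) Q(2) by (simp add: ultrametric_absval_mult)
    have c1: "fps_nth (y * subst_pow 3 Q) n =
        (\<Sum>i=0..n. if 3 dvd n - i then fps_nth y i * fps_nth Q ((n - i) div 3) else 0)" for n
      unfolding fps_mult_nth fps_nth_compose_X_power by (intro sum.cong) auto
    have c2: "fps_nth (subst_pow 3 y * Q) n =
        (\<Sum>i=0..n. if 3 dvd i then fps_nth y (i div 3) * fps_nth Q (n - i) else 0)" for n
      unfolding fps_mult_nth fps_nth_compose_X_power by (intro sum.cong) auto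
    have tr: "\<tau> < absval (fps_nth (y * subst_pow 3 Q) n) \<longleftrightarrow> \<tau> < absval (fps_nth (subst_pow 3 y * Q) n)" for n
    proof -
      let ?a = "fps_nth (y * subst_pow 3 Q) n" and ?b = "fps_nth (subst_pow 3 y * Q) n"
      have "absval (?a - ?b) \<le> \<tau>" using d(2)[of n] \<tau>0 by simp
      moreover have "absval (?b - ?a) = absval (?a - ?b)" by (metis minus_diff_eq ultra_absval_minus)
      ultimately show ?thesis
        using ultrametric_absval_add[of "?a - ?b" ?b] ultrametric_absval_add[of ?a "- (?a - ?b)"] by auto
    qed
    \<comment> \<open>In this degree only the pair (f, e) is large: any other pair has an index of y
      below f or an index of Q below e.\<close>
    have "\<tau> < absval (fps_nth (y * subst_pow 3 Q) (f + 3 * e))"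
      unfolding c1
    proof (rule absval_sum_gt[of _ f])
      fix i assume i: "i \<in> {0..f + 3 * e}" "i \<noteq> f"
      then have "i < f \<or> (f + 3 * e - i) div 3 < e" by auto
      then show "absval (if 3 dvd f + 3 * e - i then fps_nth y i * fps_nth Q ((f + 3 * e - i) div 3) else 0) \<le> \<tau>"
        using small \<tau>0 by auto
    qed (use \<tau>0 big in auto)
    then have "\<tau> < absval (fps_nth (subst_pow 3 y * Q) (f + 3 * e))" using tr by blast
    then have "\<exists>i\<in>{0..f + 3 * e}. \<tau> < absval (if 3 dvd i then fps_nth y (i div 3) * fps_nth Q (f + 3 * e - i) else 0)"
      unfolding c2 using ultra_absval_sum_le[OF _ \<tau>0(1)] by (meson finite_atLeastAtMost not_le)
    then obtain i where i: "i \<le> f + 3 * e" "3 dvd i" "\<tau> < absval (fps_nth y (i div 3) * fps_nth Q (f + 3 * e - i))"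
      using \<tau>0 by (auto split: if_splits)
    \<comment> \<open>A large term of the other product in the same degree gives 3 f + e <= f + 3 e.
      The mirrored argument in degree 3 f + e gives the converse, so f = e, where y
      vanishes.\<close>
    then have "f \<le> i div 3" "e \<le> f + 3 * e - i" using small by (meson not_less)+
    then have ef: "f \<le> e" using i by (auto elim!: dvdE)
    have "\<tau> < absval (fps_nth (subst_pow 3 y * Q) (3 * f + e))"
      unfolding c2
    proof (rule absval_sum_gt[of _ "3 * f"])
      fix i assume i: "i \<in> {0..3 * f + e}" "i \<noteq> 3 * f"
      then have "3 dvd i \<Longrightarrow> i div 3 < f \<or> 3 * f + e - i < e" by (auto elim!: dvdE)
      then show "absval (if 3 dvd i then fps_nth y (i div 3) * fps_nth Q (3 * f + e - i) else 0) \<le> \<tau>"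
        using small \<tau>0 by auto
    qed (use \<tau>0 big in auto)
    then have "\<tau> < absval (fps_nth (y * subst_pow 3 Q) (3 * f + e))" using tr by blast
    then have "\<exists>i\<in>{0..3 * f + e}. \<tau> < absval (if 3 dvd 3 * f + e - i then fps_nth y i * fps_nth Q ((3 * f + e - i) div 3) else 0)"
      unfolding c1 using ultra_absval_sum_le[OF _ \<tau>0(1)] by (meson finite_atLeastAtMost not_le)
    then obtain i where i: "i \<le> 3 * f + e" "3 dvd 3 * f + e - i" "\<tau> < absval (fps_nth y i * fps_nth Q ((3 * f + e - i) div 3))"
      using \<tau>0 by (auto split: if_splits)
    then have "f \<le> i" "e \<le> (3 * f + e - i) div 3" using small by (meson not_less)+
    then have "e = f" using i ef by auto
    then show False using f(1) ye \<tau>0 by simp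
  qed
  then show ?thesis using up[of n] by linarith
qed

context valued_subfield
begin

lemma power_S: "x \<in> S \<Longrightarrow> x ^ n \<in> S"
  by (induction n) (auto intro: one_S mult_S)

lemma power_int_S: "x \<in> S \<Longrightarrow> x powi i \<in> S"
  by (auto simp: power_int_def intro: power_S inverse_S)

lemma divide_S: "x \<in> S \<Longrightarrow> y \<in> S \<Longrightarrow> x / y \<in> S"
  by (simp add: divide_inverse mult_S inverse_S)

lemma N_power: "x \<in> S \<Longrightarrow> N (x ^ n) = N x ^ n"
  by (induction n) (auto simp: N_1 N_mult power_S)

end

abbreviation frob3 :: "'c::field fls \<Rightarrow> 'c fls" where
  "frob3 f \<equiv> fls_compose_power f 3"

locale base_field =
  fixes K :: "'c::ultrametric_field set"
  assumes K: "subfield K (ring_of_type_algebra :: 'c ring)"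
begin

sublocale valued_subfield "bounded_quotients K" gauss_norm
  by (rule valued_subfield_bq[OF K])

lemmas K_closed = Defs.K_closed[OF K]

lemma K_inverse: assumes "x \<in> K" shows "inverse x \<in> K"
proof (cases "x = 0")
  case False
  interpret F: ring "ring_of_type_algebra :: 'c ring" by (rule ring_from_type_algebra)
  have "x \<in> K - {\<zero>\<^bsub>ring_of_type_algebra\<^esub>}" using assms False by (simp add: ring_of_type_algebra_def)
  from F.subfield_m_inv[OF K this] obtain y where "y \<in> K" "x * y = 1"
    by (auto simp: ring_of_type_algebra_def)
  then show ?thesis by (metis inverse_unique)
qed (use assms in simp)

lemma K_diff: "x \<in> K \<Longrightarrow> y \<in> K \<Longrightarrow> x - y \<in> K"
  using K_closed(3)[of x "- y"] K_closed(5)[of y] by simp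

lemma K_of_nat: "of_nat n \<in> K"
  by (induction n) (auto intro: K_closed)

lemma K_of_int: "of_int n \<in> K"
  by (cases n rule: int_cases2) (auto intro: K_closed K_of_nat)

lemma K_power: "x \<in> K \<Longrightarrow> x ^ n \<in> K"
  by (induction n) (auto intro: K_closed)

lemma series_S: assumes "F \<in> bounded_series K"
  shows "fps_to_fls F \<in> bounded_quotients K" "gauss_norm (fps_to_fls F) = sup_norm F"
proof -
  have s: "sup_norm (1::'c fps) = 1"
    by (rule antisym[OF sup_norm_least]) (use sup_norm_upper[OF bs_1[OF K], of 0] in auto)
  show "fps_to_fls F \<in> bounded_quotients K" using bq_I[OF K assms bs_1[OF K]] by simp
  show "gauss_norm (fps_to_fls F) = sup_norm F"
    using gauss_norm_quotient[of F 1] bs_UNIV[OF K assms] bs_UNIV[OF K bs_1[OF K]] s by simp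
qed

lemma N_series_le: assumes "F \<in> bounded_series K" "\<And>n. absval (fps_nth F n) \<le> d"
  shows "gauss_norm (fps_to_fls F) \<le> d"
  using series_S[OF assms(1)] sup_norm_least[of F d] assms(2) by simp

lemma N_series_nth: assumes "F \<in> bounded_series K"
  shows "absval (fps_nth F n) \<le> gauss_norm (fps_to_fls F)"
  using series_S[OF assms] sup_norm_upper[OF assms] by simp

lemma N_quotient: assumes "F \<in> bounded_series K" "G \<in> bounded_series K" "G \<noteq> 0"
  shows "fps_to_fls F / fps_to_fls G \<in> bounded_quotients K"
    "gauss_norm (fps_to_fls F / fps_to_fls G) = sup_norm F / sup_norm G"
  using bq_I[OF K] assms gauss_norm_quotient[OF bs_UNIV[OF K] bs_UNIV[OF K]] by auto

lemma S_cases: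
  assumes "x \<in> bounded_quotients K"
  obtains F G where "F \<in> bounded_series K" "G \<in> bounded_series K" "G \<noteq> 0" "x = fps_to_fls F / fps_to_fls G"
    "gauss_norm x = sup_norm F / sup_norm G"
  using bq_D[OF K assms] by blast

text \<open>\<open>valued_subfield\<close> records only the ordinary triangle inequality. The
  ultrametric one is what lets errors of size d combine to d and not to a multiple of d.\<close>

lemma N_diff_max: assumes "x \<in> bounded_quotients K" "y \<in> bounded_quotients K"
  shows "gauss_norm (x - y) \<le> max (gauss_norm x) (gauss_norm y)"
proof -
  obtain F G where x: "F \<in> bounded_series K" "G \<in> bounded_series K" "G \<noteq> 0"
    "x = fps_to_fls F / fps_to_fls G" "gauss_norm x = sup_norm F / sup_norm G" using S_cases assms by blast
  obtain F' G' where y: "F' \<in> bounded_series K" "G' \<in> bounded_series K" "G' \<noteq> 0"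
    "y = fps_to_fls F' / fps_to_fls G'" "gauss_norm y = sup_norm F' / sup_norm G'" using S_cases assms by blast
  have d: "x - y = fps_to_fls (F * G' - F' * G) / fps_to_fls (G * G')"
    unfolding x(4) y(4) using x(3) y(3) by (simp add: fls_times_fps_to_fls diff_frac_eq)
  note m = sup_norm_mult(2)[OF bs_UNIV[OF K] bs_UNIV[OF K]]
  note D = bs_diff[OF K bs_mult[OF K x(1) y(2)] bs_mult[OF K y(1) x(2)]]
  have pos: "0 < sup_norm G" "0 < sup_norm G'" using sup_norm_pos x y by auto
  have "gauss_norm (x - y) = sup_norm (F * G' - F' * G) / (sup_norm G * sup_norm G')"
    unfolding d using N_quotient(2)[OF conjunct1[OF D] bs_mult[OF K x(2) y(2)]] x(3) y(3) m[OF x(2) y(2)] by simp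
  also have "\<dots> \<le> max (sup_norm F * sup_norm G') (sup_norm F' * sup_norm G) / (sup_norm G * sup_norm G')"
    using D pos unfolding m[OF x(1) y(2)] m[OF y(1) x(2)] by (intro divide_right_mono) auto
  also have "\<dots> = max (gauss_norm x) (gauss_norm y)"
    unfolding x(5) y(5) using pos by (auto simp: max_def field_simps)
  finally show ?thesis .
qed

lemma N_diff_le: "x \<in> bounded_quotients K \<Longrightarrow> y \<in> bounded_quotients K \<Longrightarrow> gauss_norm x \<le> d \<Longrightarrow> gauss_norm y \<le> d \<Longrightarrow>
  gauss_norm (x - y) \<le> d"
  using N_diff_max[of x y] by simp

lemma N_add_le: "x \<in> bounded_quotients K \<Longrightarrow> y \<in> bounded_quotients K \<Longrightarrow> gauss_norm x \<le> d \<Longrightarrow> gauss_norm y \<le> d \<Longrightarrow>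
  gauss_norm (x + y) \<le> d"
  using N_diff_le[of x "- y" d] minus_S[of y] N_minus[of y] by simp

lemma bounded_series_subst_pow: "F \<in> bounded_series K \<Longrightarrow> subst_pow 3 F \<in> bounded_series K"
  and sup_norm_subst_pow: "F \<in> bounded_series K \<Longrightarrow> sup_norm (subst_pow 3 F) = sup_norm F"
proof -
  assume F: "F \<in> bounded_series K"
  have le: "absval (fps_nth (subst_pow 3 F) n) \<le> sup_norm F" for n
    using sup_norm_upper[OF F] order_trans[OF ultra_absval_ge_0 sup_norm_upper[OF F, of 0]]
    by (simp add: fps_nth_compose_X_power)
  then show *: "subst_pow 3 F \<in> bounded_series K"
    using F K_closed(1) by (auto simp: bounded_series_def fps_nth_compose_X_power intro!: bdd_aboveI[of _ "sup_norm F"])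
  have "absval (fps_nth F n) \<le> sup_norm (subst_pow 3 F)" for n
    using sup_norm_upper[OF *, of "3 * n"] by (simp add: fps_nth_compose_X_power)
  then show "sup_norm (subst_pow 3 F) = sup_norm F"
    using le by (intro antisym sup_norm_least)
qed

lemma frob3_divide: "frob3 (x / y) = frob3 x / frob3 y" for x y :: "'c fls"
proof (cases "y = 0")
  case False
  then have "frob3 y \<noteq> 0" using fls_nth_compose_power[of 3 y "3 * k" for k]
    by (metis (no_types, opaque_lifting) dvd_triv_left fls_eqI fls_zero_nth nonzero_mult_div_cancel_left of_nat_numeral zero_less_numeral zero_neq_numeral)
  moreover have "frob3 (x / y) * frob3 y = frob3 x"
    using False by (simp flip: fls_compose_power_mult)
  ultimately show ?thesis by (simp add: field_simps)
qed simp

lemma frob3_inj: "frob3 y = 0 \<longleftrightarrow> y = 0" for y :: "'c fls"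
proof -
  have "frob3 (y / y) = frob3 y / frob3 y" by (rule frob3_divide)
  then show ?thesis by (cases "y = 0") auto
qed

lemma frob3_S: assumes "x \<in> bounded_quotients K"
  shows "frob3 x \<in> bounded_quotients K" "gauss_norm (frob3 x) = gauss_norm x"
proof -
  obtain F G where x: "F \<in> bounded_series K" "G \<in> bounded_series K" "G \<noteq> 0"
    "x = fps_to_fls F / fps_to_fls G" "gauss_norm x = sup_norm F / sup_norm G" using S_cases assms by blast
  have e: "frob3 x = fps_to_fls (subst_pow 3 F) / fps_to_fls (subst_pow 3 G)"
    unfolding x(4) frob3_divide by (simp add: fls_compose_power_fps_to_fls)
  have nz: "subst_pow 3 G \<noteq> 0"
    using frob3_inj[of "fps_to_fls G"] x(3) by (simp add: fls_compose_power_fps_to_fls)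
  show "frob3 x \<in> bounded_quotients K" "gauss_norm (frob3 x) = gauss_norm x"
    unfolding e x(5) using N_quotient[OF bounded_series_subst_pow bounded_series_subst_pow] nz x sup_norm_subst_pow
    by auto
qed

lemma deriv_series: assumes "F \<in> bounded_series K"
  shows "fps_deriv F \<in> bounded_series K" "sup_norm (fps_deriv F) \<le> sup_norm F"
proof -
  have le: "absval (fps_nth (fps_deriv F) n) \<le> sup_norm F" for n
  proof -
    have "absval (fps_nth (fps_deriv F) n) \<le> 1 * absval (fps_nth F (n + 1))"
      unfolding fps_deriv_nth ultrametric_absval_mult by (intro mult_right_mono absval_of_nat_le_1) auto
    then show ?thesis using sup_norm_upper[OF assms, of "n + 1"] by simp
  qed
  then show "fps_deriv F \<in> bounded_series K"
    using assms K_of_nat K_closed(4)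
    by (auto simp: bounded_series_def simp del: of_nat_Suc of_nat_add intro!: bdd_aboveI[of _ "sup_norm F"])
  show "sup_norm (fps_deriv F) \<le> sup_norm F" by (rule sup_norm_least) (rule le)
qed

lemma deriv_divide: assumes "g \<noteq> 0"
  shows "fls_deriv (f / g) = (fls_deriv f - f / g * fls_deriv g) / (g :: 'c fls)"
proof -
  have "fls_deriv (f / g * g) = f / g * fls_deriv g + fls_deriv (f / g) * g" by (rule fls_deriv_mult)
  then show ?thesis using assms by (simp add: field_simps)
qed

text \<open>Quotient rule x' = (F' - x G') / G; differentiating a series does not increase its norm
  because integers have absolute value at most 1. The bound extends the derivation to analytic
  elements.\<close>

lemma deriv_S: assumes "x \<in> bounded_quotients K"
  shows "fls_deriv x \<in> bounded_quotients K" "gauss_norm (fls_deriv x) \<le> gauss_norm x"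
proof -
  obtain F G where x: "F \<in> bounded_series K" "G \<in> bounded_series K" "G \<noteq> 0"
    "x = fps_to_fls F / fps_to_fls G" "gauss_norm x = sup_norm F / sup_norm G" using S_cases assms by blast
  have e: "fls_deriv x = (fps_to_fls (fps_deriv F) - x * fps_to_fls (fps_deriv G)) * inverse (fps_to_fls G)"
    using deriv_divide[of "fps_to_fls G" "fps_to_fls F"] x(3,4) by (simp add: fls_deriv_fps_to_fls divide_inverse)
  note S = series_S(1)[OF deriv_series(1)[OF x(1)]] series_S(1)[OF deriv_series(1)[OF x(2)]] series_S(1)[OF x(2)]
  show "fls_deriv x \<in> bounded_quotients K" unfolding e by (intro mult_S diff_S inverse_S S assms)
  have pos: "0 < sup_norm G" using sup_norm_pos x by auto
  have "gauss_norm (fps_to_fls (fps_deriv F) - x * fps_to_fls (fps_deriv G)) \<le> gauss_norm x * sup_norm G"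
  proof (rule N_diff_le)
    show "gauss_norm (fps_to_fls (fps_deriv F)) \<le> gauss_norm x * sup_norm G"
      using series_S(2)[OF deriv_series(1)[OF x(1)]] deriv_series(2)[OF x(1)] x(5) pos by simp
    show "gauss_norm (x * fps_to_fls (fps_deriv G)) \<le> gauss_norm x * sup_norm G"
      using series_S(2)[OF deriv_series(1)[OF x(2)]] deriv_series(2)[OF x(2)] N_ge_0[OF assms]
      by (simp add: N_mult[OF assms S(2)] mult_left_mono)
  qed (intro mult_S S assms)+
  moreover have "gauss_norm (fls_deriv x) =
      gauss_norm (fps_to_fls (fps_deriv F) - x * fps_to_fls (fps_deriv G)) * inverse (sup_norm G)"
    unfolding e series_S(2)[OF x(2), symmetric] N_inverse[OF S(3), symmetric]
    by (intro N_mult diff_S mult_S inverse_S S assms)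
  ultimately show "gauss_norm (fls_deriv x) \<le> gauss_norm x"
    using pos by (simp add: divide_inverse[symmetric] pos_divide_le_eq)
qed

section \<open>The field of rational functions, its Frobenius and its derivation\<close>

lemma poly_series: assumes "\<forall>i. poly.coeff P i \<in> K" shows "fps_of_poly P \<in> bounded_series K"
  using fps_of_poly_bounded(1)[of P] assms by (auto simp: bounded_series_def)

lemma rational_S: "rational_functions K \<subseteq> bounded_quotients K"
  unfolding rational_functions_def poly_to_fls_def
  by (auto intro!: N_quotient(1) poly_series)

lemma rationalI: "\<forall>i. poly.coeff P i \<in> K \<Longrightarrow> \<forall>i. poly.coeff Q i \<in> K \<Longrightarrow> Q \<noteq> 0 \<Longrightarrow> poly_to_fls P / poly_to_fls Q \<in> rational_functions K"
  unfolding rational_functions_def by blast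

lemma rational_cases:
  assumes "r \<in> rational_functions K"
  obtains P Q where "\<forall>i. poly.coeff P i \<in> K" "\<forall>i. poly.coeff Q i \<in> K" "Q \<noteq> 0" "r = poly_to_fls P / poly_to_fls Q"
  using assms unfolding rational_functions_def by blast

lemma poly_to_fls_simps: "poly_to_fls (P * Q) = poly_to_fls P * poly_to_fls (Q :: 'c poly)"
  "poly_to_fls (P - Q) = poly_to_fls P - poly_to_fls Q" "poly_to_fls (1 :: 'c poly) = 1"
  "poly_to_fls P = 0 \<longleftrightarrow> P = 0"
  by (simp_all add: poly_to_fls_def fps_of_poly_mult fps_of_poly_diff fls_times_fps_to_fls fps_to_fls_minus)

lemma K_poly_mult: "\<forall>i. poly.coeff P i \<in> K \<Longrightarrow> \<forall>i. poly.coeff Q i \<in> K \<Longrightarrow> \<forall>i. poly.coeff (P * Q) i \<in> K"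
  by (simp add: coeff_mult K_sum[OF K] K_closed(4))

lemma rational_poly: assumes "\<forall>i. poly.coeff P i \<in> K" shows "poly_to_fls P \<in> rational_functions K"
  using rationalI[OF assms, of 1] by (simp add: poly_to_fls_simps K_closed)

lemma valued_subfield_rational: "valued_subfield (rational_functions K) gauss_norm"
proof
  show "1 \<in> rational_functions K"
    using rational_poly[of 1] by (simp add: poly_to_fls_simps K_closed)
  fix x assume x: "x \<in> rational_functions K"
  then obtain P Q where PQ: "\<forall>i. poly.coeff P i \<in> K" "\<forall>i. poly.coeff Q i \<in> K" "Q \<noteq> 0" "x = poly_to_fls P / poly_to_fls Q"
    by (rule rational_cases)
  show "inverse x \<in> rational_functions K"
  proof (cases "P = 0")
    case True
    then have "x = 0" using PQ(4) by (simp add: poly_to_fls_def)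
    then show ?thesis using x by simp
  next
    case False
    then show ?thesis using rationalI[OF PQ(2,1)] PQ(4) by simp
  qed
  have xS: "x \<in> bounded_quotients K" using x rational_S by blast
  show "gauss_norm x = 0 \<longleftrightarrow> x = 0" by (rule N_eq_0[OF xS])
  fix y assume y: "y \<in> rational_functions K"
  then obtain P' Q' where PQ': "\<forall>i. poly.coeff P' i \<in> K" "\<forall>i. poly.coeff Q' i \<in> K" "Q' \<noteq> 0" "y = poly_to_fls P' / poly_to_fls Q'"
    by (rule rational_cases)
  have yS: "y \<in> bounded_quotients K" using y rational_S by blast
  show "gauss_norm (x * y) = gauss_norm x * gauss_norm y" "gauss_norm (x - y) \<le> gauss_norm x + gauss_norm y"
    by (intro N_mult N_diff xS yS)+
  have "x * y = poly_to_fls (P * P') / poly_to_fls (Q * Q')"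
    by (simp add: PQ(4) PQ'(4) poly_to_fls_simps)
  then show "x * y \<in> rational_functions K"
    using rationalI[OF K_poly_mult[OF PQ(1) PQ'(1)] K_poly_mult[OF PQ(2) PQ'(2)]] PQ(3) PQ'(3) by simp
  have "x - y = poly_to_fls (P * Q' - P' * Q) / poly_to_fls (Q * Q')"
    using PQ(3) PQ'(3) by (simp add: PQ(4) PQ'(4) poly_to_fls_simps diff_frac_eq)
  moreover have "\<forall>i. poly.coeff (P * Q' - P' * Q) i \<in> K"
    using K_poly_mult[OF PQ(1) PQ'(2)] K_poly_mult[OF PQ'(1) PQ(2)] K_diff by simp
  ultimately show "x - y \<in> rational_functions K"
    using rationalI[OF _ K_poly_mult[OF PQ(2) PQ'(2)]] PQ(3) PQ'(3) by simp
qed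

sublocale rat: valued_subfield "rational_functions K" gauss_norm
  by (rule valued_subfield_rational)

lemma rational_const: "c \<in> K \<Longrightarrow> fls_const c \<in> rational_functions K"
  using rational_poly[of "[:c:]"] K_closed(1)
  by (simp add: poly_to_fls_def fps_of_poly_const fps_const_to_fls coeff_pCons split: nat.split)

lemma rational_X: "fls_X \<in> rational_functions K"
  using rational_poly[of "[:0, 1:]"] K_closed(1,2)
  by (simp add: poly_to_fls_def fps_of_poly_fps_X coeff_pCons split: nat.split)

lemma rational_numeral: "numeral n \<in> rational_functions K"
  using rational_const[OF K_of_nat[of "numeral n"]] by (simp flip: fls_const_numeral)

lemma frob3_rational: assumes "x \<in> rational_functions K" shows "frob3 x \<in> rational_functions K"
proof -
  obtain P Q where PQ: "\<forall>i. poly.coeff P i \<in> K" "\<forall>i. poly.coeff Q i \<in> K" "Q \<noteq> 0" "x = poly_to_fls P / poly_to_fls Q"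
    using assms by (rule rational_cases)
  have c: "frob3 (poly_to_fls R) = poly_to_fls (R \<circ>\<^sub>p Polynomial.monom 1 3)" for R :: "'c poly"
    by (simp add: poly_to_fls_def fls_compose_power_fps_to_fls fps_of_poly_pcompose fps_of_poly_monom')
  have cK: "\<forall>i. poly.coeff (R \<circ>\<^sub>p Polynomial.monom 1 3) i \<in> K" if "\<forall>i. poly.coeff R i \<in> K" for R
  proof
    fix i
    have "poly.coeff (R \<circ>\<^sub>p Polynomial.monom 1 3) i = fps_nth (subst_pow 3 (fps_of_poly R)) i"
      by (metis c fls_compose_power_fps_to_fls fps_of_poly_nth fps_to_fls_eq_iff poly_to_fls_def zero_less_numeral)
    then show "poly.coeff (R \<circ>\<^sub>p Polynomial.monom 1 3) i \<in> K"
      using that K_closed(1) by (simp add: fps_nth_compose_X_power)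
  qed
  have "Q \<circ>\<^sub>p Polynomial.monom 1 3 \<noteq> 0"
    using frob3_inj[of "poly_to_fls Q"] PQ(3) by (simp add: c poly_to_fls_simps)
  then show ?thesis
    unfolding PQ(4) frob3_divide c using rationalI cK PQ by blast
qed

lemma deriv_rational: assumes "x \<in> rational_functions K" shows "fls_deriv x \<in> rational_functions K"
proof -
  obtain P Q where PQ: "\<forall>i. poly.coeff P i \<in> K" "\<forall>i. poly.coeff Q i \<in> K" "Q \<noteq> 0" "x = poly_to_fls P / poly_to_fls Q"
    using assms by (rule rational_cases)
  have d: "fls_deriv (poly_to_fls R) \<in> rational_functions K" if "\<forall>i. poly.coeff R i \<in> K" for R
  proof -
    have "fls_deriv (poly_to_fls R) = poly_to_fls (pderiv R)"
      by (simp add: poly_to_fls_def fls_deriv_fps_to_fls fps_of_poly_pderiv)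
    moreover have "\<forall>i. poly.coeff (pderiv R) i \<in> K"
      using that K_closed(4) K_of_nat by (simp add: coeff_pderiv del: of_nat_Suc)
    ultimately show ?thesis using rational_poly by simp
  qed
  have "fls_deriv x = (fls_deriv (poly_to_fls P) - x * fls_deriv (poly_to_fls Q)) * inverse (poly_to_fls Q)"
    using deriv_divide[of "poly_to_fls Q" "poly_to_fls P"] PQ(3,4) by (simp add: poly_to_fls_simps divide_inverse)
  then show ?thesis
    by (auto intro!: rat.mult_S rat.diff_S rat.inverse_S d PQ assms rational_poly)
qed

end

section \<open>Analytic elements\<close>

text \<open>Integral series with constant term 1 form a multiplicative group of elements of Gauss
  norm 1, so multiplication by them never affects an estimate.\<close>

definition unit_series :: "'c::ultrametric_field set \<Rightarrow> 'c fls set" where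
  "unit_series K = fps_to_fls ` {F \<in> bounded_series K. fps_nth F 0 = 1 \<and> (\<forall>n. absval (fps_nth F n) \<le> 1)}"

context base_field
begin

text \<open>The part of E_K inside the field of bounded quotients, namely the closure of K(z) there.
  It avoids computing with classes of Cauchy sequences; \<open>embed_analytic\<close> links it to
  \<open>analytic_elements\<close>.\<close>

definition analytic :: "'c fls set" where
  "analytic = {x \<in> bounded_quotients K. \<forall>d>0. \<exists>r\<in>rational_functions K. gauss_norm (x - r) < d}"

lemma analytic_S: "x \<in> analytic \<Longrightarrow> x \<in> bounded_quotients K"
  by (simp add: analytic_def)

lemma analyticD: "x \<in> analytic \<Longrightarrow> 0 < d \<Longrightarrow> \<exists>r\<in>rational_functions K. gauss_norm (x - r) < d"
  by (simp add: analytic_def)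

lemma rational_analytic: "r \<in> rational_functions K \<Longrightarrow> r \<in> analytic"
  using rational_S by (auto simp: analytic_def N_0 intro!: bexI[of _ r])

lemma rat_S: "r \<in> rational_functions K \<Longrightarrow> r \<in> bounded_quotients K"
  using rational_S by blast

lemma N_trans_less:
  assumes "x \<in> bounded_quotients K" "y \<in> bounded_quotients K" "z \<in> bounded_quotients K"
    "gauss_norm (x - y) < d" "gauss_norm (y - z) < d"
  shows "gauss_norm (x - z) < d"
proof -
  have "gauss_norm ((x - y) - (z - y)) \<le> max (gauss_norm (x - y)) (gauss_norm (z - y))"
    by (intro N_diff_max diff_S assms)
  then show ?thesis using assms N_commute[of z y] by simp
qed

lemma analyticI:
  assumes "x \<in> bounded_quotients K" "\<And>d. 0 < d \<Longrightarrow> \<exists>e\<in>analytic. gauss_norm (x - e) < d"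
  shows "x \<in> analytic"
  unfolding analytic_def
proof (intro CollectI conjI allI impI assms(1))
  fix d :: real assume d: "0 < d"
  then obtain e where e: "e \<in> analytic" "gauss_norm (x - e) < d" using assms(2) by blast
  then obtain r where r: "r \<in> rational_functions K" "gauss_norm (e - r) < d" using analyticD d by blast
  show "\<exists>r\<in>rational_functions K. gauss_norm (x - r) < d"
    using N_trans_less[OF assms(1) analytic_S[OF e(1)] rat_S[OF r(1)] e(2) r(2)] r(1) by blast
qed

lemma analyticI_le:
  assumes "x \<in> bounded_quotients K" "\<And>M. \<exists>e\<in>analytic. gauss_norm (x - e) \<le> B * (1 / 3) ^ (M::nat)"
  shows "x \<in> analytic"
proof (rule analyticI[OF assms(1)])
  fix d :: real assume d: "0 < d"
  have "(\<lambda>M. B * (1 / 3) ^ M) \<longlonglongrightarrow> B * 0"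
    by (intro tendsto_mult tendsto_const LIMSEQ_realpow_zero) auto
  then have "\<forall>\<^sub>F M in sequentially. B * (1 / 3) ^ M < d" using d by (intro order_tendstoD(2)) auto
  then obtain M where "B * (1 / 3) ^ M < d" by (auto simp: eventually_sequentially)
  moreover obtain e where "e \<in> analytic" "gauss_norm (x - e) \<le> B * (1 / 3) ^ M" using assms(2) by blast
  ultimately show "\<exists>e\<in>analytic. gauss_norm (x - e) < d" by (intro bexI[of _ e]) auto
qed

lemma valued_subfield_analytic: "valued_subfield analytic gauss_norm"
proof
  show "1 \<in> analytic" by (intro rational_analytic rat.one_S)
  fix x assume x: "x \<in> analytic"
  note xS = analytic_S[OF x]
  show "gauss_norm x = 0 \<longleftrightarrow> x = 0" by (rule N_eq_0[OF xS])
  show "inverse x \<in> analytic"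
  proof (cases "x = 0")
    case True
    then show ?thesis using x by simp
  next
    case False
    then have Nx: "0 < gauss_norm x" using N_eq_0[OF xS] N_ge_0[OF xS] by linarith
    show ?thesis
    proof (rule analyticI[OF inverse_S[OF xS]])
      fix d :: real assume d: "0 < d"
      \<comment> \<open>The first bound forces |r| >= |x| by the ultrametric inequality; the second
        pays for the factor 1 / (|x| |r|) in the difference of the inverses.\<close>
      then have "0 < min (gauss_norm x) (d * (gauss_norm x * gauss_norm x))" using Nx by simp
      then obtain r where r: "r \<in> rational_functions K" "gauss_norm (x - r) < min (gauss_norm x) (d * (gauss_norm x * gauss_norm x))"
        using analyticD[OF x] by blast
      note rS = rat_S[OF r(1)]
      have "gauss_norm x \<le> max (gauss_norm (x - r)) (gauss_norm (- r))"
        using N_diff_max[OF diff_S[OF xS rS] minus_S[OF rS]] by simp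
      then have Nr: "gauss_norm x \<le> gauss_norm r" using r(2) N_minus[OF rS] by auto
      then have "r \<noteq> 0" using Nx N_0 by auto
      then have "inverse x - inverse r = (r - x) * (inverse x * inverse r)" using False by (simp add: field_simps)
      then have "gauss_norm (inverse x - inverse r) = gauss_norm (x - r) * (inverse (gauss_norm x) * inverse (gauss_norm r))"
        using N_commute[OF xS rS] by (simp add: N_mult N_inverse diff_S mult_S inverse_S xS rS)
      also have "\<dots> \<le> gauss_norm (x - r) * (inverse (gauss_norm x) * inverse (gauss_norm x))"
        using Nr Nx by (intro mult_left_mono le_imp_inverse_le N_ge_0 diff_S xS rS) auto
      also have "\<dots> < d * (gauss_norm x * gauss_norm x) * (inverse (gauss_norm x) * inverse (gauss_norm x))"
        using r(2) Nx by (intro mult_strict_right_mono) auto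
      also have "\<dots> = d" using Nx by (simp add: field_simps)
      finally show "\<exists>e\<in>analytic. gauss_norm (inverse x - e) < d"
        using rational_analytic[OF rat.inverse_S[OF r(1)]] by blast
    qed
  qed
  fix y assume y: "y \<in> analytic"
  note yS = analytic_S[OF y]
  show "gauss_norm (x * y) = gauss_norm x * gauss_norm y" "gauss_norm (x - y) \<le> gauss_norm x + gauss_norm y"
    by (intro N_mult N_diff xS yS)+
  show "x - y \<in> analytic"
  proof (rule analyticI[OF diff_S[OF xS yS]])
    fix d :: real assume d: "0 < d"
    obtain r where r: "r \<in> rational_functions K" "gauss_norm (x - r) < d" using analyticD[OF x d] by blast
    obtain s where s: "s \<in> rational_functions K" "gauss_norm (y - s) < d" using analyticD[OF y d] by blast
    have "gauss_norm ((x - r) - (y - s)) \<le> max (gauss_norm (x - r)) (gauss_norm (y - s))"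
      by (intro N_diff_max diff_S xS yS rat_S r s)
    then have "gauss_norm (x - y - (r - s)) < d" using r s by (simp add: algebra_simps)
    then show "\<exists>e\<in>analytic. gauss_norm (x - y - e) < d" using rational_analytic[OF rat.diff_S[OF r(1) s(1)]] by blast
  qed
  show "x * y \<in> analytic"
  proof (rule analyticI[OF mult_S[OF xS yS]])
    fix d :: real assume d: "0 < d"
    define B where "B = gauss_norm x + gauss_norm y + 1"
    have B: "0 < B" "gauss_norm x < B" "gauss_norm y + 1 \<le> B" using N_ge_0[OF xS] N_ge_0[OF yS] by (auto simp: B_def)
    \<comment> \<open>The cap at 1 keeps the approximation s of y below \<open>B\<close> in
      norm.\<close>
    define d1 where "d1 = min 1 (d / B)"
    have d1: "0 < d1" "d1 \<le> 1" "B * d1 \<le> d" using d B by (auto simp: d1_def min_def field_simps)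
    obtain r where r: "r \<in> rational_functions K" "gauss_norm (x - r) < d1" using analyticD[OF x d1(1)] by blast
    obtain s where s: "s \<in> rational_functions K" "gauss_norm (y - s) < d1" using analyticD[OF y d1(1)] by blast
    note rS = rat_S[OF r(1)] and sS = rat_S[OF s(1)]
    have "gauss_norm (y - (y - s)) \<le> gauss_norm y + gauss_norm (y - s)" by (intro N_diff diff_S yS sS)
    then have Ns: "gauss_norm s < B" using s(2) d1(2) B(3) by simp
    have "gauss_norm (x * (y - s) - (r - x) * s) \<le> max (gauss_norm (x * (y - s))) (gauss_norm ((r - x) * s))"
      by (intro N_diff_max diff_S mult_S xS yS rS sS)
    also have "gauss_norm (x * (y - s)) = gauss_norm x * gauss_norm (y - s)" by (intro N_mult diff_S xS yS sS)
    also have "gauss_norm ((r - x) * s) = gauss_norm s * gauss_norm (x - r)"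
      using N_mult[OF diff_S[OF rS xS] sS] N_commute[OF rS xS] by simp
    also have "max (gauss_norm x * gauss_norm (y - s)) (gauss_norm s * gauss_norm (x - r)) < B * d1"
      unfolding max_less_iff_conj
      using B Ns r(2) s(2) by (auto intro!: mult_strict_mono N_ge_0 diff_S xS yS rS sS)
    finally have "gauss_norm (x * y - r * s) < d" using d1(3) by (simp add: algebra_simps)
    then show "\<exists>e\<in>analytic. gauss_norm (x * y - e) < d" using rational_analytic[OF rat.mult_S[OF r(1) s(1)]] by blast
  qed
qed

sublocale an: valued_subfield analytic gauss_norm
  by (rule valued_subfield_analytic)

lemma frob3_analytic: assumes "x \<in> analytic" shows "frob3 x \<in> analytic"
proof (rule analyticI)
  note xS = analytic_S[OF assms]
  show "frob3 x \<in> bounded_quotients K" by (rule frob3_S[OF xS])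
  fix d :: real assume "0 < d"
  then obtain r where r: "r \<in> rational_functions K" "gauss_norm (x - r) < d" using analyticD[OF assms] by blast
  have "gauss_norm (frob3 x - frob3 r) = gauss_norm (x - r)"
    using frob3_S(2)[OF diff_S[OF xS rat_S[OF r(1)]]] by simp
  then show "\<exists>e\<in>analytic. gauss_norm (frob3 x - e) < d"
    using r rational_analytic[OF frob3_rational[OF r(1)]] by (intro bexI[of _ "frob3 r"]) auto
qed

lemma deriv_analytic: assumes "x \<in> analytic" shows "fls_deriv x \<in> analytic"
proof (rule analyticI)
  note xS = analytic_S[OF assms]
  show "fls_deriv x \<in> bounded_quotients K" by (rule deriv_S[OF xS])
  fix d :: real assume "0 < d"
  then obtain r where r: "r \<in> rational_functions K" "gauss_norm (x - r) < d" using analyticD[OF assms] by blast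
  have "gauss_norm (fls_deriv x - fls_deriv r) \<le> gauss_norm (x - r)"
    using deriv_S(2)[OF diff_S[OF xS rat_S[OF r(1)]]] by simp
  then show "\<exists>e\<in>analytic. gauss_norm (fls_deriv x - e) < d"
    using r rational_analytic[OF deriv_rational[OF r(1)]] by (intro bexI[of _ "fls_deriv r"]) auto
qed

lemma N_const: assumes "c \<in> K" shows "fls_const c \<in> bounded_quotients K" "gauss_norm (fls_const c) = absval c"
proof -
  have b: "fps_const c \<in> bounded_series K"
    using poly_series[of "[:c:]"] assms K_closed(1) by (simp add: fps_of_poly_const coeff_pCons split: nat.split)
  show "fls_const c \<in> bounded_quotients K" using series_S(1)[OF b] by (simp add: fps_const_to_fls)
  have "sup_norm (fps_const c) = absval c"
    by (rule antisym[OF sup_norm_least]) (use sup_norm_upper[OF b, of 0] in auto)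
  then show "gauss_norm (fls_const c) = absval c" using series_S(2)[OF b] by (simp add: fps_const_to_fls)
qed

lemma N_X: "fls_X \<in> bounded_quotients K" "gauss_norm (fls_X :: 'c fls) = 1"
proof -
  have b: "fps_X \<in> bounded_series K"
    using poly_series[of "[:0, 1:]"] K_closed(1,2) by (simp add: fps_of_poly_fps_X coeff_pCons split: nat.split)
  show "(fls_X :: 'c fls) \<in> bounded_quotients K" using series_S(1)[OF b] by simp
  have "sup_norm (fps_X :: 'c fps) = 1"
    by (rule antisym[OF sup_norm_least]) (use sup_norm_upper[OF b, of 1] in auto)
  then show "gauss_norm (fls_X :: 'c fls) = 1" using series_S(2)[OF b] by simp
qed

lemma unit_series_S: assumes "u \<in> unit_series K"
  shows "u \<in> bounded_quotients K" "gauss_norm u = 1" "u \<noteq> 0"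
proof -
  obtain F where F: "F \<in> bounded_series K" "fps_nth F 0 = 1" "\<And>n. absval (fps_nth F n) \<le> 1" "u = fps_to_fls F"
    using assms by (auto simp: unit_series_def)
  show "u \<in> bounded_quotients K" using series_S F by simp
  show *: "gauss_norm u = 1" using N_series_le[OF F(1,3)] N_series_nth[OF F(1), of 0] F(2,4) by simp
  show "u \<noteq> 0" using * N_0 by auto
qed

lemma unit_series_mult: assumes "u \<in> unit_series K" "v \<in> unit_series K"
  shows "u * v \<in> unit_series K"
proof -
  obtain F where F: "F \<in> bounded_series K" "fps_nth F 0 = 1" "\<And>n. absval (fps_nth F n) \<le> 1" "u = fps_to_fls F"
    using assms by (auto simp: unit_series_def)
  obtain G where G: "G \<in> bounded_series K" "fps_nth G 0 = 1" "\<And>n. absval (fps_nth G n) \<le> 1" "v = fps_to_fls G"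
    using assms by (auto simp: unit_series_def)
  have "absval (fps_nth (F * G) n) \<le> 1" for n
    unfolding fps_mult_nth
    by (intro ultra_absval_sum_le) (auto simp: ultrametric_absval_mult F(3) G(3) intro: mult_le_one)
  then show ?thesis
    unfolding unit_series_def using bs_mult[OF K F(1) G(1)] F G
    by (intro image_eqI[of _ _ "F * G"]) (auto simp: fls_times_fps_to_fls)
qed

text \<open>The recursion for the coefficients of 1/F divides only by the constant term 1, so they
  stay in K and integral.\<close>

lemma unit_series_inverse: assumes "u \<in> unit_series K"
  shows "inverse u \<in> unit_series K"
proof -
  obtain F where F: "F \<in> bounded_series K" "fps_nth F 0 = 1" "\<And>n. absval (fps_nth F n) \<le> 1" "u = fps_to_fls F"
    using assms by (auto simp: unit_series_def)
  define G where "G = inverse F"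
  have FG: "F * G = 1" unfolding G_def using F(2) by (subst mult.commute) (auto intro: inverse_mult_eq_1)
  have G0: "fps_nth G 0 = 1" using arg_cong[OF FG, of "\<lambda>f. fps_nth f 0"] F(2) by simp
  have "fps_nth G n \<in> K \<and> absval (fps_nth G n) \<le> 1" for n
  proof (induction n rule: less_induct)
    case (less n)
    show ?case
    proof (cases "n = 0")
      case False
      have "0 = fps_nth (F * G) n" using FG False by simp
      also have "\<dots> = fps_nth G n + (\<Sum>i=Suc 0..n. fps_nth F i * fps_nth G (n - i))"
        unfolding fps_mult_nth by (subst sum.atLeast_Suc_atMost) (auto simp: F(2))
      finally have e: "fps_nth G n = - (\<Sum>i=Suc 0..n. fps_nth F i * fps_nth G (n - i))"
        by (simp add: eq_neg_iff_add_eq_0)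
      have "absval (\<Sum>i=Suc 0..n. fps_nth F i * fps_nth G (n - i)) \<le> 1"
        using less by (intro ultra_absval_sum_le) (auto simp: ultrametric_absval_mult F(3) intro!: mult_le_one)
      moreover have "(\<Sum>i=Suc 0..n. fps_nth F i * fps_nth G (n - i)) \<in> K"
        using less F(1) by (intro K_sum[OF K] K_closed) (auto simp: bounded_series_def)
      ultimately show ?thesis unfolding e using K_closed(5) by simp
    qed (simp add: G0 K_closed)
  qed
  then have "G \<in> bounded_series K" "\<And>n. absval (fps_nth G n) \<le> 1" by (auto simp: bounded_series_def intro!: bdd_aboveI[of _ 1])
  moreover have "inverse u = fps_to_fls G"
    by (rule inverse_unique) (simp add: F(4) FG flip: fls_times_fps_to_fls)
  ultimately show ?thesis using G0 by (auto simp: unit_series_def)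
qed

lemma unit_series_1: "1 \<in> unit_series K"
  unfolding unit_series_def using bs_1[OF K] by (intro image_eqI[of _ _ 1]) auto

lemma unit_series_power: "u \<in> unit_series K \<Longrightarrow> u ^ n \<in> unit_series K"
  by (induction n) (auto simp: unit_series_mult unit_series_1)

lemma unit_series_power_int: "u \<in> unit_series K \<Longrightarrow> u powi i \<in> unit_series K"
  by (auto simp: power_int_def intro: unit_series_power unit_series_inverse)

text \<open>Division by a denominator coefficient of maximal absolute value, which lies in K. The
  index e is the pivot both for \<open>subst_pow_eigen_small\<close> and for the recurrence in
  \<open>rational_mod_3_periodic\<close>; the latter also uses the finite supports.\<close>

lemma rational_normalized:
  assumes "r \<in> rational_functions K"
  obtains F G e where "F \<in> bounded_series K" "G \<in> bounded_series K" "r = fps_to_fls F / fps_to_fls G"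
    "G \<noteq> 0" "sup_norm G = 1" "\<And>i. absval (fps_nth G i) \<le> 1" "absval (fps_nth G e) = 1" "\<And>i. i < e \<Longrightarrow> absval (fps_nth G i) < 1"
    "finite {i. fps_nth F i \<noteq> 0}" "finite {i. fps_nth G i \<noteq> 0}"
proof -
  obtain P Q where PQ: "\<forall>i. poly.coeff P i \<in> K" "\<forall>i. poly.coeff Q i \<in> K" "Q \<noteq> 0" "r = poly_to_fls P / poly_to_fls Q"
    using assms by (rule rational_cases)
  have "sup_norm (fps_of_poly Q) \<in> (\<lambda>i. absval (poly.coeff Q i)) ` {..Polynomial.degree Q}"
    unfolding fps_of_poly_bounded(2) by (intro Max_in) auto
  then obtain j where j: "absval (poly.coeff Q j) = sup_norm (fps_of_poly Q)" by auto
  define q where "q = poly.coeff Q j"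
  have "0 < sup_norm (fps_of_poly Q)" using sup_norm_pos[OF poly_series[OF PQ(2)]] PQ(3) by simp
  then have q: "q \<noteq> 0" "q \<in> K" using j PQ(2) by (auto simp: q_def)
  define F where "F = fps_of_poly (Polynomial.smult (inverse q) P)"
  define G where "G = fps_of_poly (Polynomial.smult (inverse q) Q)"
  have FK: "F \<in> bounded_series K" "G \<in> bounded_series K"
    unfolding F_def G_def using PQ K_inverse[OF q(2)] K_closed(4) by (auto intro!: poly_series)
  have G0: "G \<noteq> 0" using q PQ(3) by (simp add: G_def)
  have "r = fps_to_fls F / fps_to_fls G"
    using q unfolding PQ(4) F_def G_def poly_to_fls_def by (simp add: fps_of_poly_smult fls_times_fps_to_fls)
  moreover have le: "absval (fps_nth G i) \<le> 1" for i
  proof -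
    have "absval (poly.coeff Q i) \<le> absval q"
      using sup_norm_upper[OF poly_series[OF PQ(2)], of i] j by (simp add: q_def)
    moreover have "0 < absval q" using q(1) by (metis order_le_less ultra_absval_eq_0 ultra_absval_ge_0)
    ultimately show ?thesis
      by (simp add: G_def absval_divide pos_divide_le_eq divide_inverse_commute[symmetric])
  qed
  moreover have j1: "absval (fps_nth G j) = 1"
    using q by (simp add: G_def ultrametric_absval_mult absval_inverse q_def[symmetric])
  moreover have "sup_norm G = 1"
    using sup_norm_least[of G 1] le sup_norm_upper[OF FK(2), of j] j1 by (intro antisym) auto
  moreover define e where "e = (LEAST e. absval (fps_nth G e) = 1)"
  moreover have "absval (fps_nth G e) = 1" unfolding e_def using j1 by (rule LeastI)
  moreover have "absval (fps_nth G i) < 1" if "i < e" for i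
    using le[of i] not_less_Least[of i "\<lambda>e. absval (fps_nth G e) = 1"] that unfolding e_def by force
  moreover have "finite {i. fps_nth (fps_of_poly R) i \<noteq> 0}" for R :: "'c poly"
    by (rule finite_subset[of _ "{..Polynomial.degree R}"]) (auto intro: le_degree)
  ultimately show ?thesis
    using that[OF FK _ G0] unfolding F_def G_def by blast
qed

text \<open>Clearing the denominator of x = Y / G turns the hypothesis into a bound on Y F(G) - F(Y)
  G. Subtracting k G from Y leaves this unchanged, since F fixes constants, and with k = Y_e / G_e
  makes coefficient e vanish, as \<open>subst_pow_eigen_small\<close> requires.\<close>

lemma frob3_eigen_const_rational:
  assumes r: "r \<in> rational_functions K" and U: "U \<in> bounded_series K" and d: "0 \<le> d"
    and x: "x = r * fps_to_fls U" "gauss_norm (frob3 x - x) \<le> d"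
  shows "\<exists>k\<in>K. gauss_norm (x - fls_const k) \<le> d"
proof -
  obtain F G e where FG: "F \<in> bounded_series K" "G \<in> bounded_series K" "r = fps_to_fls F / fps_to_fls G"
    "G \<noteq> 0" "sup_norm G = 1" "\<And>i. absval (fps_nth G i) \<le> 1" "absval (fps_nth G e) = 1" "\<And>i. i < e \<Longrightarrow> absval (fps_nth G i) < 1"
    using rational_normalized[OF r] by metis
  define Y where "Y = F * U"
  have Y: "Y \<in> bounded_series K" unfolding Y_def by (rule bs_mult[OF K FG(1) U])
  have xY: "x = fps_to_fls Y / fps_to_fls G" by (simp add: x FG Y_def fls_times_fps_to_fls)
  define k where "k = fps_nth Y e / fps_nth G e"
  have Ge: "fps_nth G e \<noteq> 0" using FG(7) by auto
  have kK: "k \<in> K" using Y FG(2) K_closed(4) K_inverse by (auto simp: k_def bounded_series_def divide_inverse)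
  have kb: "fps_const k \<in> bounded_series K"
    using poly_series[of "[:k:]"] kK K_closed(1) by (simp add: fps_of_poly_const coeff_pCons split: nat.split)
  define y where "y = Y - fps_const k * G"
  have y: "y \<in> bounded_series K" unfolding y_def by (intro conjunct1[OF bs_diff[OF K]] bs_mult[OF K] Y kb FG(2))
  note FrG = bounded_series_subst_pow[OF FG(2)]
  have FrG0: "subst_pow 3 G \<noteq> 0"
    using frob3_inj[of "fps_to_fls G"] FG(4) by (simp add: fls_compose_power_fps_to_fls)
  have key: "y * subst_pow 3 G - subst_pow 3 y * G = Y * subst_pow 3 G - subst_pow 3 Y * G"
    unfolding y_def by (simp add: subst_pow_diff subst_pow_mult algebra_simps)
  have D: "Y * subst_pow 3 G - subst_pow 3 Y * G \<in> bounded_series K"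
    by (intro conjunct1[OF bs_diff[OF K]] bs_mult[OF K] Y FrG FG(2) bounded_series_subst_pow)
  have "x - frob3 x = fps_to_fls (Y * subst_pow 3 G - subst_pow 3 Y * G) / fps_to_fls (G * subst_pow 3 G)"
    unfolding xY frob3_divide using FG(4) FrG0
    by (simp add: fls_compose_power_fps_to_fls fls_times_fps_to_fls diff_frac_eq)
  then have "gauss_norm (x - frob3 x) = sup_norm (Y * subst_pow 3 G - subst_pow 3 Y * G)"
    using N_quotient(2)[OF D bs_mult[OF K FG(2) FrG]] FG(4,5) FrG0
      sup_norm_mult(2)[OF bs_UNIV[OF K FG(2)] bs_UNIV[OF K FrG]] sup_norm_subst_pow[OF FG(2)] by simp
  moreover have xS: "x \<in> bounded_quotients K" unfolding xY by (rule N_quotient(1)[OF Y FG(2,4)])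
  ultimately have dd: "sup_norm (Y * subst_pow 3 G - subst_pow 3 Y * G) \<le> d"
    using x(2) N_commute[OF xS frob3_S(1)[OF xS]] by simp
  \<comment> \<open>Finitely many coefficients precede e, so one bound below 1 serves all of them; 0
    is inserted for the case e = 0.\<close>
  define \<rho> where "\<rho> = Max (insert 0 ((\<lambda>i. absval (fps_nth G i)) ` {..<e}))"
  have "\<rho> \<in> insert 0 ((\<lambda>i. absval (fps_nth G i)) ` {..<e})" unfolding \<rho>_def by (intro Max_in) auto
  then have \<rho>: "\<rho> < 1" "0 \<le> \<rho>" using FG(8) by auto
  have "absval (fps_nth y n) \<le> d" for n
  proof (rule subst_pow_eigen_small[OF bs_UNIV[OF K y] FG(6,7) \<rho> _ _ d])
    show "absval (fps_nth G i) \<le> \<rho>" if "i < e" for i unfolding \<rho>_def using that by (intro Max_ge) auto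
    show "fps_nth y e = 0" using Ge by (simp add: y_def k_def)
    show "absval (fps_nth (y * subst_pow 3 G - subst_pow 3 y * G) n) \<le> d" for n
      unfolding key using sup_norm_upper[OF D, of n] dd by linarith
  qed
  then have "sup_norm y \<le> d" by (rule sup_norm_least)
  moreover have "x - fls_const k = fps_to_fls y / fps_to_fls G"
  proof -
    have "fps_to_fls y = fps_to_fls Y - fls_const k * fps_to_fls G"
      by (simp add: y_def fls_times_fps_to_fls fps_to_fls_minus fps_const_to_fls)
    then show ?thesis using FG(4) by (simp add: xY diff_divide_distrib)
  qed
  ultimately show ?thesis using kK N_quotient(2)[OF y FG(2,4)] FG(5) by (intro bexI[of _ k]) auto
qed

text \<open>As u has norm 1, replacing c by a rational function within d moves c u and its Frobenius
  image by at most d, and the ultrametric inequality keeps the bound d.\<close>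

lemma frob3_eigen_const:
  assumes c: "c \<in> analytic" and u: "u \<in> unit_series K" and d: "0 < d" "gauss_norm (frob3 (c * u) - c * u) \<le> d"
  shows "\<exists>k\<in>K. gauss_norm (c * u - fls_const k) \<le> d"
proof -
  note uS = unit_series_S[OF u] and cS = analytic_S[OF c]
  obtain r where r: "r \<in> rational_functions K" "gauss_norm (c - r) < d" using analyticD[OF c d(1)] by blast
  note rS = rat_S[OF r(1)]
  have xS: "c * u \<in> bounded_quotients K" "r * u \<in> bounded_quotients K" by (intro mult_S cS rS uS)+
  have diff: "gauss_norm (c * u - r * u) \<le> d"
    using N_mult[OF diff_S[OF cS rS] uS(1)] uS(2) r(2) by (simp add: algebra_simps)
  have fdiff: "gauss_norm (frob3 (c * u) - frob3 (r * u)) \<le> d"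
    using diff frob3_S(2)[OF diff_S[OF xS]] by (simp del: fls_compose_power_mult)
  have "gauss_norm ((frob3 (c * u) - c * u) - ((frob3 (c * u) - frob3 (r * u)) - (c * u - r * u))) \<le> d"
    by (intro N_diff_le diff_S xS frob3_S d fdiff diff)
  then have 1: "gauss_norm (frob3 (r * u) - r * u) \<le> d" by (simp add: algebra_simps)
  obtain U where U: "U \<in> bounded_series K" "u = fps_to_fls U" using u by (auto simp: unit_series_def)
  obtain k where k: "k \<in> K" "gauss_norm (r * u - fls_const k) \<le> d"
    using frob3_eigen_const_rational[OF r(1) U(1) less_imp_le[OF d(1)] _ 1] U(2) by blast
  have "gauss_norm ((c * u - r * u) + (r * u - fls_const k)) \<le> d"
    by (intro N_add_le diff_S xS N_const k diff)
  then show ?thesis using k(1) by auto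
qed

end

section \<open>Algebraic relations and Frobenius\<close>

lemma frob3_sum: "frob3 (sum f A) = (\<Sum>x\<in>A. frob3 (f x))"
  by (induction A rule: infinite_finite_induct) auto

lemma frob3_power_int: "frob3 (x powi i) = frob3 (x :: 'c::ultrametric_field fls) powi i"
proof -
  have "frob3 (inverse y) = inverse (frob3 y)" for y :: "'c fls"
  proof (cases "y = 0")
    case False
    have "frob3 y * frob3 (inverse y) = 1" using False by (simp flip: fls_compose_power_mult)
    then show ?thesis by (metis inverse_unique)
  qed simp
  then show ?thesis by (auto simp: power_int_def)
qed

context base_field
begin

section \<open>Null sequences and shortest relations\<close>

definition null :: "(nat \<Rightarrow> 'c fls) \<Rightarrow> bool" where
  "null s \<longleftrightarrow> (\<forall>n. s n \<in> bounded_quotients K) \<and> (\<lambda>n. gauss_norm (s n)) \<longlonglongrightarrow> 0"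

lemma null_le:
  assumes "\<And>n. t n \<in> bounded_quotients K" "\<And>n. gauss_norm (t n) \<le> g n" "g \<longlonglongrightarrow> 0"
  shows "null t"
  unfolding null_def
proof (intro conjI allI assms(1))
  show "(\<lambda>n. gauss_norm (t n)) \<longlonglongrightarrow> 0"
    by (rule tendsto_sandwich[OF _ _ tendsto_const assms(3)]) (auto intro!: always_eventually N_ge_0 assms)
qed

lemma null_diff: assumes "null s" "null t" shows "null (\<lambda>n. s n - t n)"
proof (rule null_le)
  show "(\<lambda>n. gauss_norm (s n) + gauss_norm (t n)) \<longlonglongrightarrow> 0"
    using tendsto_add[of "\<lambda>n. gauss_norm (s n)" 0 _ "\<lambda>n. gauss_norm (t n)" 0] assms by (simp add: null_def)
qed (use assms in \<open>auto simp: null_def intro!: diff_S N_diff\<close>)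

lemma null_mult: assumes "null s" "\<And>n. t n \<in> bounded_quotients K" "\<And>n. gauss_norm (t n) \<le> B"
  shows "null (\<lambda>n. s n * t n)"
proof (rule null_le)
  show "(\<lambda>n. gauss_norm (s n) * B) \<longlonglongrightarrow> 0"
    using tendsto_mult[of "\<lambda>n. gauss_norm (s n)" 0 _ "\<lambda>n. B" B] assms by (simp add: null_def)
  show "gauss_norm (s n * t n) \<le> gauss_norm (s n) * B" for n
    using assms by (auto simp: null_def N_mult intro!: mult_left_mono N_ge_0)
qed (use assms in \<open>auto simp: null_def intro!: mult_S\<close>)

lemma null_0: "null (\<lambda>n. 0)"
  by (simp add: null_def zero_S N_0)

lemma null_add: assumes "null s" "null t" shows "null (\<lambda>n. s n + t n)"
  using null_diff[OF assms(1) null_diff[OF null_0 assms(2)]] by simp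

lemma null_sum: "(\<And>x. x \<in> I \<Longrightarrow> null (s x)) \<Longrightarrow> null (\<lambda>n. \<Sum>x\<in>I. s x n)"
  by (induction I rule: infinite_finite_induct) (auto intro: null_add null_0)

lemma null_frob3: assumes "null s" shows "null (\<lambda>n. frob3 (s n))"
  using assms by (auto simp: null_def frob3_S)

lemma not_null_1: "\<not> null (\<lambda>n. 1)"
  by (simp add: null_def N_1 LIMSEQ_const_iff)

lemma cauchy_frob3: assumes "s \<in> cauchy_seqs analytic gauss_norm" shows "(\<lambda>n. frob3 (s n)) \<in> cauchy_seqs analytic gauss_norm"
proof (rule an.C_I)
  show "frob3 (s n) \<in> analytic" for n by (rule frob3_analytic[OF an.C_S[OF assms]])
  fix d :: real assume "0 < d"
  then obtain M where "\<forall>m\<ge>M. \<forall>n\<ge>M. gauss_norm (s m - s n) < d" using an.C_D[OF assms] by blast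
  moreover have "gauss_norm (frob3 (s m) - frob3 (s n)) = gauss_norm (s m - s n)" for m n
    using frob3_S(2)[OF diff_S[OF analytic_S analytic_S], OF an.C_S an.C_S, OF assms assms] by simp
  ultimately show "\<exists>M. \<forall>m\<ge>M. \<forall>n\<ge>M. gauss_norm (frob3 (s m) - frob3 (s n)) < d" by metis
qed

text \<open>The minimal relation argument: applying Frobenius to a normalized relation and subtracting
  shortens it, so in the shortest one every term is an eigenvector of Frobenius, hence constant.\<close>

lemma relation_trivial:
  assumes h: "h \<in> unit_series K" "frob3 h = v * h" "v \<in> analytic"
    and A: "A \<in> unit_series K" "frob3 A = w * A" "w \<in> analytic"
    and indep: "\<And>a b. h powi a * A powi b \<in> analytic \<Longrightarrow> a = 0 \<and> b = 0"
  shows "finite I \<Longrightarrow> (\<And>ij. ij \<in> I \<Longrightarrow> r ij \<in> cauchy_seqs analytic gauss_norm) \<Longrightarrow>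
    null (\<lambda>n. \<Sum>ij\<in>I. r ij n * (h ^ fst ij * A ^ snd ij)) \<Longrightarrow> ij \<in> I \<Longrightarrow> null (r ij)"
proof (induction "card I" arbitrary: I r ij rule: less_induct)
  case less
  have nz: "h \<noteq> 0" "A \<noteq> 0" using unit_series_S(3) h(1) A(1) by auto
  have N1: "gauss_norm v = 1" "gauss_norm w = 1"
    using frob3_S(2)[OF unit_series_S(1)[OF h(1)]] frob3_S(2)[OF unit_series_S(1)[OF A(1)]]
      unit_series_S h A N_mult[OF analytic_S] by simp_all
  then have vw0: "v \<noteq> 0" "w \<noteq> 0" using N_0 by auto
  define m where "m ij = h ^ fst ij * A ^ snd ij" for ij :: "nat \<times> nat"
  define q where "q ij = v ^ fst ij * w ^ snd ij" for ij :: "nat \<times> nat"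
  have m: "m ij \<in> unit_series K" for ij unfolding m_def by (intro unit_series_mult unit_series_power h A)
  note mS = unit_series_S[OF m]
  have q: "q ij \<in> analytic" for ij unfolding q_def by (intro an.mult_S an.power_S h A)
  have qS: "q ij \<in> bounded_quotients K" for ij by (rule analytic_S[OF q])
  have Nq: "gauss_norm (q ij) = 1" for ij
    unfolding q_def by (simp add: N_mult N_power N1 power_S analytic_S h A)
  have q0: "q ij \<noteq> 0" for ij by (simp add: q_def vw0)
  have frob_m: "frob3 (m ij) = q ij * m ij" for ij
    by (simp add: m_def q_def h A power_mult_distrib)
  show ?case
  proof (rule ccontr)
    define ij0 where "ij0 = ij"
    assume "\<not> null (r ij)"
    then have r0: "r ij0 \<notin> null_seqs analytic gauss_norm"
      using less.prems(2)[OF less.prems(4)] analytic_S an.C_S by (auto simp: null_def null_seqs_def ij0_def)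
    have ij0: "ij0 \<in> I" using less.prems by (simp add: ij0_def)
    \<comment> \<open>\<open>t\<close> inverts the coefficient \<open>r ij0\<close> up to a null
      sequence; multiplying by it normalizes the relation.\<close>
    obtain t where t: "t \<in> cauchy_seqs analytic gauss_norm" "(\<lambda>n. r ij0 n * t n - 1) \<in> null_seqs analytic gauss_norm"
      using an.inverse_C[OF less.prems(2)[OF ij0] r0] by blast
    define r' where "r' ij n = r ij n * t n" for ij n
    have r'C: "r' ij \<in> cauchy_seqs analytic gauss_norm" if "ij \<in> I" for ij
      unfolding r'_def by (rule an.C_mult[OF less.prems(2)[OF that] t(1)])
    have r'A: "r' ij n \<in> analytic" if "ij \<in> I" for ij n by (rule an.C_S[OF r'C[OF that]])
    have r'S: "r' ij n \<in> bounded_quotients K" if "ij \<in> I" for ij n by (rule analytic_S[OF r'A[OF that]])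
    have r'0: "null (\<lambda>n. r' ij0 n - 1)"
      using t(2) r'S[OF ij0] one_S unfolding null_def null_seqs_def r'_def by (auto intro: diff_S)
    define P where "P n = (\<Sum>ij\<in>I. r' ij n * m ij)" for n
    obtain B where B: "\<And>n. gauss_norm (t n) \<le> B" using an.C_bounded[OF t(1)] by blast
    have "null (\<lambda>n. (\<Sum>ij\<in>I. r ij n * (h ^ fst ij * A ^ snd ij)) * t n)"
      by (rule null_mult[OF less.prems(3) analytic_S[OF an.C_S[OF t(1)]] B])
    then have P: "null P" unfolding P_def r'_def m_def by (simp add: sum_distrib_left mult_ac)
    \<comment> \<open>The coefficients of F(P) - q ij0 * P. The one at \<open>ij0\<close> is null
      because \<open>r' ij0\<close> tends to 1, which F fixes.\<close>
    define s where "s ij n = frob3 (r' ij n) * q ij - q ij0 * r' ij n" for ij n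
    have sC: "s ij \<in> cauchy_seqs analytic gauss_norm" if "ij \<in> I" for ij
      using an.C_add[OF an.C_mult[OF cauchy_frob3[OF r'C[OF that]] an.C_const[OF q[of ij]]]
          an.C_minus[OF an.C_mult[OF an.C_const[OF q[of ij0]] r'C[OF that]]]]
      unfolding s_def by simp
    have "null (\<lambda>n. frob3 (P n) - P n * q ij0)"
      by (rule null_diff[OF null_frob3[OF P] null_mult[where B = 1, OF P qS]]) (simp add: Nq)
    moreover have "frob3 (P n) - P n * q ij0 = (\<Sum>ij\<in>I. s ij n * m ij)" for n
      unfolding P_def s_def
      by (simp add: frob3_sum frob_m sum_distrib_left right_diff_distrib sum_subtractf mult_ac)
    ultimately have "null (\<lambda>n. \<Sum>ij\<in>I. s ij n * m ij)" by simp
    moreover have "null (\<lambda>n. s ij0 n * m ij0)"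
    proof (rule null_mult[OF _ mS(1)])
      have "null (\<lambda>n. (frob3 (r' ij0 n - 1) - (r' ij0 n - 1)) * q ij0)"
        by (rule null_mult[where B = 1, OF null_diff[OF null_frob3[OF r'0] r'0] qS]) (simp add: Nq)
      then show "null (s ij0)" unfolding s_def by (simp add: algebra_simps)
      show "gauss_norm (m ij0) \<le> 1" by (simp add: mS)
    qed
    ultimately have "null (\<lambda>n. (\<Sum>ij\<in>I. s ij n * m ij) - s ij0 n * m ij0)" by (rule null_diff)
    then have sum0: "null (\<lambda>n. \<Sum>ij\<in>I - {ij0}. s ij n * (h ^ fst ij * A ^ snd ij))"
      using less.prems(1) ij0 by (simp add: sum_diff1 m_def)
    have s_null: "null (s ij)" if "ij \<in> I - {ij0}" for ij
      using that ij0 less.prems(1) sC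
      by (intro less.hyps[OF card_Diff1_less[OF less.prems(1) ij0] _ _ sum0]) auto
    \<comment> \<open>Otherwise the relation would shrink to the single monomial
      \<open>m ij0\<close>, of norm 1, with a coefficient tending to 1.\<close>
    have "\<exists>ij1\<in>I - {ij0}. \<not> null (r' ij1)"
    proof (rule ccontr)
      assume "\<not> ?thesis"
      then have "null (\<lambda>n. \<Sum>ij\<in>I - {ij0}. r' ij n * m ij)"
        by (intro null_sum null_mult[of _ _ 1] mS) (auto simp: mS)
      from null_diff[OF P this] have "null (\<lambda>n. r' ij0 n * m ij0)"
        unfolding P_def using less.prems(1) ij0 by (simp add: sum_diff1)
      from null_mult[OF this, of "\<lambda>_. inverse (m ij0)" 1] have "null (r' ij0)"
        using mS by (simp add: inverse_S N_inverse mult.assoc)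
      from null_diff[OF this r'0] show False using not_null_1 by simp
    qed
    then obtain ij1 where ij1: "ij1 \<in> I - {ij0}" "\<not> null (r' ij1)" by blast
    define a b where "a = int (fst ij1) - int (fst ij0)" and "b = int (snd ij1) - int (snd ij0)"
    define u where "u = h powi a * A powi b"
    have u: "u \<in> unit_series K" unfolding u_def by (intro unit_series_mult unit_series_power_int h A)
    note uS = unit_series_S[OF u]
    have "frob3 u = v powi a * w powi b * u"
      unfolding u_def by (simp add: frob3_power_int h A power_int_mult_distrib)
    also have "v powi a * w powi b = q ij1 * inverse (q ij0)"
      unfolding a_def b_def q_def using vw0 by (simp add: power_int_diff field_simps)
    finally have fu: "frob3 u = q ij1 * inverse (q ij0) * u" .
    \<comment> \<open>Nullity of \<open>s ij1\<close> now says that \<open>r' ij1 n * u\<close> is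
      almost fixed by F, with u the quotient of two monomials.\<close>
    have frob_x: "frob3 (r' ij1 n * u) - r' ij1 n * u = s ij1 n * (inverse (q ij0) * u)" for n
      unfolding s_def using q0[of ij0] by (simp add: fu field_simps)
    have c: "r' ij1 n \<in> analytic" "r' ij1 n \<in> bounded_quotients K" for n using r'A r'S ij1 by auto
    \<comment> \<open>The lower bound holds only infinitely often, which suffices: each precision d
      uses a single large n.\<close>
    obtain e where e: "0 < e" "\<And>M. \<exists>n\<ge>M. e \<le> gauss_norm (r' ij1 n)"
      using ij1(2) N_ge_0[OF c(2)] c(2) unfolding null_def LIMSEQ_def by (force simp: not_less)
    have "u \<in> analytic"
    proof (rule analyticI[OF uS(1)])
      fix d :: real assume d: "0 < d"
      \<comment> \<open>Division by \<open>r' ij1 n\<close> costs at most the factor 1 / e; the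
        factor 1/2 makes the final bound strict.\<close>
      define \<delta> where "\<delta> = d * e / 2"
      have \<delta>: "0 < \<delta>" using d e by (simp add: \<delta>_def)
      have "(\<lambda>n. gauss_norm (s ij1 n)) \<longlonglongrightarrow> 0" using s_null[OF ij1(1)] by (simp add: null_def)
      then have "\<forall>\<^sub>F n in sequentially. gauss_norm (s ij1 n) < \<delta>" using \<delta> by (intro order_tendstoD(2)) auto
      then obtain M where M: "\<And>n. n \<ge> M \<Longrightarrow> gauss_norm (s ij1 n) < \<delta>" by (auto simp: eventually_sequentially)
      obtain n where n: "n \<ge> M" "e \<le> gauss_norm (r' ij1 n)" using e(2) by blast
      have sS: "s ij1 n \<in> bounded_quotients K" using s_null[OF ij1(1)] by (simp add: null_def)
      have "gauss_norm (frob3 (r' ij1 n * u) - r' ij1 n * u) = gauss_norm (s ij1 n)"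
        unfolding frob_x by (simp add: N_mult mult_S inverse_S sS qS uS N_inverse Nq)
      then obtain k where k: "k \<in> K" "gauss_norm (r' ij1 n * u - fls_const k) \<le> \<delta>"
        using frob3_eigen_const[OF c(1)[of n] u \<delta>] M[OF n(1)] by auto
      have "r' ij1 n \<noteq> 0" using n(2) e(1) N_0 by auto
      then have "u - fls_const k * inverse (r' ij1 n) = (r' ij1 n * u - fls_const k) * inverse (r' ij1 n)"
        by (simp add: field_simps)
      then have "gauss_norm (u - fls_const k * inverse (r' ij1 n)) =
          gauss_norm (r' ij1 n * u - fls_const k) * inverse (gauss_norm (r' ij1 n))"
        by (simp add: N_mult N_inverse diff_S mult_S inverse_S c uS N_const k)
      also have "\<dots> \<le> \<delta> * inverse e"
        using k(2) n(2) e(1) \<delta> by (intro mult_mono) (auto intro: N_ge_0 c)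
      also have "\<dots> < d" using d e(1) by (simp add: \<delta>_def)
      finally show "\<exists>x\<in>analytic. gauss_norm (u - x) < d"
        by (intro bexI[of _ "fls_const k * inverse (r' ij1 n)"])
           (auto intro!: an.mult_S an.inverse_S c rational_analytic[OF rational_const] k)
    qed
    then have "a = 0" "b = 0" using indep unfolding u_def by blast+
    then show False using ij1(1) unfolding a_def b_def by (auto simp: prod_eq_iff)
  qed
qed

section \<open>From relations in the ambient field to null sequences\<close>

abbreviation "L \<equiv> ambient_field K"
abbreviation "cl \<equiv> seq_class (bounded_quotients K) gauss_norm"

lemma rational_cauchy:
  assumes "s \<in> cauchy_seqs (rational_functions K) gauss_norm"
  shows "s \<in> cauchy_seqs (bounded_quotients K) gauss_norm" "s \<in> cauchy_seqs analytic gauss_norm"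
  using assms rat_S rational_analytic unfolding cauchy_seqs_def by auto

lemma embed_analytic:
  assumes "x \<in> analytic"
  shows "embed_ambient K x \<in> analytic_elements K"
proof -
  have "\<forall>n. \<exists>r\<in>rational_functions K. gauss_norm (x - r) < (1 / 2) ^ n"
    using analyticD[OF assms] by simp
  then obtain r where r: "\<And>n. r n \<in> rational_functions K" "\<And>n. gauss_norm (x - r n) < (1 / 2) ^ n"
    by metis
  note xS = analytic_S[OF assms] and rS = rat_S[OF r(1)]
  have z: "null (\<lambda>n. x - r n)"
    by (rule null_le[of _ "\<lambda>n. (1 / 2) ^ n"]) (auto intro!: diff_S xS rS less_imp_le[OF r(2)] LIMSEQ_realpow_zero)
  have c: "r \<in> cauchy_seqs (rational_functions K) gauss_norm"
  proof (rule rat.C_I[OF r(1)])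
    fix e :: real assume "0 < e"
    then have "\<forall>\<^sub>F n in sequentially. gauss_norm (x - r n) < e"
      using z unfolding null_def by (intro order_tendstoD(2)) auto
    then obtain M where M: "\<And>n. n \<ge> M \<Longrightarrow> gauss_norm (x - r n) < e" by (auto simp: eventually_sequentially)
    have "gauss_norm (r m - r n) < e" if "m \<ge> M" "n \<ge> M" for m n
      using N_trans_less[OF rS xS rS] M that N_commute[OF xS rS] by metis
    then show "\<exists>M. \<forall>m\<ge>M. \<forall>n\<ge>M. gauss_norm (r m - r n) < e" by blast
  qed
  have "(\<lambda>n. x - r n) \<in> cauchy_seqs (bounded_quotients K) gauss_norm"
    using C_add[OF C_const[OF xS] C_minus[OF rational_cauchy(1)[OF c]]] by simp
  then have "cl (\<lambda>_. x) = cl r"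
    using z seq_class_eq_iff[OF C_const[OF xS] rational_cauchy(1)[OF c]] by (simp add: null_seqs_def null_def)
  then show ?thesis unfolding embed_ambient_def analytic_elements_def using c by blast
qed

text \<open>Forming classes is a ring homomorphism, so the relation is the class of a sequence
  computed termwise, with \<open>x\<close> and \<open>y\<close> as constant sequences.\<close>

lemma relation_class:
  assumes "finite I" "\<And>ij. ij \<in> I \<Longrightarrow> c ij = cl (r ij)"
    "\<And>ij. ij \<in> I \<Longrightarrow> r ij \<in> cauchy_seqs (bounded_quotients K) gauss_norm"
    "x \<in> bounded_quotients K" "y \<in> bounded_quotients K"
  shows "finsum L (\<lambda>(i, j). c (i, j) \<otimes>\<^bsub>L\<^esub> (embed_ambient K x [^]\<^bsub>L\<^esub> (i::nat)) \<otimes>\<^bsub>L\<^esub> (embed_ambient K y [^]\<^bsub>L\<^esub> (j::nat))) I = \<zero>\<^bsub>L\<^esub>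
    \<longleftrightarrow> null (\<lambda>n. \<Sum>ij\<in>I. r ij n * (x ^ fst ij * y ^ snd ij))"
proof -
  interpret L: Ring.field L by (rule field_ambient[OF K])
  interpret Rc: cring "cauchy_ring (bounded_quotients K) gauss_norm" by (rule cring_R)
  interpret cl: ring_hom_cring "cauchy_ring (bounded_quotients K) gauss_norm" L cl
    by unfold_locales (use seq_class_hom in \<open>simp add: ambient_field_def\<close>)
  define T where "T ij n = r ij n * (x ^ fst ij * y ^ snd ij)" for ij n
  have T_fun: "T ij = (\<lambda>n. r ij n * (x ^ fst ij * y ^ snd ij))" for ij by (simp add: T_def fun_eq_iff)
  have TC: "T ij \<in> cauchy_seqs (bounded_quotients K) gauss_norm" if "ij \<in> I" for ij
    unfolding T_def by (intro C_mult[OF assms(3)[OF that] C_const] mult_S power_S assms)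
  have pw: "embed_ambient K z [^]\<^bsub>L\<^esub> i = cl (\<lambda>_. z ^ i)" if "z \<in> bounded_quotients K" for z and i :: nat
  proof (induction i)
    case 0
    show ?case using cl.hom_one by (simp add: R_simps)
  next
    case (Suc i)
    then show ?case
      using cl.hom_mult[of "\<lambda>_. z ^ i" "\<lambda>_. z"] that
      by (simp add: R_simps C_const power_S embed_ambient_def mult.commute)
  qed
  have tm: "(\<lambda>(i, j). c (i, j) \<otimes>\<^bsub>L\<^esub> (embed_ambient K x [^]\<^bsub>L\<^esub> i) \<otimes>\<^bsub>L\<^esub> (embed_ambient K y [^]\<^bsub>L\<^esub> j)) ij = cl (T ij)"
    if "ij \<in> I" for ij
  proof -
    have xy: "(\<lambda>_. x ^ i) \<in> cauchy_seqs (bounded_quotients K) gauss_norm" "(\<lambda>_. y ^ i) \<in> cauchy_seqs (bounded_quotients K) gauss_norm" for i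
      by (intro C_const power_S assms)+
    show ?thesis
      using cl.hom_mult[of "r ij" "\<lambda>_. x ^ fst ij"] cl.hom_mult[of "\<lambda>n. r ij n * x ^ fst ij" "\<lambda>_. y ^ snd ij"]
        xy C_mult[OF assms(3)[OF that] xy(1)] assms(2,3)[OF that]
      by (simp add: case_prod_beta pw assms(4,5) R_simps T_fun mult.assoc)
  qed
  have fs: "finsum L (\<lambda>ij. cl (T ij)) J = cl (\<lambda>n. \<Sum>ij\<in>J. T ij n) \<and> (\<lambda>n. \<Sum>ij\<in>J. T ij n) \<in> cauchy_seqs (bounded_quotients K) gauss_norm"
    if "J \<subseteq> I" for J
    using finite_subset[OF that assms(1)] that
  proof (induction J rule: finite_induct)
    case empty
    show ?case using cl.hom_zero C_const[OF zero_S] by (simp add: R_simps)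
  next
    case (insert j J)
    have cT: "cl (T ij) \<in> carrier L" if "ij \<in> I" for ij using cl.hom_closed TC[OF that] by (simp add: R_simps)
    have "finsum L (\<lambda>ij. cl (T ij)) (insert j J) = cl (T j) \<oplus>\<^bsub>L\<^esub> finsum L (\<lambda>ij. cl (T ij)) J"
      using insert by (intro L.finsum_insert) (auto intro: cT)
    also have "\<dots> = cl (\<lambda>n. T j n + (\<Sum>ij\<in>J. T ij n))"
      using insert TC cl.hom_add[of "T j" "\<lambda>n. \<Sum>ij\<in>J. T ij n"] by (simp add: R_simps)
    finally show ?case using insert C_add[OF TC, of j] by simp
  qed
  have "finsum L (\<lambda>(i, j). c (i, j) \<otimes>\<^bsub>L\<^esub> (embed_ambient K x [^]\<^bsub>L\<^esub> i) \<otimes>\<^bsub>L\<^esub> (embed_ambient K y [^]\<^bsub>L\<^esub> j)) I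
      = finsum L (\<lambda>ij. cl (T ij)) I"
    using cl.hom_closed TC tm by (intro L.finsum_cong) (auto simp: R_simps simp_implies_def)
  also have "\<dots> = cl (\<lambda>n. \<Sum>ij\<in>I. T ij n)" using fs by blast
  also have "\<zero>\<^bsub>L\<^esub> = cl (\<lambda>_. 0)" using cl.hom_zero by (simp add: R_simps)
  ultimately have "?thesis \<longleftrightarrow> (cl (\<lambda>n. \<Sum>ij\<in>I. T ij n) = cl (\<lambda>_. 0) \<longleftrightarrow> null (\<lambda>n. \<Sum>ij\<in>I. T ij n))"
    by (simp add: T_def)
  moreover have sC: "(\<lambda>n. \<Sum>ij\<in>I. T ij n) \<in> cauchy_seqs (bounded_quotients K) gauss_norm" using fs by blast
  ultimately show ?thesis
    using seq_class_eq_iff[OF sC C_const[OF zero_S]] C_S[OF sC] by (simp add: null_seqs_def null_def)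
qed

lemma class_eq_0_iff: assumes "s \<in> cauchy_seqs (bounded_quotients K) gauss_norm"
  shows "cl s = \<zero>\<^bsub>L\<^esub> \<longleftrightarrow> null s"
proof -
  interpret L: Ring.field L by (rule field_ambient[OF K])
  interpret Rc: cring "cauchy_ring (bounded_quotients K) gauss_norm" by (rule cring_R)
  interpret cl: ring_hom_cring "cauchy_ring (bounded_quotients K) gauss_norm" L cl
    by unfold_locales (use seq_class_hom in \<open>simp add: ambient_field_def\<close>)
  have "\<zero>\<^bsub>L\<^esub> = cl (\<lambda>_. 0)" using cl.hom_zero by (simp add: R_simps)
  then show ?thesis
    using seq_class_eq_iff[OF assms C_const[OF zero_S]] C_S[OF assms] assms by (simp add: null_seqs_def null_def)
qed

text \<open>\<open>indep\<close> ranges over integer exponents because it is applied to the quotient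
  of two monomials of a relation.\<close>

theorem alg_independent_criterion:
  assumes h: "h \<in> unit_series K" "frob3 h = v * h" "v \<in> analytic"
    and A: "A \<in> unit_series K" "frob3 A = w * A" "w \<in> analytic"
    and indep: "\<And>a b. h powi a * A powi b \<in> analytic \<Longrightarrow> a = 0 \<and> b = 0"
  shows "alg_independent2 L (analytic_elements K) (embed_ambient K h) (embed_ambient K A)"
  unfolding alg_independent2_def
proof (intro allI impI ballI)
  fix I :: "(nat \<times> nat) set" and c ij
  assume a: "finite I \<and> c \<in> I \<rightarrow> analytic_elements K \<and>
    finsum L (\<lambda>(i, j). c (i, j) \<otimes>\<^bsub>L\<^esub> (embed_ambient K h [^]\<^bsub>L\<^esub> i) \<otimes>\<^bsub>L\<^esub> (embed_ambient K A [^]\<^bsub>L\<^esub> j)) I = \<zero>\<^bsub>L\<^esub>"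
    and ij: "ij \<in> I"
  then have "\<forall>ij\<in>I. \<exists>r. r \<in> cauchy_seqs (rational_functions K) gauss_norm \<and> c ij = cl r"
    by (auto simp: analytic_elements_def Pi_iff)
  then obtain r where r: "\<And>ij. ij \<in> I \<Longrightarrow> r ij \<in> cauchy_seqs (rational_functions K) gauss_norm" "\<And>ij. ij \<in> I \<Longrightarrow> c ij = cl (r ij)"
    by metis
  have "null (\<lambda>n. \<Sum>ij\<in>I. r ij n * (h ^ fst ij * A ^ snd ij))"
    using a relation_class[of I c r h A] r(2) rational_cauchy(1)[OF r(1)] unit_series_S h A by blast
  then have "null (r ij)"
    using a by (intro relation_trivial[OF h A indep _ rational_cauchy(2)[OF r(1)] _ ij]) auto
  then show "c ij = \<zero>\<^bsub>L\<^esub>" using r[OF ij] class_eq_0_iff[OF rational_cauchy(1)] by simp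
qed

text \<open>The linear relation u * X - Y = 0 at X = h, Y = u * h; its coefficient -1 makes it
  nontrivial.\<close>

theorem not_alg_independent_criterion:
  assumes "u \<in> analytic" "h \<in> bounded_quotients K"
  shows "\<not> alg_independent2 L (analytic_elements K) (embed_ambient K h) (embed_ambient K (u * h))"
proof
  assume ind: "alg_independent2 L (analytic_elements K) (embed_ambient K h) (embed_ambient K (u * h))"
  define I where "I = {(1 :: nat, 0 :: nat), (0, 1)}"
  define r where "r ij = (if ij = (1 :: nat, 0 :: nat) then u else - 1)" for ij
  have rA: "r ij \<in> analytic" for ij using assms(1) an.minus_S[OF an.one_S] by (simp add: r_def)
  have "null (\<lambda>n. \<Sum>ij\<in>I. r ij * (h ^ fst ij * (u * h) ^ snd ij))"
    using null_0 by (simp add: I_def r_def)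
  then have "finsum L (\<lambda>(i, j). embed_ambient K (r (i, j)) \<otimes>\<^bsub>L\<^esub> (embed_ambient K h [^]\<^bsub>L\<^esub> i) \<otimes>\<^bsub>L\<^esub> (embed_ambient K (u * h) [^]\<^bsub>L\<^esub> j)) I = \<zero>\<^bsub>L\<^esub>"
    using relation_class[of I "\<lambda>ij. embed_ambient K (r ij)" "\<lambda>ij _. r ij" h "u * h"] assms
    by (auto simp: I_def embed_ambient_def C_const analytic_S[OF rA] mult_S analytic_S)
  moreover have "finite I" "(\<lambda>ij. embed_ambient K (r ij)) \<in> I \<rightarrow> analytic_elements K"
    using embed_analytic[OF rA] by (auto simp: I_def)
  ultimately have "\<forall>ij\<in>I. embed_ambient K (r ij) = \<zero>\<^bsub>L\<^esub>"
    by (intro ind[unfolded alg_independent2_def, THEN spec[of _ I],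
          THEN spec[of _ "\<lambda>ij. embed_ambient K (r ij)"], THEN mp] conjI)
  then have "embed_ambient K (r (0, 1)) = \<zero>\<^bsub>L\<^esub>" by (simp add: I_def)
  then have "null (\<lambda>_. - 1)"
    using class_eq_0_iff[OF C_const[OF minus_S[OF one_S]]] by (simp add: embed_ambient_def r_def)
  from null_diff[OF null_0 this] show False using not_null_1 by simp
qed

end

section \<open>Frobenius quotients and logarithmic derivatives\<close>

definition of_int_fps :: "int fps \<Rightarrow> 'c::ultrametric_field fps" where
  "of_int_fps F = Abs_fps (\<lambda>n. of_int (fps_nth F n))"

definition of_int_fls :: "int fps \<Rightarrow> 'c::ultrametric_field fls" where
  "of_int_fls F = fps_to_fls (of_int_fps F)"

lemma of_int_fls_simps:
  "of_int_fls (F + G) = of_int_fls F + (of_int_fls G :: 'c::ultrametric_field fls)"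
  "of_int_fls (F - G) = of_int_fls F - (of_int_fls G :: 'c fls)"
  "of_int_fls (F * G) = of_int_fls F * (of_int_fls G :: 'c fls)" "of_int_fls 0 = (0 :: 'c fls)" "of_int_fls 1 = (1 :: 'c fls)"
  "of_int_fls fps_X = (fls_X :: 'c fls)" "frob3 (of_int_fls F) = (of_int_fls (subst_pow 3 F) :: 'c fls)"
  "of_int_fls (of_int c) = (fls_const (of_int c) :: 'c fls)" "of_int_fls (numeral n) = (fls_const (numeral n) :: 'c fls)"
proof -
  have "of_int_fps (F + G) = of_int_fps F + (of_int_fps G :: 'c fps)" "of_int_fps (F - G) = of_int_fps F - (of_int_fps G :: 'c fps)"
    "of_int_fps (F * G) = of_int_fps F * (of_int_fps G :: 'c fps)" "of_int_fps 0 = (0 :: 'c fps)" "of_int_fps 1 = (1 :: 'c fps)"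
    "of_int_fps fps_X = (fps_X :: 'c fps)"
    by (auto simp: of_int_fps_def fps_eq_iff fps_mult_nth)
  then show "of_int_fls (F + G) = of_int_fls F + (of_int_fls G :: 'c fls)" "of_int_fls (F - G) = of_int_fls F - (of_int_fls G :: 'c fls)"
    "of_int_fls (F * G) = of_int_fls F * (of_int_fls G :: 'c fls)" "of_int_fls 0 = (0 :: 'c fls)" "of_int_fls 1 = (1 :: 'c fls)"
    "of_int_fls fps_X = (fls_X :: 'c fls)"
    by (simp_all add: of_int_fls_def fls_times_fps_to_fls fps_to_fls_minus fps_to_fls_plus)
  have "of_int_fps (subst_pow 3 F) = (subst_pow 3 (of_int_fps F) :: 'c fps)"
    by (auto simp: of_int_fps_def fps_eq_iff fps_nth_compose_X_power)
  then show "frob3 (of_int_fls F) = (of_int_fls (subst_pow 3 F) :: 'c fls)"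
    by (simp add: of_int_fls_def fls_compose_power_fps_to_fls)
  show *: "of_int_fls (of_int c) = (fls_const (of_int c) :: 'c fls)" for c
  proof -
    have "of_int_fps (of_int c) = (fps_const (of_int c) :: 'c fps)"
      by (auto simp: of_int_fps_def fps_eq_iff simp flip: fps_of_int)
    then show ?thesis by (simp add: of_int_fls_def fps_const_to_fls)
  qed
  show "of_int_fls (numeral n) = (fls_const (numeral n) :: 'c fls)" using *[of "numeral n"] by simp
qed

text \<open>The chain rule for z^3. Its factor 3 is the source of the contraction in
  \<open>log_deriv_analytic\<close>.\<close>

lemma deriv_frob3: "fls_deriv (frob3 x) = 3 * fls_X ^ 2 * frob3 (fls_deriv (x :: 'c::ultrametric_field fls))"
proof (rule fls_eqI)
  fix n :: int
  have "3 * fls_X ^ 2 * frob3 (fls_deriv x) = fls_const 3 * (fls_X ^ 2 * frob3 (fls_deriv x))"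
    by (simp add: mult.assoc)
  also have "fls_nth \<dots> n = 3 * fls_nth (frob3 (fls_deriv x)) (n - 2)"
    by (simp only: fls_X_power_times_conv_shift(1) fls_mult_const_nth fls_shift_nth) simp
  finally have r: "fls_nth (3 * fls_X ^ 2 * frob3 (fls_deriv x)) n = 3 * fls_nth (frob3 (fls_deriv x)) (n - 2)" .
  show "fls_nth (fls_deriv (frob3 x)) n = fls_nth (3 * fls_X ^ 2 * frob3 (fls_deriv x)) n"
  proof (cases "3 dvd n + 1")
    case True
    then obtain k where k: "n + 1 = 3 * k" by (elim dvdE)
    then have m: "n - 2 = 3 * (k - 1)" by simp
    have "fls_nth (frob3 (fls_deriv x)) (3 * (k - 1)) = of_int k * fls_nth x k" "fls_nth (frob3 x) (3 * k) = fls_nth x k"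
      by (simp_all add: fls_nth_compose_power)
    then show ?thesis unfolding r fls_deriv_nth k m by simp
  next
    case False
    then have "\<not> 3 dvd n - 2" by presburger
    then show ?thesis unfolding r fls_deriv_nth using False by (simp add: fls_nth_compose_power)
  qed
qed

locale padic_field = base_field K for K :: "'c::ultrametric_field set" +
  assumes absval_of_int: "absval (of_int n :: 'c) = (if n = 0 then 0 else (1 / 3) ^ multiplicity 3 n)"
begin

lemma absval_of_int_le_iff: "absval (of_int n :: 'c) \<le> (1 / 3) ^ M \<longleftrightarrow> 3 ^ M dvd n"
proof (cases "n = 0")
  case False
  then show ?thesis
    by (simp add: absval_of_int power_decreasing_iff power_dvd_iff_le_multiplicity)
qed simp

lemma absval_of_int_less_1_iff: "absval (of_int n :: 'c) < 1 \<longleftrightarrow> 3 dvd n"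
proof (cases "n = 0")
  case False
  have "(1 / 3 :: real) ^ multiplicity 3 n < 1 \<longleftrightarrow> multiplicity 3 n \<noteq> 0" by (simp add: power_less_one_iff)
  then show ?thesis using False by (simp add: absval_of_int multiplicity_eq_zero_iff)
qed simp

lemma absval_3: "absval (3 :: 'c) = 1 / 3"
  using absval_of_int[of 3] by simp

lemma of_int_series: "of_int_fps F \<in> bounded_series K"
  by (auto simp: bounded_series_def of_int_fps_def K_of_int intro!: bdd_aboveI[of _ 1] absval_of_int_le_1)

lemma of_int_fls_S: "of_int_fls F \<in> bounded_quotients K" "gauss_norm (of_int_fls F :: 'c fls) \<le> 1"
  unfolding of_int_fls_def using series_S(1)[OF of_int_series] N_series_le[OF of_int_series, of _ 1]
  by (auto simp: of_int_fps_def absval_of_int_le_1)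

lemma of_int_fls_unit: "fps_nth F 0 = 1 \<Longrightarrow> of_int_fls F \<in> unit_series K"
proof -
  assume "fps_nth F 0 = 1"
  then have "fps_nth (of_int_fps F :: 'c fps) 0 = 1" "\<And>n. absval (fps_nth (of_int_fps F :: 'c fps) n) \<le> 1"
    by (simp_all add: of_int_fps_def absval_of_int_le_1)
  then show ?thesis unfolding unit_series_def of_int_fls_def using of_int_series[of F] by blast
qed

lemma of_int_fls_small: "of_int (3 ^ M) dvd F \<Longrightarrow> gauss_norm (of_int_fls F :: 'c fls) \<le> (1 / 3) ^ M"
  unfolding of_int_fls_def of_int_dvd_fps_iff
  by (rule N_series_le[OF of_int_series]) (simp add: of_int_fps_def absval_of_int_le_iff)

lemma of_int_fls_trunc: "of_int_fls (trunc q b) \<in> rational_functions K"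
proof -
  define P :: "'c poly" where "P = (\<Sum>n<q. Polynomial.monom (of_int (b n)) n)"
  have c: "poly.coeff P i = (if i < q then of_int (b i) else 0)" for i
    by (auto simp: P_def coeff_sum)
  have "of_int_fls (trunc q b) = poly_to_fls P"
    by (simp add: of_int_fls_def poly_to_fls_def of_int_fps_def trunc_def fps_eq_iff c)
  then show ?thesis using rational_poly[of P] c K_of_int K_closed(1) by simp
qed

text \<open>\<open>ghost_decomposable\<close> concerns integer sequences, whereas the coefficients
  of \<open>h_series\<close> have denominators 64 ^ n; hence one integer sequence for each precision
  M.\<close>

definition dwork_series :: "'c fps \<Rightarrow> bool" where
  "dwork_series F \<longleftrightarrow> (\<forall>M. \<exists>b. ghost_decomposable 3 b \<and> (\<forall>n. absval (fps_nth F n - of_int (b n)) \<le> (1 / 3) ^ M))"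

lemma N_approx:
  assumes "F \<in> bounded_series K" "\<And>n. absval (fps_nth F n - of_int (b n)) \<le> d"
  shows "gauss_norm (fps_to_fls F - of_int_fls (Abs_fps b)) \<le> d"
proof -
  have "fps_to_fls F - of_int_fls (Abs_fps b) = fps_to_fls (F - of_int_fps (Abs_fps b))"
    by (simp add: of_int_fls_def fps_to_fls_minus)
  moreover have "F - of_int_fps (Abs_fps b) \<in> bounded_series K" using bs_diff[OF K assms(1) of_int_series] by blast
  then have "gauss_norm (fps_to_fls (F - of_int_fps (Abs_fps b))) \<le> d"
    by (rule N_series_le) (use assms(2) in \<open>simp add: of_int_fps_def\<close>)
  ultimately show ?thesis by simp
qed

text \<open>To precision 3 ^ (- M) the Dwork congruence identifies the quotient with F(T1) / T2 for
  two truncations, a rational function; T2 has norm 1, so dividing by it costs nothing.\<close>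

lemma frob_ratio_analytic:
  assumes F: "F \<in> bounded_series K" "fps_to_fls F \<in> unit_series K" and dw: "dwork_series F"
  shows "frob3 (fps_to_fls F) / fps_to_fls F \<in> analytic"
proof (rule analyticI_le[where B = 1])
  define h where "h = fps_to_fls F"
  note hS = unit_series_S[OF F(2), folded h_def]
  show "frob3 (fps_to_fls F) / fps_to_fls F \<in> bounded_quotients K"
    using hS by (auto simp flip: h_def intro!: divide_S frob3_S)
  fix M
  obtain b where b: "ghost_decomposable 3 b" "\<And>n. absval (fps_nth F n - of_int (b n)) \<le> (1 / 3) ^ M"
    using dw unfolding dwork_series_def by blast
  have b0: "b 0 = 1" using b(1) by (simp add: ghost_decomposable_def)
  define g where "g = (of_int_fls (Abs_fps b) :: 'c fls)"
  define T1 where "T1 = (of_int_fls (trunc (3 ^ M) b) :: 'c fls)"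
  define T2 where "T2 = (of_int_fls (trunc (3 ^ Suc M) b) :: 'c fls)"
  have T2: "T2 \<in> unit_series K" unfolding T2_def by (rule of_int_fls_unit) (simp add: trunc_def b0)
  note T2S = unit_series_S[OF T2]
  have gS: "g \<in> bounded_quotients K" "T1 \<in> bounded_quotients K" "gauss_norm T1 \<le> 1"
    unfolding g_def T1_def by (rule of_int_fls_S)+
  have hg: "gauss_norm (h - g) \<le> (1 / 3) ^ M" unfolding h_def g_def by (rule N_approx[OF F(1) b(2)])
  have "of_int (int 3 ^ Suc M) dvd Abs_fps b * subst_pow 3 (trunc (3 ^ M) b) - subst_pow 3 (Abs_fps b) * trunc (3 ^ Suc M) b"
    by (rule dwork_congruence[OF b(1)]) simp
  then have "gauss_norm (g * frob3 T1 - frob3 g * T2) \<le> (1 / 3) ^ Suc M"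
    using of_int_fls_small[of "Suc M" "Abs_fps b * subst_pow 3 (trunc (3 ^ M) b) - subst_pow 3 (Abs_fps b) * trunc (3 ^ Suc M) b"]
    by (simp add: of_int_fls_simps g_def T1_def T2_def)
  also have "\<dots> \<le> (1 / 3) ^ M" by simp
  finally have dwk: "gauss_norm (g * frob3 T1 - frob3 g * T2) \<le> (1 / 3) ^ M" .
  \<comment> \<open>Return from the integer approximation g to h: both sides of the Dwork difference
    change by multiples of h - g or of its Frobenius image.\<close>
  have "gauss_norm ((frob3 (h - g) * T2 - frob3 T1 * (h - g)) - (g * frob3 T1 - frob3 g * T2)) \<le> (1 / 3) ^ M"
  proof (rule N_diff_le[OF _ _ N_diff_le dwk])
    show "gauss_norm (frob3 (h - g) * T2) \<le> (1 / 3) ^ M"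
      using hg T2S frob3_S[OF diff_S[OF hS(1) gS(1)]] by (simp add: N_mult del: fls_compose_power_diff)
    have "gauss_norm (frob3 T1 * (h - g)) = gauss_norm T1 * gauss_norm (h - g)"
      by (simp add: N_mult frob3_S gS diff_S hS)
    also have "\<dots> \<le> 1 * (1 / 3) ^ M" using hg gS by (intro mult_mono) (auto intro!: N_ge_0 diff_S hS)
    finally show "gauss_norm (frob3 T1 * (h - g)) \<le> (1 / 3) ^ M" by simp
  qed (intro mult_S diff_S frob3_S hS gS T2S)+
  then have key: "gauss_norm (frob3 h * T2 - frob3 T1 * h) \<le> (1 / 3) ^ M" by (simp add: algebra_simps)
  have "frob3 h / h - frob3 T1 / T2 = (frob3 h * T2 - frob3 T1 * h) * inverse (h * T2)"
    using hS T2S by (simp add: field_simps)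
  then have "gauss_norm (frob3 h / h - frob3 T1 / T2) \<le> (1 / 3) ^ M"
    using key hS T2S by (simp add: N_mult N_inverse diff_S mult_S inverse_S frob3_S gS)
  moreover have "frob3 T1 / T2 \<in> analytic"
    by (intro rational_analytic rat.divide_S frob3_rational) (simp_all add: T1_def T2_def of_int_fls_trunc)
  ultimately show "\<exists>e\<in>analytic. gauss_norm (frob3 (fps_to_fls F) / fps_to_fls F - e) \<le> 1 * (1 / 3) ^ M"
    by (intro bexI[of _ "frob3 T1 / T2"]) (simp_all add: h_def)
qed

lemma N_3: "(3 :: 'c fls) \<in> rational_functions K" "gauss_norm (3 :: 'c fls) = 1 / 3"
  using rational_numeral[of "num.Bit1 num.One"] N_const(2)[OF K_of_nat[of 3]] absval_3
  by (simp_all flip: fls_const_numeral)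

text \<open>With \<open>\<eta> = h'/h\<close>, the logarithmic derivative of \<open>frob3 h = v * h\<close> says
  \<open>\<eta> = 3 * z^2 * frob3 \<eta> - v'/v\<close>, a contraction with factor \<open>1/3\<close>.\<close>

lemma log_deriv_analytic:
  assumes h: "h \<in> unit_series K" "frob3 h = v * h" "v \<in> analytic"
  shows "fls_deriv h / h \<in> analytic"
proof (rule analyticI_le)
  define \<eta> where "\<eta> = fls_deriv h / h"
  note hS = unit_series_S[OF h(1)]
  have v0: "v \<noteq> 0" using h(2) hS(3) frob3_inj[of h] by auto
  have fh0: "frob3 h \<noteq> 0" using hS(3) frob3_inj[of h] by auto
  have \<eta>S: "\<eta> \<in> bounded_quotients K" unfolding \<eta>_def by (intro divide_S deriv_S hS)
  then show "fls_deriv h / h \<in> bounded_quotients K" by (simp add: \<eta>_def)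
  define g where "g = 3 * fls_X ^ 2 * frob3 \<eta>"
  have "3 * fls_X ^ 2 * frob3 (fls_deriv h) = v * fls_deriv h + fls_deriv v * h"
    using arg_cong[OF h(2), of fls_deriv] by (simp add: deriv_frob3)
  moreover have "frob3 (fls_deriv h) = frob3 \<eta> * (v * h)"
    using fh0 by (simp add: \<eta>_def frob3_divide h(2)[symmetric])
  ultimately have "g * (v * h) = v * (\<eta> * h) + fls_deriv v * h"
    using hS(3) by (simp add: g_def \<eta>_def mult_ac)
  then have "(g * v) * h = (v * \<eta> + fls_deriv v) * h" by (simp add: algebra_simps)
  then have "g * v = v * \<eta> + fls_deriv v" using hS(3) by simp
  then have "\<eta> = g - fls_deriv v / v" using v0 by (simp add: field_simps)
  then have fix_eq: "\<eta> = 3 * fls_X ^ 2 * frob3 \<eta> - fls_deriv v / v" by (simp add: g_def)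
  \<comment> \<open>Iterates of the contraction from 0; they are built from v alone, hence analytic,
    and converge to \<open>\<eta>\<close>.\<close>
  define e where "e = rec_nat 0 (\<lambda>_ x. 3 * fls_X ^ 2 * frob3 x - fls_deriv v / v)"
  have e: "e 0 = 0" "e (Suc M) = 3 * fls_X ^ 2 * frob3 (e M) - fls_deriv v / v" for M
    by (simp_all add: e_def)
  have eA: "e M \<in> analytic" for M
    by (induction M) (auto simp: e intro!: an.zero_S an.diff_S an.mult_S an.power_S an.divide_S
        frob3_analytic deriv_analytic h rational_analytic[OF rational_X] rational_analytic[OF N_3(1)])
  have "gauss_norm (\<eta> - e M) \<le> gauss_norm \<eta> * (1 / 3) ^ M" for M
  proof (induction M)
    case (Suc M)
    note S = rat_S[OF N_3(1)] power_S[OF N_X(1)] diff_S[OF \<eta>S analytic_S[OF eA]]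
    have "\<eta> - e (Suc M) = 3 * fls_X ^ 2 * frob3 (\<eta> - e M)"
      by (subst fix_eq) (simp add: e algebra_simps)
    then have "gauss_norm (\<eta> - e (Suc M)) = 1 / 3 * gauss_norm (\<eta> - e M)"
      using S by (simp add: N_mult N_power N_3 N_X mult_S frob3_S del: fls_compose_power_diff)
    then show ?case using Suc by simp
  qed (simp add: e)
  then show "\<exists>x\<in>analytic. gauss_norm (fls_deriv h / h - x) \<le> gauss_norm \<eta> * (1 / 3) ^ M" for M
    using eA unfolding \<eta>_def by blast
qed

end

section \<open>The recurrence of \<open>h_series\<close> and the expression of
  \<open>f_series\<close> by its derivatives\<close>

lemma central_binomial_Suc: "Suc n * ((2 * Suc n) choose Suc n) = 2 * (2 * n + 1) * ((2 * n) choose n)"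
proof -
  have e: "2 * Suc n = Suc (Suc (2 * n))" by simp
  have "Suc n * (Suc n * ((2 * Suc n) choose Suc n)) = Suc n * (Suc (Suc (2 * n)) * (Suc (2 * n) choose n))"
    unfolding e Suc_times_binomial ..
  also have "Suc (2 * n) choose n = Suc (2 * n) choose Suc n"
    using binomial_symmetric[of n "Suc (2 * n)"] by simp
  also have "Suc n * (Suc (Suc (2 * n)) * (Suc (2 * n) choose Suc n)) = Suc (Suc (2 * n)) * (Suc (2 * n) * ((2 * n) choose n))"
    by (metis Suc_times_binomial mult.left_commute)
  also have "\<dots> = Suc n * (2 * (2 * n + 1) * ((2 * n) choose n))" by (simp add: algebra_simps)
  finally show ?thesis by (simp only: mult_cancel1) simp
qed

lemma h_series_Suc:
  "(of_nat (Suc n)) ^ 3 * fps_nth (h_series :: 'c::field_char_0 fps) (Suc n) = (of_nat (2 * n + 1)) ^ 3 / 8 * fps_nth h_series n"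
proof -
  have gen: "1 / 64 ^ Suc n * (2 * d * e) ^ 3 = d ^ 3 / 8 * (1 / 64 ^ n * e ^ 3)" for d e :: 'c
    by (simp add: power_mult_distrib)
  have "of_nat (Suc n) * of_nat ((2 * Suc n) choose Suc n) = (2 * of_nat (2 * n + 1) * of_nat ((2 * n) choose n) :: 'c)"
    using arg_cong[OF central_binomial_Suc[of n], of "of_nat :: nat \<Rightarrow> 'c"] by (simp only: of_nat_mult of_nat_numeral)
  then have "(of_nat (Suc n)) ^ 3 * of_nat ((2 * Suc n) choose Suc n) ^ 3 = (2 * of_nat (2 * n + 1) * of_nat ((2 * n) choose n) :: 'c) ^ 3"
    by (metis power_mult_distrib)
  then have "(of_nat (Suc n)) ^ 3 * (1 / 64 ^ Suc n * of_nat ((2 * Suc n) choose Suc n) ^ 3) = 1 / 64 ^ Suc n * (2 * of_nat (2 * n + 1) * of_nat ((2 * n) choose n) :: 'c) ^ 3"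
    by (metis mult.left_commute)
  also have "\<dots> = (of_nat (2 * n + 1)) ^ 3 / 8 * (1 / 64 ^ n * of_nat ((2 * n) choose n) ^ 3)"
    by (rule gen)
  finally show ?thesis by (simp add: h_series_def)
qed

text \<open>With a_n the coefficients of h, the recurrence 8 n^3 a_n = (2n - 1)^3 a_(n-1) and the
  factorization 8 n^3 - 1 = (2n - 1) (4 n^2 + 2n + 1) give - a_n / (2n - 1) = (4 n^2 + 2n + 1) a_n -
  (2n - 1)^2 a_(n-1). The right side is polynomial in n, hence a differential operator of order 2
  applied to h.\<close>

lemma f_series_eq:
  "(f_series :: 'c::field_char_0 fps) = (1 - fps_X) * h_series + (6 * fps_X - 8 * fps_X ^ 2) * fps_deriv h_series
     + 4 * fps_X ^ 2 * (1 - fps_X) * fps_deriv (fps_deriv h_series)"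
proof (rule fps_ext)
  fix n
  define a where "a = fps_nth (h_series :: 'c fps)"
  have f: "fps_nth (f_series :: 'c fps) n = - a n / (2 * of_nat n - 1)"
    by (simp add: f_series_def h_series_def a_def)
  define R where "R = (1 - fps_X) * h_series + (6 * fps_X - 8 * fps_X ^ 2) * fps_deriv h_series
     + 4 * fps_X ^ 2 * (1 - fps_X) * fps_deriv (fps_deriv (h_series :: 'c fps))"
  have R: "R = h_series - fps_X * h_series + (fps_const 6 * (fps_X * fps_deriv h_series) - fps_const 8 * (fps_X * (fps_X * fps_deriv h_series)))
     + (fps_const 4 * (fps_X * (fps_X * fps_deriv (fps_deriv h_series))) - fps_const 4 * (fps_X * (fps_X * (fps_X * fps_deriv (fps_deriv h_series)))))"
    by (simp add: R_def algebra_simps power2_eq_square numeral_fps_const)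
  consider "n = 0" | m where "n = Suc m" by (cases n) auto
  then have "fps_nth R n = - a n / (2 * of_nat n - 1)"
  proof cases
    case 1
    then show ?thesis by (simp add: R a_def)
  next
    case (2 m)
    have rec: "(of_nat (Suc m)) ^ 3 * a (Suc m) = (of_nat (2 * m + 1)) ^ 3 / 8 * a m"
      unfolding a_def by (rule h_series_Suc)
    have nz: "(of_nat (2 * m + 1) :: 'c) \<noteq> 0" using of_nat_eq_0_iff[of "2 * m + 1", where 'a = 'c] by simp
    define M :: 'c where "M = of_nat m"
    have nz': "2 * M + 1 \<noteq> 0" using nz by (simp add: M_def add.commute)
    have rec': "8 * (M + 1) ^ 3 * a (Suc m) = (2 * M + 1) ^ 3 * a m" using rec by (simp add: M_def field_simps)
    \<comment> \<open>Cases, because the shifts by \<open>fps_X\<close> reach the boundary for m = 0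
      and m = 1.\<close>
    have Rn: "fps_nth R (Suc m) = a (Suc m) - a m + (6 * ((M + 1) * a (Suc m)) - 8 * (M * a m)) + (4 * (M * (M + 1) * a (Suc m)) - 4 * (M * (M - 1) * a m))"
    proof (cases m)
      case 0
      then show ?thesis by (simp add: R a_def M_def)
    next
      case (Suc k)
      show ?thesis
      proof (cases k)
        case 0
        then show ?thesis using Suc by (simp add: R a_def M_def numeral_2_eq_2) (simp add: algebra_simps)?
      next
        case (Suc l)
        then show ?thesis using \<open>m = Suc k\<close> by (simp add: R a_def M_def) (simp add: algebra_simps)?
      qed
    qed
    have "(2 * M + 1) * fps_nth R (Suc m) = (2 * M + 1) * (4 * (M + 1)\<^sup>2 + 2 * (M + 1) + 1) * a (Suc m) - (2 * M + 1) ^ 3 * a m"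
      unfolding Rn by (simp add: power2_eq_square power3_eq_cube algebra_simps)
    also have "\<dots> = - a (Suc m)"
      unfolding rec'[symmetric] by (simp add: power2_eq_square power3_eq_cube algebra_simps)
    finally show ?thesis using nz' 2 by (simp add: M_def field_simps)
  qed
  then show "fps_nth (f_series :: 'c fps) n = fps_nth ((1 - fps_X) * h_series + (6 * fps_X - 8 * fps_X ^ 2) * fps_deriv h_series
     + 4 * fps_X ^ 2 * (1 - fps_X) * fps_deriv (fps_deriv h_series)) n"
    using f by (simp add: R_def)
qed

context padic_field
begin

text \<open>As h'' = (\<open>\<eta>\<close>' + \<open>\<eta>\<close>^2) h, dividing
  \<open>f_series_eq\<close> by h leaves a polynomial in z, \<open>\<eta>\<close> and
  \<open>\<eta>\<close>'.\<close>

lemma f_over_h_analytic: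
  assumes "fps_to_fls h_series \<in> unit_series K" "fls_deriv (fps_to_fls h_series) / fps_to_fls h_series \<in> analytic"
  shows "fps_to_fls f_series / fps_to_fls h_series \<in> analytic"
proof -
  define h where "h = (fps_to_fls h_series :: 'c fls)"
  define \<eta> where "\<eta> = fls_deriv h / h"
  have h0: "h \<noteq> 0" using unit_series_S(3)[OF assms(1)] by (simp add: h_def)
  have \<eta>: "\<eta> \<in> analytic" using assms(2) by (simp add: \<eta>_def h_def)
  have d1: "fls_deriv h = \<eta> * h" using h0 by (simp add: \<eta>_def)
  have "fls_deriv (fls_deriv h) = \<eta> * (\<eta> * h) + fls_deriv \<eta> * h"
    by (subst d1, subst fls_deriv_mult) (simp add: d1)
  then have d2: "fls_deriv (fls_deriv h) = (fls_deriv \<eta> + \<eta> ^ 2) * h" by (simp add: algebra_simps power2_eq_square)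
  have "fps_to_fls f_series = (1 - fls_X) * h + (6 * fls_X - 8 * fls_X ^ 2) * fls_deriv h
     + 4 * fls_X ^ 2 * (1 - fls_X) * fls_deriv (fls_deriv h)"
    unfolding f_series_eq h_def
    by (simp add: fls_times_fps_to_fls fps_to_fls_plus fps_to_fls_minus fls_deriv_fps_to_fls fps_to_fls_power)
  then have "fps_to_fls f_series / h = (1 - fls_X) + (6 * fls_X - 8 * fls_X ^ 2) * \<eta>
     + 4 * fls_X ^ 2 * (1 - fls_X) * (fls_deriv \<eta> + \<eta> ^ 2)"
    using h0 unfolding d2 unfolding d1 by (simp add: field_simps)
  also have "\<dots> \<in> analytic"
    using rational_analytic[OF rational_numeral] rational_analytic[OF rational_X]
    by (intro an.add_S an.diff_S an.mult_S an.power_S \<eta> deriv_analytic an.one_S) auto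
  finally show ?thesis by (simp add: h_def)
qed

end

section \<open>Congruences modulo 9\<close>

definition free3 :: "nat \<Rightarrow> int" where
  "free3 n = int (n div 3 ^ multiplicity 3 n)"

lemma free3_0 [simp]: "free3 0 = 0"
  by (simp add: free3_def)

lemma free3_not_dvd: "\<not> 3 dvd n \<Longrightarrow> free3 n = int n"
  by (simp add: free3_def not_dvd_imp_multiplicity_0)

lemma free3_mult3: "free3 (3 * n) = free3 n"
proof (cases "n = 0")
  case False
  then have "multiplicity 3 (3 * n) = Suc (multiplicity 3 n)"
    by (intro multiplicity_times_same) auto
  then show ?thesis by (simp add: free3_def)
qed simp

lemma free3_power3_mult: "\<not> 3 dvd m \<Longrightarrow> free3 (3 ^ k * m) = int m"
  by (induction k) (auto simp: free3_not_dvd free3_mult3 mult.assoc)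

text \<open>Modulo 3, \<open>log_h\<close> is \<open>(h^2 * (1 - z) - 1) / 3\<close> and \<open>log_A\<close> is \<open>(A * (1 + z) - 1) / 3\<close>.
  They solve the Artin-Schreier equations \<open>y - y(z^3) = - z / (1 - z)^2\<close> and
  \<open>y - y(z^3) = - z / (1 + z)^2\<close>.\<close>

definition log_h :: "int fps" where
  "log_h = Abs_fps (\<lambda>n. - free3 n)"

definition log_A :: "int fps" where
  "log_A = Abs_fps (\<lambda>n. (- 1) ^ n * free3 n)"

text \<open>In degree n > 0 the substitution involves only coefficients of index at most n div 3 <
  n, and U starts with 1, so the equation determines a series modulo m from its constant term. A
  series is thus identified modulo 9 by its functional equation.\<close>

lemma frob_solution_unique:
  fixes F G U V :: "int fps"
  assumes "of_int m dvd F * U - subst_pow 3 F * V" "of_int m dvd G * U - subst_pow 3 G * V"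
    and U: "fps_nth U 0 = 1" and FG: "fps_nth F 0 = fps_nth G 0"
  shows "of_int m dvd F - G"
proof -
  define E where "E = F - G"
  have "of_int m dvd (F * U - subst_pow 3 F * V) - (G * U - subst_pow 3 G * V)" by (intro dvd_diff assms)
  also have "\<dots> = E * U - subst_pow 3 E * V" unfolding E_def subst_pow_diff by (simp add: algebra_simps)
  finally have d: "m dvd fps_nth (E * U) n - fps_nth (subst_pow 3 E * V) n" for n
    by (simp add: of_int_dvd_fps_iff)
  have "m dvd fps_nth E n" for n
  proof (induction n rule: less_induct)
    case (less n)
    show ?case
    proof (cases "n = 0")
      case False
      have a: "fps_nth (E * U) n = fps_nth E n + (\<Sum>i<n. fps_nth E i * fps_nth U (n - i))"
      proof -
        have "{0..n} = insert n {..<n}" by auto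
        then show ?thesis using U by (simp add: fps_mult_nth)
      qed
      have b: "m dvd (\<Sum>i<n. fps_nth E i * fps_nth U (n - i))" using less by (intro dvd_sum dvd_mult2) auto
      have c: "m dvd fps_nth (subst_pow 3 E * V) n"
        unfolding fps_mult_nth fps_nth_compose_X_power
      proof (intro dvd_sum dvd_mult2)
        fix i assume "i \<in> {0..n}"
        then have "i div 3 < n" using False by auto
        then show "m dvd (if 3 dvd i then fps_nth E (i div 3) else 0)" using less by auto
      qed
      have "fps_nth E n = (fps_nth (E * U) n - fps_nth (subst_pow 3 E * V) n) + fps_nth (subst_pow 3 E * V) n
          - (\<Sum>i<n. fps_nth E i * fps_nth U (n - i))" by (simp add: a)
      then show ?thesis by (simp only:) (intro dvd_diff dvd_add d b c)
    qed (simp add: E_def FG)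
  qed
  then show ?thesis by (simp add: of_int_dvd_fps_iff E_def)
qed

lemma subst_pow_poly:
  "subst_pow 3 (1 + fps_X :: int fps) = 1 + fps_X ^ 3" "subst_pow 3 (1 - fps_X :: int fps) = 1 - fps_X ^ 3"
  by (simp_all add: fps_compose_add_distrib fps_compose_sub_distrib)

lemma less_9_cases: "n < 9 \<Longrightarrow> n = 0 \<or> n = 1 \<or> n = 2 \<or> n = 3 \<or> n = 4 \<or> n = 5 \<or> n = 6 \<or> n = 7 \<or> n = (8::nat)"
  by auto

text \<open>The Dwork congruence for M = 1 compares B with the truncations at 3 and 9. If these are
  T and T * F(T), the factor F(T) cancels: a Lucas congruence modulo 9, to be checked on nine
  coefficients.\<close>

lemma lucas_mod_9:
  fixes b :: "nat \<Rightarrow> int" and T :: "int fps"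
  assumes b: "ghost_decomposable 3 b" and T0: "fps_nth T 0 = 1"
    and T1: "of_int 9 dvd trunc 3 b - T" and T2: "of_int 9 dvd trunc 9 b - T * subst_pow 3 T"
  shows "of_int 9 dvd Abs_fps b - subst_pow 3 (Abs_fps b) * T"
proof -
  define B where "B = Abs_fps b"
  have "of_int 9 dvd B * subst_pow 3 (trunc 3 b) - subst_pow 3 B * trunc 9 b"
    using dwork_congruence[OF b, of 1] by (simp add: B_def)
  moreover have "of_int 9 dvd B * subst_pow 3 (trunc 3 b - T)"
    by (intro dvd_mult of_int_dvd_subst_pow T1) simp
  moreover have "of_int 9 dvd subst_pow 3 B * (trunc 9 b - T * subst_pow 3 T)"
    by (intro dvd_mult T2)
  ultimately have "of_int 9 dvd (B * subst_pow 3 (trunc 3 b) - subst_pow 3 B * trunc 9 b)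
      - B * subst_pow 3 (trunc 3 b - T) + subst_pow 3 B * (trunc 9 b - T * subst_pow 3 T)"
    by (rule dvd_add[OF dvd_diff])
  also have "\<dots> = (B - subst_pow 3 B * T) * subst_pow 3 T"
    unfolding subst_pow_diff by (simp add: algebra_simps)
  finally show ?thesis unfolding B_def by (rule dvd_fps_unit_cancel) (simp add: T0)
qed

section \<open>The two integer sequences modulo 9\<close>

definition h_int :: "nat \<Rightarrow> int" where "h_int n = int ((2 * n) choose n) ^ 3"

definition A_int :: "nat \<Rightarrow> int" where "A_int n = (\<Sum>k=0..n. int (n choose k) ^ 2 * int ((n + k) choose k) ^ 2)"

lemma h_int_values:
  "h_int 0 mod 9 = 1" "h_int 1 mod 9 = 8" "h_int 2 mod 9 = 0" "h_int 3 mod 9 = 8" "h_int 4 mod 9 = 1" "h_int 5 mod 9 = 0" "h_int 6 mod 9 = 0" "h_int 7 mod 9 = 0" "h_int 8 mod 9 = 0"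
  by (simp_all add: h_int_def binomial_code fold_atLeastAtMost_nat.simps fact_numeral)

lemma A_int_values:
  "A_int 0 mod 9 = 1" "A_int 1 mod 9 = 5" "A_int 2 mod 9 = 1" "A_int 3 mod 9 = 5" "A_int 4 mod 9 = 7" "A_int 5 mod 9 = 5" "A_int 6 mod 9 = 1" "A_int 7 mod 9 = 5" "A_int 8 mod 9 = 1"
proof -
  have s1: "{0..1::nat} = {0, 1}" by auto
  have s2: "{0..2::nat} = {0, 1, 2}" by auto
  have s3: "{0..3::nat} = {0, 1, 2, 3}" by auto
  have s4: "{0..4::nat} = {0, 1, 2, 3, 4}" by auto
  have s5: "{0..5::nat} = {0, 1, 2, 3, 4, 5}" by auto
  have s6: "{0..6::nat} = {0, 1, 2, 3, 4, 5, 6}" by auto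
  have s7: "{0..7::nat} = {0, 1, 2, 3, 4, 5, 6, 7}" by auto
  have s8: "{0..8::nat} = {0, 1, 2, 3, 4, 5, 6, 7, 8}" by auto
  show "A_int 0 mod 9 = 1" "A_int 1 mod 9 = 5" "A_int 2 mod 9 = 1" "A_int 3 mod 9 = 5" "A_int 4 mod 9 = 7" "A_int 5 mod 9 = 5" "A_int 6 mod 9 = 1" "A_int 7 mod 9 = 5" "A_int 8 mod 9 = 1"
    by (simp_all add: A_int_def s1 s2 s3 s4 s5 s6 s7 s8 binomial_code fold_atLeastAtMost_nat.simps fact_numeral
        del: binomial_Suc_Suc One_nat_def)
qed

lemma h_int_frob: "of_int 9 dvd Abs_fps h_int - subst_pow 3 (Abs_fps h_int) * (1 - fps_X)"
proof (rule lucas_mod_9)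
  show "ghost_decomposable 3 h_int"
    using ghost_decomposable_central_binomial_cube[of 1] by (simp add: h_int_def[abs_def])
  have v: "h_int n mod 9 = [1, 8, 0, 8, 1, 0, 0, 0, 0] ! n" if "n < 9" for n
    using less_9_cases[OF that] by (auto simp: h_int_values h_int_values[simplified])
  show "of_int 9 dvd trunc 3 h_int - (1 - fps_X)"
    unfolding of_int_dvd_fps_iff
  proof
    fix n
    show "9 dvd fps_nth (trunc 3 h_int - (1 - fps_X)) n"
    proof (cases "n < 3")
      case True
      then have "n = 0 \<or> n = 1 \<or> n = 2" by auto
      then show ?thesis using v[of n] by (auto simp: trunc_def) presburger+
    qed (auto simp: trunc_def)
  qed
  have e: "(1 - fps_X) * (1 - fps_X ^ 3) = (1 - fps_X - fps_X ^ 3 + fps_X ^ 4 :: int fps)"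
    by (simp add: algebra_simps power_numeral_reduce)
  show "of_int 9 dvd trunc 9 h_int - (1 - fps_X) * subst_pow 3 (1 - fps_X)"
    unfolding of_int_dvd_fps_iff subst_pow_poly e
  proof
    fix n
    show "9 dvd fps_nth (trunc 9 h_int - (1 - fps_X - fps_X ^ 3 + fps_X ^ 4)) n"
    proof (cases "n < 9")
      case True
      then show ?thesis using v[of n] less_9_cases[OF True] by (auto simp: trunc_def fps_X_power_nth) presburger+
    qed (auto simp: trunc_def fps_X_power_nth)
  qed
qed simp

lemma A_int_frob: "of_int 9 dvd Abs_fps A_int - subst_pow 3 (Abs_fps A_int) * (1 + 5 * fps_X + fps_X ^ 2)"
proof (rule lucas_mod_9)
  show "ghost_decomposable 3 A_int"
    using ghost_decomposable_apery by (simp add: A_int_def[abs_def])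
  have v: "A_int n mod 9 = [1, 5, 1, 5, 7, 5, 1, 5, 1] ! n" if "n < 9" for n
    using less_9_cases[OF that] by (auto simp: A_int_values A_int_values[simplified])
  have num: "fps_nth (5 * F) n = 5 * fps_nth F n" "fps_nth (25 * F) n = 25 * fps_nth F n" for F :: "int fps" and n
    by (simp_all add: numeral_fps_const)
  show "of_int 9 dvd trunc 3 A_int - (1 + 5 * fps_X + fps_X ^ 2)"
    unfolding of_int_dvd_fps_iff
  proof
    fix n
    show "9 dvd fps_nth (trunc 3 A_int - (1 + 5 * fps_X + fps_X ^ 2)) n"
    proof (cases "n < 3")
      case True
      then have "n = 0 \<or> n = 1 \<or> n = 2" by auto
      then show ?thesis using v[of n] by (auto simp: trunc_def num fps_X_power_nth numeral_fps_const) presburger+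
    qed (auto simp: trunc_def num fps_X_power_nth numeral_fps_const)
  qed
  have s: "subst_pow 3 (1 + 5 * fps_X + fps_X ^ 2) = (1 + 5 * fps_X ^ 3 + fps_X ^ 6 :: int fps)"
    by (simp add: fps_compose_add_distrib numeral_fps_const fps_compose_mult_distrib fps_compose_power[symmetric] flip: power_mult)
  have e: "(1 + 5 * fps_X + fps_X ^ 2) * (1 + 5 * fps_X ^ 3 + fps_X ^ 6) =
     (1 + 5 * fps_X + fps_X ^ 2 + 5 * fps_X ^ 3 + 25 * fps_X ^ 4 + 5 * fps_X ^ 5 + fps_X ^ 6 + 5 * fps_X ^ 7 + fps_X ^ 8 :: int fps)"
    by (simp add: algebra_simps power_numeral_reduce)
  show "of_int 9 dvd trunc 9 A_int - (1 + 5 * fps_X + fps_X ^ 2) * subst_pow 3 (1 + 5 * fps_X + fps_X ^ 2)"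
    unfolding of_int_dvd_fps_iff s e
  proof
    fix n
    show "9 dvd fps_nth (trunc 9 A_int - (1 + 5 * fps_X + fps_X ^ 2 + 5 * fps_X ^ 3 + 25 * fps_X ^ 4 + 5 * fps_X ^ 5
        + fps_X ^ 6 + 5 * fps_X ^ 7 + fps_X ^ 8)) n"
    proof (cases "n < 9")
      case True
      then show ?thesis using v[of n] less_9_cases[OF True] by (auto simp: trunc_def num fps_X_power_nth numeral_fps_const) presburger+
    qed (auto simp: trunc_def num fps_X_power_nth numeral_fps_const)
  qed
qed simp

text \<open>The difference has coefficient - n for n prime to 3 and 0 otherwise. Modulo 3 this has
  period 3, so multiplication by 1 - z^3 leaves - z - 2 z^2, that is - z (1 - z).\<close>

lemma log_h_frob: "of_int 3 dvd (log_h - subst_pow 3 log_h) * (1 - fps_X ^ 3) + fps_X * (1 - fps_X)"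
  unfolding of_int_dvd_fps_iff
proof
  fix n
  define g where "g = log_h - subst_pow 3 log_h"
  have g: "fps_nth g n = (if 3 dvd n then 0 else - int n)" for n
    by (auto simp: g_def log_h_def fps_nth_compose_X_power free3_mult3 free3_not_dvd elim!: dvdE)
  have "g * (1 - fps_X ^ 3) + fps_X * (1 - fps_X) = g - fps_X ^ 3 * g + fps_X - fps_X ^ 2"
    by (simp add: algebra_simps power2_eq_square)
  then have "fps_nth (g * (1 - fps_X ^ 3) + fps_X * (1 - fps_X)) n =
      fps_nth g n - (if n < 3 then 0 else fps_nth g (n - 3)) + (if n = 1 then 1 else 0) - (if n = 2 then 1 else 0)"
    by (simp add: fps_X_power_mult_nth fps_X_power_nth)
  moreover have "3 dvd fps_nth g n - (if n < 3 then 0 else fps_nth g (n - 3)) + (if n = 1 then 1 else 0) - (if n = 2 then 1 else 0)"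
  proof (cases "n < 3")
    case True
    then have "n = 0 \<or> n = 1 \<or> n = 2" by auto
    then show ?thesis by (auto simp: g)
  next
    case False
    then obtain m where "n = m + 3" by (metis add.commute le_Suc_ex not_less)
    then show ?thesis by (auto simp: g)
  qed
  ultimately show "3 dvd fps_nth ((log_h - subst_pow 3 log_h) * (1 - fps_X ^ 3) + fps_X * (1 - fps_X)) n"
    by (simp add: g_def)
qed

text \<open>As for \<open>log_h_frob\<close>, except that the sign changes under n -> n + 3, whence
  the factor 1 + z^3.\<close>

lemma log_A_frob: "of_int 3 dvd (log_A - subst_pow 3 log_A) * (1 + fps_X ^ 3) + fps_X * (1 + fps_X)"
  unfolding of_int_dvd_fps_iff
proof
  fix n
  define g where "g = log_A - subst_pow 3 log_A"
  have g: "fps_nth g n = (if 3 dvd n then 0 else (- 1) ^ n * int n)" for n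
    by (auto simp: g_def log_A_def fps_nth_compose_X_power free3_mult3 free3_not_dvd power_mult elim!: dvdE)
  have "g * (1 + fps_X ^ 3) + fps_X * (1 + fps_X) = g + fps_X ^ 3 * g + fps_X + fps_X ^ 2"
    by (simp add: algebra_simps power2_eq_square)
  then have "fps_nth (g * (1 + fps_X ^ 3) + fps_X * (1 + fps_X)) n =
      fps_nth g n + (if n < 3 then 0 else fps_nth g (n - 3)) + (if n = 1 then 1 else 0) + (if n = 2 then 1 else 0)"
    by (simp add: fps_X_power_mult_nth fps_X_power_nth)
  moreover have "3 dvd fps_nth g n + (if n < 3 then 0 else fps_nth g (n - 3)) + (if n = 1 then 1 else 0) + (if n = 2 then 1 else 0)"
  proof (cases "n < 3")
    case True
    then have "n = 0 \<or> n = 1 \<or> n = 2" by auto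
    then show ?thesis by (auto simp: g)
  next
    case False
    then obtain m where "n = m + 3" by (metis add.commute le_Suc_ex not_less)
    then show ?thesis by (auto simp: g power_add algebra_simps)
  qed
  ultimately show "3 dvd fps_nth ((log_A - subst_pow 3 log_A) * (1 + fps_X ^ 3) + fps_X * (1 + fps_X)) n"
    by (simp add: g_def)
qed

lemma of_int_3: "(of_int 3 :: int fps) = 3"
  by simp

lemma subst_pow_3_one_plus: "subst_pow 3 (1 + 3 * F) = 1 + 3 * subst_pow 3 (F :: int fps)"
  by (simp add: fps_compose_add_distrib numeral_fps_const fps_compose_mult_distrib)

text \<open>Both series satisfy G (1 - z^3) = F(G) (1 - z)^3 modulo 9: for h^2 (1 - z) this is
  \<open>h_int_frob\<close> squared, for 1 + 3 \<open>log_h\<close> it is \<open>log_h_frob\<close>,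
  since (1 - z^3) - (1 - z)^3 = 3 z (1 - z).\<close>

lemma h_int_mod_9: "of_int 9 dvd Abs_fps h_int ^ 2 * (1 - fps_X) - (1 + 3 * log_h)"
proof (rule frob_solution_unique)
  define B where "B = Abs_fps h_int"
  have "of_int 9 dvd (B - subst_pow 3 B * (1 - fps_X)) * ((B + subst_pow 3 B * (1 - fps_X)) * ((1 - fps_X) * (1 - fps_X ^ 3)))"
    using h_int_frob by (intro dvd_mult2) (simp add: B_def)
  also have "\<dots> = B ^ 2 * (1 - fps_X) * (1 - fps_X ^ 3) - subst_pow 3 (B ^ 2 * (1 - fps_X)) * (1 - fps_X) ^ 3"
    by (simp add: power2_eq_square subst_pow_mult subst_pow_poly) (simp add: power3_eq_cube algebra_simps)
  finally show "of_int 9 dvd Abs_fps h_int ^ 2 * (1 - fps_X) * (1 - fps_X ^ 3) - subst_pow 3 (Abs_fps h_int ^ 2 * (1 - fps_X)) * (1 - fps_X) ^ 3"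
    by (simp add: B_def)
  obtain d where d: "(log_h - subst_pow 3 log_h) * (1 - fps_X ^ 3) + fps_X * (1 - fps_X) = 3 * d"
    using log_h_frob unfolding of_int_3 by (elim dvdE)
  have "(1 + 3 * log_h) * (1 - fps_X ^ 3) - subst_pow 3 (1 + 3 * log_h) * (1 - fps_X) ^ 3 =
      3 * ((log_h - subst_pow 3 log_h) * (1 - fps_X ^ 3) + fps_X * (1 - fps_X)) + 9 * (subst_pow 3 log_h * fps_X * (1 - fps_X))"
    unfolding subst_pow_3_one_plus by (simp add: power3_eq_cube algebra_simps)
  also have "\<dots> = 9 * (d + subst_pow 3 log_h * fps_X * (1 - fps_X))" unfolding d by (simp add: algebra_simps)
  finally show "of_int 9 dvd (1 + 3 * log_h) * (1 - fps_X ^ 3) - subst_pow 3 (1 + 3 * log_h) * (1 - fps_X) ^ 3"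
    by simp
qed (simp_all add: fps_X_power_nth h_int_def log_h_def power2_eq_square numeral_fps_const)

text \<open>The same comparison, with (1 + z^3) - (1 + z) (1 + 5 z + z^2) = - 6 z (1 + z), which is
  3 z (1 + z) modulo 9. No square appears because A itself is rational modulo 3.\<close>

lemma A_int_mod_9: "of_int 9 dvd Abs_fps A_int * (1 + fps_X) - (1 + 3 * log_A)"
proof (rule frob_solution_unique)
  define B where "B = Abs_fps A_int"
  let ?V = "(1 + fps_X) * (1 + 5 * fps_X + fps_X ^ 2) :: int fps"
  have "of_int 9 dvd (B - subst_pow 3 B * (1 + 5 * fps_X + fps_X ^ 2)) * ((1 + fps_X) * (1 + fps_X ^ 3))"
    using A_int_frob by (intro dvd_mult2) (simp add: B_def)
  also have "\<dots> = B * (1 + fps_X) * (1 + fps_X ^ 3) - subst_pow 3 (B * (1 + fps_X)) * ?V"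
    by (simp add: subst_pow_mult subst_pow_poly) (simp add: algebra_simps)
  finally show "of_int 9 dvd Abs_fps A_int * (1 + fps_X) * (1 + fps_X ^ 3) - subst_pow 3 (Abs_fps A_int * (1 + fps_X)) * ?V"
    by (simp add: B_def)
  obtain d where d: "(log_A - subst_pow 3 log_A) * (1 + fps_X ^ 3) + fps_X * (1 + fps_X) = 3 * d"
    using log_A_frob unfolding of_int_3 by (elim dvdE)
  have "(1 + 3 * log_A) * (1 + fps_X ^ 3) - subst_pow 3 (1 + 3 * log_A) * ?V =
      3 * ((log_A - subst_pow 3 log_A) * (1 + fps_X ^ 3) + fps_X * (1 + fps_X))
      - 9 * ((1 + 2 * subst_pow 3 log_A) * fps_X * (1 + fps_X))"
    unfolding subst_pow_3_one_plus by (simp add: power3_eq_cube power2_eq_square algebra_simps)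
  also have "\<dots> = 9 * (d - (1 + 2 * subst_pow 3 log_A) * fps_X * (1 + fps_X))" unfolding d by (simp add: algebra_simps)
  finally show "of_int 9 dvd (1 + 3 * log_A) * (1 + fps_X ^ 3) - subst_pow 3 (1 + 3 * log_A) * ?V"
    by simp
qed (simp_all add: fps_X_power_nth A_int_def log_A_def power2_eq_square numeral_fps_const)

section \<open>Multiplicative independence\<close>

context padic_field
begin

text \<open>A denominator of norm 1 gives a linear recurrence modulo the maximal ideal, so d
  consecutive residues determine the next one. The recurrence has coefficients in K, not in the
  integers; it is therefore applied to the difference of two windows, where only divisibility by 3
  matters.\<close>

lemma rational_mod_3_periodic:
  assumes r: "r \<in> rational_functions K" and small: "gauss_norm (of_int_fls \<psi> - r) < 1"
  shows "\<exists>T>0. \<exists>n0. \<forall>n\<ge>n0. 3 dvd fps_nth \<psi> (n + T) - fps_nth \<psi> n"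
proof -
  obtain F G e where FG: "F \<in> bounded_series K" "G \<in> bounded_series K" "r = fps_to_fls F / fps_to_fls G"
    "G \<noteq> 0" "sup_norm G = 1" "\<And>i. absval (fps_nth G i) \<le> 1" "absval (fps_nth G e) = 1" "\<And>i. i < e \<Longrightarrow> absval (fps_nth G i) < 1"
    and fin: "finite {i. fps_nth F i \<noteq> 0}" "finite {i. fps_nth G i \<noteq> 0}"
    using rational_normalized[OF r] by metis
  obtain d where d: "{i. fps_nth F i \<noteq> 0} \<union> {i. fps_nth G i \<noteq> 0} \<subseteq> {..d}"
    using fin finite_nat_iff_bounded_le by (metis finite_Un)
  have "fps_nth G e \<noteq> 0" using FG(7) by auto
  then have ed: "e \<le> d" using d by auto
  define p where "p = fps_nth \<psi>"
  define D where "D = G * of_int_fps \<psi> - F"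
  have DK: "D \<in> bounded_series K"
    unfolding D_def by (intro conjunct1[OF bs_diff[OF K]] bs_mult[OF K] FG of_int_series)
  have "of_int_fls \<psi> - r = fps_to_fls D / fps_to_fls G"
    using FG(4) by (simp add: FG(3) D_def of_int_fls_def field_simps fls_times_fps_to_fls fps_to_fls_minus)
  then have "sup_norm D < 1" using small N_quotient(2)[OF DK FG(2,4)] FG(5) by simp
  then have D1: "absval (fps_nth D n) < 1" for n using sup_norm_upper[OF DK, of n] by linarith
  have rec: "absval (\<Sum>j\<le>d. fps_nth G j * of_int (p (n - j))) < 1" if "d < n" for n
  proof -
    have "fps_nth D n = (\<Sum>j=0..n. fps_nth G j * of_int (p (n - j)))"
      using d that by (auto simp: D_def fps_mult_nth of_int_fps_def p_def)
    also have "\<dots> = (\<Sum>j\<le>d. fps_nth G j * of_int (p (n - j)))"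
      using d that by (intro sum.mono_neutral_right) auto
    finally show ?thesis using D1[of n] by simp
  qed
  have step: "3 dvd p n - p n'" if n: "d < n" "d < n'" and w: "\<And>i. 1 \<le> i \<Longrightarrow> i \<le> d \<Longrightarrow> 3 dvd p (n - i) - p (n' - i)" for n n'
  proof -
    \<comment> \<open>The recurrence is read in degree n + e: terms with j < e have small
      coefficients, terms with j > e involve earlier values, and the coefficient at j = e is a
      unit.\<close>
    define t where "t j = fps_nth G j * of_int (p (n + e - j) - p (n' + e - j))" for j
    have "sum t {..d} = (\<Sum>j\<le>d. fps_nth G j * of_int (p (n + e - j))) - (\<Sum>j\<le>d. fps_nth G j * of_int (p (n' + e - j)))"
      by (simp add: t_def algebra_simps sum_subtractf)
    then have "absval (sum t {..d}) < 1"
      using rec[of "n + e"] rec[of "n' + e"] n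
        ultrametric_absval_add[of "\<Sum>j\<le>d. fps_nth G j * of_int (p (n + e - j))" "- (\<Sum>j\<le>d. fps_nth G j * of_int (p (n' + e - j)))"]
      by simp
    moreover have "absval (sum t ({..d} - {e})) < 1"
    proof (rule ultra_absval_sum_less)
      fix j assume j: "j \<in> {..d} - {e}"
      show "absval (t j) < 1"
      proof (cases "j < e")
        case True
        have "absval (t j) \<le> absval (fps_nth G j) * 1"
          unfolding t_def ultrametric_absval_mult by (intro mult_left_mono absval_of_int_le_1) simp
        then show ?thesis using FG(8)[OF True] by simp
      next
        case False
        then have "n + e - j = n - (j - e)" "n' + e - j = n' - (j - e)" "1 \<le> j - e" "j - e \<le> d" using j n by auto
        then have "absval (of_int (p (n + e - j) - p (n' + e - j)) :: 'c) < 1"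
          using w absval_of_int_less_1_iff by metis
        moreover have "absval (t j) \<le> 1 * absval (of_int (p (n + e - j) - p (n' + e - j)) :: 'c)"
          unfolding t_def ultrametric_absval_mult by (intro mult_right_mono FG(6)) simp
        ultimately show ?thesis by linarith
      qed
    qed auto
    moreover have "sum t {..d} = t e + sum t ({..d} - {e})" using ed by (simp add: sum.remove)
    ultimately have "absval (t e) < 1"
      using ultrametric_absval_add[of "sum t {..d}" "- sum t ({..d} - {e})"] by simp
    then have "absval (of_int (p n - p n') :: 'c) < 1" by (simp add: t_def ultrametric_absval_mult FG(7) del: of_int_diff)
    then show ?thesis using absval_of_int_less_1_iff by blast
  qed
  \<comment> \<open>The residues of the d values before n; there are finitely many such windows, so
    two of them coincide.\<close>
  define W where "W n = map (\<lambda>i. p (n - Suc i) mod 3) [0..<d]" for n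
  have "W ` {d<..} \<subseteq> {xs. set xs \<subseteq> {0..<3} \<and> length xs = d}" by (auto simp: W_def)
  then have "finite (W ` {d<..})" by (rule finite_subset) (intro finite_lists_length_eq finite_atLeastLessThan_int)
  then have "\<not> inj_on W {d<..}" using finite_imageD infinite_Ioi by blast
  then obtain n n' where nn: "d < n" "n < n'" "W n = W n'"
    unfolding inj_on_def by (metis greaterThan_iff linorder_neq_iff)
  have "3 dvd p (n + k) - p (n' + k)" for k
  proof (induction k rule: less_induct)
    case (less k)
    show ?case
    proof (rule step)
      fix i assume i: "1 \<le> i" "i \<le> d"
      show "3 dvd p (n + k - i) - p (n' + k - i)"
      proof (cases "i \<le> k")
        case True
        then show ?thesis using less[of "k - i"] i by simp
      next
        case False
        define l where "l = i - k - 1"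
        have l: "l < d" "n + k - i = n - Suc l" "n' + k - i = n' - Suc l" using False i nn by (auto simp: l_def)
        have "W n ! l = W n' ! l" using nn(3) by simp
        then show ?thesis unfolding l(2,3) using l(1) by (simp add: W_def mod_eq_dvd_iff)
      qed
    qed (use nn in auto)
  qed
  then have per: "3 dvd p (n' + k) - p (n + k)" for k by (metis dvd_minus_iff minus_diff_eq)
  have "3 dvd fps_nth \<psi> (m + (n' - n)) - fps_nth \<psi> m" if "n \<le> m" for m
  proof -
    obtain k where k: "m = n + k" using \<open>n \<le> m\<close> by (metis le_iff_add)
    then have "m + (n' - n) = n' + k" using nn by simp
    then show ?thesis using per[of k] k by (simp only: p_def)
  qed
  moreover have "n' - n > 0" using nn by simp
  ultimately show ?thesis by blast
qed

text \<open>The coefficients of \<open>a * log_h + b * log_A\<close> are not eventually periodic modulo 3: for a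
  period \<open>3^k * t\<close> and a multiple \<open>n\<close> of \<open>3^(k+1)\<close>, the part prime to 3 of \<open>n + 2 * j * 3^k * t\<close>
  is congruent to \<open>2 * j * t\<close>.\<close>

lemma log_combination_not_rational:
  assumes ab: "\<not> (3 dvd a \<and> 3 dvd b)" and r: "r \<in> rational_functions K"
  shows "\<not> gauss_norm (of_int_fls (of_int a * log_h + of_int b * log_A) - r) < 1"
proof
  define \<psi> where "\<psi> = of_int a * log_h + of_int b * log_A"
  assume "gauss_norm (of_int_fls (of_int a * log_h + of_int b * log_A) - r) < 1"
  then obtain T n0 where T: "T > 0" "\<And>n. n \<ge> n0 \<Longrightarrow> 3 dvd fps_nth \<psi> (n + T) - fps_nth \<psi> n"
    using rational_mod_3_periodic[OF r] unfolding \<psi>_def by metis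
  have \<psi>: "fps_nth \<psi> n = (b * (- 1) ^ n - a) * free3 n" for n
    by (simp add: \<psi>_def log_h_def log_A_def fps_of_int[symmetric] algebra_simps)
  \<comment> \<open>An even shift preserves the sign (-1) ^ n in the coefficients.\<close>
  have T2: "3 dvd fps_nth \<psi> (n + 2 * T) - fps_nth \<psi> n" if "n \<ge> n0" for n
    using dvd_add[OF T(2)[of "n + T"] T(2)[OF that]] that by (simp add: mult_2 add.assoc)
  have "\<not> is_unit (3 :: nat)" "T \<noteq> 0" using T(1) by simp_all
  then obtain k t where kt: "T = 3 ^ k * t" "\<not> 3 dvd t"
    using multiplicity_decompose' by metis
  \<comment> \<open>If both parities failed, 3 would divide b - a and - b - a, hence a and
    b.\<close>
  have "\<exists>\<epsilon>::nat. \<not> 3 dvd b * (- 1) ^ \<epsilon> - a"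
  proof (rule ccontr)
    assume "\<not> ?thesis"
    then have "3 dvd b * (- 1) ^ 0 - a" "3 dvd b * (- 1) ^ 1 - a" by blast+
    then show False using ab by simp presburger
  qed
  then obtain \<epsilon> :: nat where \<epsilon>: "\<not> 3 dvd b * (- 1) ^ \<epsilon> - a" by blast
  \<comment> \<open>Large enough for the periodic range and of the parity of
    \<open>\<epsilon>\<close>, which multiplication by 3 ^ Suc k preserves.\<close>
  define m where "m = 2 * n0 + \<epsilon>"
  have val: "fps_nth \<psi> (3 ^ Suc k * m + 2 * j * T) = (b * (- 1) ^ \<epsilon> - a) * int (3 * m + 2 * j * t)" if "\<not> 3 dvd j" for j
  proof -
    have e: "3 ^ Suc k * m + 2 * j * T = 3 ^ k * (3 * m + 2 * j * t)" by (simp add: kt algebra_simps)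
    have "Factorial_Ring.prime (3 :: nat)" by simp
    then have "\<not> 3 dvd 2 * j * t" using kt(2) that by (auto simp: prime_dvd_mult_iff)
    then have nd: "\<not> 3 dvd 3 * m + 2 * j * t" by presburger
    have "even (3 ^ Suc k * m + 2 * j * T) \<longleftrightarrow> even \<epsilon>" by (simp add: m_def)
    then have "(- 1 :: int) ^ (3 ^ Suc k * m + 2 * j * T) = (- 1) ^ \<epsilon>" by (metis neg_one_even_power neg_one_odd_power)
    then show ?thesis unfolding \<psi> using free3_power3_mult[OF nd, of k] by (simp only: e)
  qed
  have "m \<le> 3 ^ Suc k * m" by simp
  moreover have "n0 \<le> m" by (simp add: m_def)
  ultimately have "n0 \<le> 3 ^ Suc k * m + 2 * 1 * T" by linarith
  \<comment> \<open>j = 1 and j = 2 lie one shift 2 * T apart, and both multiples j are prime to 3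
    as \<open>val\<close> demands; the part prime to 3 grows by 2 * t.\<close>
  from T2[OF this] have "3 dvd fps_nth \<psi> (3 ^ Suc k * m + 2 * 2 * T) - fps_nth \<psi> (3 ^ Suc k * m + 2 * 1 * T)"
    by (simp add: algebra_simps)
  also have "\<dots> = (b * (- 1) ^ \<epsilon> - a) * (2 * int t)"
  proof -
    have "\<not> 3 dvd (1 :: nat)" "\<not> 3 dvd (2 :: nat)" by simp_all
    from val[OF this(1)] val[OF this(2)] show ?thesis by (simp only:) (simp add: algebra_simps)
  qed
  finally have "3 dvd (b * (- 1) ^ \<epsilon> - a) * (2 * int t)" .
  moreover have "Factorial_Ring.prime (3 :: int)" by simp
  ultimately have "3 dvd 2 * int t" using \<epsilon> prime_dvd_multD by blast
  then show False using kt(2) by presburger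
qed

text \<open>x = 1 + 3 psi modulo 9, so psi plays the part of (log x) / 3 modulo 3: products become
  sums, integer powers become multiples.\<close>

definition near_1 :: "'c fls \<Rightarrow> int fps \<Rightarrow> bool" where
  "near_1 x \<psi> \<longleftrightarrow> x \<in> unit_series K \<and> gauss_norm (x - (1 + 3 * of_int_fls \<psi>)) \<le> 1 / 9"

lemma three_S: "(3 :: 'c fls) \<in> bounded_quotients K"
  using rat_S N_3(1) by blast

lemma nine_S: "(9 :: 'c fls) \<in> bounded_quotients K"
  using mult_S[OF three_S three_S] by simp

lemma N_9: assumes "x \<in> bounded_quotients K" shows "gauss_norm (9 * x) = 1 / 9 * gauss_norm x"
proof -
  have "9 * x = 3 * (3 * x)" by simp
  then show ?thesis
    by (simp only: N_mult[OF three_S mult_S[OF three_S assms]] N_mult[OF three_S assms] N_3(2))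
qed

lemma near_1_mult: assumes "near_1 x \<psi>" "near_1 y \<omega>" shows "near_1 (x * y) (\<psi> + \<omega>)"
proof -
  let ?g = "of_int_fls \<psi> :: 'c fls" and ?k = "of_int_fls \<omega> :: 'c fls"
  have x: "x \<in> unit_series K" "gauss_norm (x - (1 + 3 * ?g)) \<le> 1 / 9"
    and y: "y \<in> unit_series K" "gauss_norm (y - (1 + 3 * ?k)) \<le> 1 / 9" using assms by (auto simp: near_1_def)
  note xS = unit_series_S[OF x(1)] and yS = unit_series_S[OF y(1)] and g = of_int_fls_S[of \<psi>] and k = of_int_fls_S[of \<omega>]
  have gS: "1 + 3 * ?g \<in> bounded_quotients K" "1 + 3 * ?k \<in> bounded_quotients K"
    by (intro add_S one_S mult_S three_S g k)+
  have Ng: "gauss_norm (1 + 3 * ?g) \<le> 1"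
    using N_mult[OF three_S g(1)] g(2) N_ge_0[OF g(1)] by (intro N_add_le one_S mult_S three_S g) (auto simp: N_1 N_3)
  have "x * y - (1 + 3 * of_int_fls (\<psi> + \<omega>)) =
      (x - (1 + 3 * ?g)) * y + ((1 + 3 * ?g) * (y - (1 + 3 * ?k)) + 9 * (?g * ?k))"
    by (simp add: of_int_fls_simps algebra_simps)
  moreover have "gauss_norm ((x - (1 + 3 * ?g)) * y + ((1 + 3 * ?g) * (y - (1 + 3 * ?k)) + 9 * (?g * ?k))) \<le> 1 / 9"
  proof (intro N_add_le)
    show "gauss_norm ((x - (1 + 3 * ?g)) * y) \<le> 1 / 9" using x yS by (simp add: N_mult diff_S xS gS)
    have "gauss_norm ((1 + 3 * ?g) * (y - (1 + 3 * ?k))) \<le> 1 * (1 / 9)"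
      unfolding N_mult[OF gS(1) diff_S[OF yS(1) gS(2)]] using y Ng
      by (intro mult_mono) (auto intro!: N_ge_0 diff_S yS gS)
    then show "gauss_norm ((1 + 3 * ?g) * (y - (1 + 3 * ?k))) \<le> 1 / 9" by simp
    have "gauss_norm (?g * ?k) \<le> 1" unfolding N_mult[OF g(1) k(1)] by (intro mult_le_one g k N_ge_0)
    then show "gauss_norm (9 * (?g * ?k)) \<le> 1 / 9" by (simp add: N_9 mult_S g k)
    show 9: "9 * (?g * ?k) \<in> bounded_quotients K" by (rule mult_S[OF nine_S mult_S[OF g(1) k(1)]])
    show "(1 + 3 * ?g) * (y - (1 + 3 * ?k)) + 9 * (?g * ?k) \<in> bounded_quotients K"
      by (rule add_S[OF mult_S[OF gS(1) diff_S[OF yS(1) gS(2)]] 9])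
  qed (intro mult_S diff_S xS yS gS)+
  ultimately show ?thesis unfolding near_1_def using unit_series_mult[OF x(1) y(1)] by simp
qed

lemma near_1_inverse: assumes "near_1 x \<psi>" shows "near_1 (inverse x) (- \<psi>)"
proof -
  let ?g = "of_int_fls \<psi> :: 'c fls"
  have x: "x \<in> unit_series K" "gauss_norm (x - (1 + 3 * ?g)) \<le> 1 / 9" using assms by (auto simp: near_1_def)
  note xS = unit_series_S[OF x(1)] and g = of_int_fls_S[of \<psi>]
  have m: "of_int_fls (- \<psi>) = - ?g" using of_int_fls_simps(2)[of 0 \<psi>, where 'c = 'c] by (simp add: of_int_fls_simps)
  have gS: "1 + 3 * ?g \<in> bounded_quotients K" "1 - 3 * ?g \<in> bounded_quotients K"
    by (intro add_S diff_S one_S mult_S three_S g)+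
  have Ng: "gauss_norm (1 - 3 * ?g) \<le> 1"
    using N_mult[OF three_S g(1)] g(2) N_ge_0[OF g(1)] by (intro N_diff_le one_S mult_S three_S g) (auto simp: N_1 N_3)
  have 9: "9 * (?g * ?g) \<in> bounded_quotients K" by (intro mult_S nine_S g)
  have "1 - x * (1 - 3 * ?g) = 9 * (?g * ?g) - (x - (1 + 3 * ?g)) * (1 - 3 * ?g)"
    by (simp add: algebra_simps)
  moreover have "inverse x - (1 + 3 * of_int_fls (- \<psi>)) = inverse x * (1 - x * (1 - 3 * ?g))"
    using xS(3) by (simp add: m algebra_simps)
  ultimately have e: "inverse x - (1 + 3 * of_int_fls (- \<psi>)) = inverse x * (9 * (?g * ?g) - (x - (1 + 3 * ?g)) * (1 - 3 * ?g))"
    by simp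
  have "gauss_norm (9 * (?g * ?g) - (x - (1 + 3 * ?g)) * (1 - 3 * ?g)) \<le> 1 / 9"
  proof (intro N_diff_le 9)
    have "gauss_norm (?g * ?g) \<le> 1" unfolding N_mult[OF g(1) g(1)] by (intro mult_le_one g N_ge_0)
    then show "gauss_norm (9 * (?g * ?g)) \<le> 1 / 9" by (simp add: N_9 mult_S g)
    have "gauss_norm ((x - (1 + 3 * ?g)) * (1 - 3 * ?g)) \<le> 1 / 9 * 1"
      unfolding N_mult[OF diff_S[OF xS(1) gS(1)] gS(2)] using x Ng
      by (intro mult_mono) (auto intro!: N_ge_0 gS)
    then show "gauss_norm ((x - (1 + 3 * ?g)) * (1 - 3 * ?g)) \<le> 1 / 9" by simp
  qed (intro mult_S diff_S xS gS)
  moreover have "9 * (?g * ?g) - (x - (1 + 3 * ?g)) * (1 - 3 * ?g) \<in> bounded_quotients K"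
    by (intro mult_S diff_S xS gS 9)
  ultimately have "gauss_norm (inverse x - (1 + 3 * of_int_fls (- \<psi>))) \<le> 1 / 9"
    unfolding e by (simp add: N_mult inverse_S N_inverse xS)
  then show ?thesis unfolding near_1_def using unit_series_inverse[OF x(1)] by simp
qed

lemma near_1_power: assumes "near_1 x \<psi>" shows "near_1 (x ^ n) (of_nat n * \<psi>)"
proof (induction n)
  case 0
  show ?case by (simp add: near_1_def unit_series_1 of_int_fls_simps N_0)
next
  case (Suc n)
  then show ?case using near_1_mult[OF assms Suc] by (simp add: algebra_simps)
qed

lemma near_1_power_int: assumes "near_1 x \<psi>" shows "near_1 (x powi i) (of_int i * \<psi>)"
proof (cases "0 \<le> i")
  case True
  then have "of_int i = (of_nat (nat i) :: int fps)" by simp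
  then show ?thesis using near_1_power[OF assms, of "nat i"] True by (simp add: power_int_def)
next
  case False
  then have "of_int i = - (of_nat (nat (- i)) :: int fps)" by simp
  then show ?thesis using near_1_power[OF near_1_inverse[OF assms], of "nat (- i)"] False by (simp add: power_int_def)
qed

text \<open>With x = 1 + u the error terms 3 u^2 and u^3 have size at most 3^-(2k+1) and 3^-(3k),
  both within 3^-(k+2) exactly because k >= 1. Cubing thus moves g up one level without loss modulo
  3.\<close>

lemma cube_near_1:
  assumes x: "x \<in> bounded_quotients K" and g: "g \<in> bounded_quotients K" "gauss_norm g \<le> 1"
    and k: "1 \<le> k" "gauss_norm (x - (1 + 3 ^ k * g)) \<le> (1 / 3) ^ Suc k"
  shows "gauss_norm (x ^ 3 - (1 + 3 ^ Suc k * g)) \<le> (1 / 3) ^ Suc (Suc k)"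
proof -
  define \<epsilon> where "\<epsilon> = x - (1 + 3 ^ k * g)"
  define u where "u = 3 ^ k * g + \<epsilon>"
  have S: "\<epsilon> \<in> bounded_quotients K" "u \<in> bounded_quotients K" "3 ^ k * g \<in> bounded_quotients K"
    unfolding u_def \<epsilon>_def by (intro add_S diff_S mult_S power_S one_S three_S x g)+
  have N\<epsilon>: "gauss_norm \<epsilon> \<le> (1 / 3) ^ Suc k" using k by (simp add: \<epsilon>_def)
  have Nu: "gauss_norm u \<le> (1 / 3) ^ k"
    unfolding u_def
  proof (rule N_add_le[OF S(3,1)])
    show "gauss_norm (3 ^ k * g) \<le> (1 / 3) ^ k"
      using g by (simp add: N_mult N_power power_S three_S N_3 mult_left_le)
    show "gauss_norm \<epsilon> \<le> (1 / 3) ^ k" using N\<epsilon> by (rule order_trans) simp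
  qed
  have "x ^ 3 - (1 + 3 ^ Suc k * g) = 3 * \<epsilon> + (3 * u ^ 2 + u ^ 3)"
  proof -
    have "x = 1 + u" by (simp add: u_def \<epsilon>_def)
    then have "x ^ 3 = 1 + 3 * u + 3 * u ^ 2 + u ^ 3" by (simp add: power3_eq_cube power2_eq_square algebra_simps)
    moreover have "3 * u = 3 ^ Suc k * g + 3 * \<epsilon>" by (simp add: u_def algebra_simps)
    ultimately show ?thesis by simp
  qed
  moreover have "gauss_norm (3 * \<epsilon> + (3 * u ^ 2 + u ^ 3)) \<le> (1 / 3) ^ Suc (Suc k)"
  proof (intro N_add_le)
    show "gauss_norm (3 * \<epsilon>) \<le> (1 / 3) ^ Suc (Suc k)" using N\<epsilon> by (simp add: N_mult three_S S N_3)
    have "gauss_norm (3 * u ^ 2) = 1 / 3 * gauss_norm u ^ 2" by (simp add: N_mult N_power power_S three_S S N_3)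
    also have "\<dots> \<le> 1 / 3 * ((1 / 3) ^ k) ^ 2"
      using Nu by (intro mult_left_mono power_mono N_ge_0 S) auto
    also have "\<dots> = (1 / 3) ^ Suc (k * 2)" by (simp add: power_mult)
    also have "\<dots> \<le> (1 / 3) ^ Suc (Suc k)" using k(1) by (intro power_decreasing) auto
    finally show "gauss_norm (3 * u ^ 2) \<le> (1 / 3) ^ Suc (Suc k)" .
    have "gauss_norm (u ^ 3) \<le> ((1 / 3) ^ k) ^ 3"
      unfolding N_power[OF S(2)] using Nu by (intro power_mono N_ge_0 S)
    also have "\<dots> = (1 / 3) ^ (k * 3)" by (simp add: power_mult)
    also have "\<dots> \<le> (1 / 3) ^ Suc (Suc k)" using k(1) by (intro power_decreasing) auto
    finally show "gauss_norm (u ^ 3) \<le> (1 / 3) ^ Suc (Suc k)" .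
  qed (intro add_S mult_S power_S three_S S)+
  ultimately show ?thesis by simp
qed

lemma near_1_power_3: assumes "near_1 x \<psi>"
  shows "gauss_norm (x ^ 3 ^ j - (1 + 3 ^ Suc j * of_int_fls \<psi>)) \<le> (1 / 3) ^ Suc (Suc j)"
proof (induction j)
  case 0
  then show ?case using assms by (simp add: near_1_def power2_eq_square)
next
  case (Suc j)
  have "x ^ 3 ^ Suc j = (x ^ 3 ^ j) ^ 3" by (simp add: power_mult[symmetric] mult.commute)
  then show ?case
    using cube_near_1[OF power_S of_int_fls_S _ Suc] unit_series_S assms by (simp add: near_1_def)
qed

section \<open>Integrality of the three series and their integer approximations\<close>

lemma h_series_approx: assumes "3 ^ M dvd 64 * c - 1"
  shows "absval (fps_nth (h_series :: 'c fps) n - of_int (c ^ n * int ((2 * n) choose n) ^ 3)) \<le> (1 / 3) ^ M"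
proof -
  have "64 * c - 1 dvd (64 * c) ^ n - 1" by (metis dvd_triv_left power_diff_1_eq)
  then have "3 ^ M dvd (1 - (64 * c) ^ n) * int ((2 * n) choose n) ^ 3"
    using assms by (metis dvd_minus_iff dvd_mult2 dvd_trans minus_diff_eq)
  then have a: "absval (of_int ((1 - (64 * c) ^ n) * int ((2 * n) choose n) ^ 3) :: 'c) \<le> (1 / 3) ^ M"
    using absval_of_int_le_iff by blast
  have "\<not> 3 dvd (64 ^ n :: int)"
  proof
    assume "3 dvd (64 ^ n :: int)"
    moreover have "Factorial_Ring.prime (3 :: int)" by simp
    ultimately have "3 dvd (64 :: int)" using prime_dvd_power by blast
    then show False by simp
  qed
  then have "\<not> absval (of_int (64 ^ n) :: 'c) < 1" using absval_of_int_less_1_iff by blast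
  then have "absval (of_int (64 ^ n) :: 'c) = 1" using absval_of_int_le_1[of "64 ^ n", where 'c = 'c] by linarith
  moreover have "fps_nth (h_series :: 'c fps) n - of_int (c ^ n * int ((2 * n) choose n) ^ 3) =
      of_int ((1 - (64 * c) ^ n) * int ((2 * n) choose n) ^ 3) / of_int (64 ^ n)"
    by (simp add: h_series_def field_simps power_mult_distrib)
  ultimately show ?thesis using a by (simp add: absval_divide)
qed

lemma h_series_unit: "h_series \<in> bounded_series K" "fps_to_fls h_series \<in> unit_series K"
proof -
  have le: "absval (fps_nth (h_series :: 'c fps) n) \<le> 1" for n
  proof -
    have "absval (fps_nth (h_series :: 'c fps) n - of_int (1 ^ n * int ((2 * n) choose n) ^ 3)) \<le> (1 / 3) ^ 0"
      by (rule h_series_approx) simp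
    then have "absval (fps_nth (h_series :: 'c fps) n - of_int (int ((2 * n) choose n) ^ 3)) \<le> 1" by simp
    then show ?thesis
      using absval_of_int_le_1[of "int ((2 * n) choose n) ^ 3", where 'c = 'c]
        ultrametric_absval_add[of "fps_nth h_series n - of_int (int ((2 * n) choose n) ^ 3)" "of_int (int ((2 * n) choose n) ^ 3) :: 'c"]
      by (simp del: of_int_power)
  qed
  moreover have "fps_nth (h_series :: 'c fps) n \<in> K" for n
    using K_closed(4)[OF K_inverse[OF K_power[OF K_of_nat[of 64]]] K_power[OF K_of_nat]]
    by (simp add: h_series_def divide_inverse)
  ultimately show b: "h_series \<in> bounded_series K" by (auto simp: bounded_series_def intro!: bdd_aboveI[of _ 1])
  show "fps_to_fls h_series \<in> unit_series K"
    unfolding unit_series_def using b le by (auto simp: h_series_def)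
qed

text \<open>The denominators 2n - 1 can be divisible by 3, so integrality is read off
  \<open>f_series_eq\<close>: \<open>J\<close> is a ring of integral series stable under derivation
  and contains h and z.\<close>

lemma f_series_unit: "fps_to_fls f_series \<in> unit_series K"
proof -
  define J where "J = {F \<in> bounded_series K. sup_norm F \<le> 1}"
  have J_diff: "F \<in> J \<Longrightarrow> G \<in> J \<Longrightarrow> F - G \<in> J" for F G
    using bs_diff[OF K, of F G] by (auto simp: J_def)
  have J_mult: "F \<in> J \<Longrightarrow> G \<in> J \<Longrightarrow> F * G \<in> J" for F G
    using bs_mult[OF K, of F G] sup_norm_mult(2)[OF bs_UNIV[OF K] bs_UNIV[OF K], of F G]
      series_S(2)[of F] series_S(2)[of G] N_ge_0[OF series_S(1), of F] N_ge_0[OF series_S(1), of G]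
    by (auto simp: J_def intro!: mult_le_one)
  have J_deriv: "F \<in> J \<Longrightarrow> fps_deriv F \<in> J" for F
    using deriv_series[of F] by (auto simp: J_def)
  have J_int: "of_int_fps F \<in> J" for F
    using of_int_series[of F] by (auto simp: J_def of_int_fps_def absval_of_int_le_1 intro!: sup_norm_least)
  have J_h: "h_series \<in> J"
  proof -
    have "gauss_norm (fps_to_fls h_series :: 'c fls) = 1" by (rule unit_series_S(2)[OF h_series_unit(2)])
    then show ?thesis using h_series_unit(1) series_S(2)[OF h_series_unit(1)] by (simp add: J_def)
  qed
  have J_0: "0 \<in> J"
  proof -
    have "of_int_fps 0 = (0 :: 'c fps)" by (simp add: of_int_fps_def fps_eq_iff)
    then show ?thesis using J_int[of 0] by simp
  qed
  have J_add: "F \<in> J \<Longrightarrow> G \<in> J \<Longrightarrow> F + G \<in> J" for F G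
    using J_diff[of F "0 - G"] J_diff[of 0 G] J_0 by simp
  have J_X: "fps_X \<in> J"
  proof -
    have "of_int_fps fps_X = (fps_X :: 'c fps)" by (simp add: of_int_fps_def fps_eq_iff)
    then show ?thesis using J_int[of fps_X] by simp
  qed
  have J_of_nat: "of_nat n \<in> J" for n
    using J_int[of "of_nat n"] by (simp add: of_int_fps_def fps_of_nat[symmetric] fps_const_def if_distrib cong: if_cong)
  have J_1: "1 \<in> J" and J_numeral: "numeral n \<in> J" for n
    using J_of_nat[of 1] J_of_nat[of "numeral n"] by simp_all
  have J_power: "F \<in> J \<Longrightarrow> F ^ n \<in> J" for F n
    by (induction n) (auto intro: J_1 J_mult)
  have "f_series \<in> J"
    unfolding f_series_eq by (intro J_add J_mult J_diff J_1 J_X J_h J_deriv J_numeral J_power)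
  then have "f_series \<in> bounded_series K" "absval (fps_nth (f_series :: 'c fps) n) \<le> 1" for n
    using sup_norm_upper[of f_series K n] by (auto simp: J_def)
  then show ?thesis unfolding unit_series_def by (auto simp: f_series_def)
qed

lemma A_series_eq: "(A_series :: 'c fps) = of_int_fps (Abs_fps A_int)"
  by (simp add: A_series_def of_int_fps_def A_int_def)

lemma A_series_unit: "A_series \<in> bounded_series K" "fps_to_fls A_series \<in> unit_series K"
  using of_int_series of_int_fls_unit[of "Abs_fps A_int"] by (simp_all add: A_series_eq of_int_fls_def A_int_def)

lemma dwork_h_series: "dwork_series h_series"
  unfolding dwork_series_def
proof
  fix M
  \<comment> \<open>Partial sum of the geometric series of 1/64 = 1 / (1 + 63); the error is a
    multiple of 63 ^ M.\<close>
  define c where "c = (\<Sum>i<M. (- 63 :: int) ^ i)"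
  have "64 * c - 1 = - ((- 63) ^ M)" using one_diff_power_eq[of "- 63 :: int" M] by (simp add: c_def)
  moreover have "(3 :: int) ^ M dvd (- 63) ^ M" by (rule dvd_power_same) simp
  ultimately have "3 ^ M dvd 64 * c - 1" by simp
  then show "\<exists>b. ghost_decomposable 3 b \<and> (\<forall>n. absval (fps_nth (h_series :: 'c fps) n - of_int (b n)) \<le> (1 / 3) ^ M)"
    using h_series_approx ghost_decomposable_central_binomial_cube by blast
qed

lemma dwork_A_series: "dwork_series A_series"
  unfolding dwork_series_def
proof (intro allI exI[of _ A_int] conjI)
  show "ghost_decomposable 3 A_int" using ghost_decomposable_apery by (simp add: A_int_def[abs_def])
qed (simp add: A_series_eq of_int_fps_def)

lemma near_1_h: "near_1 (fps_to_fls h_series ^ 2 * (1 - fls_X)) log_h"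
proof -
  let ?h = "fps_to_fls h_series :: 'c fls" and ?g = "of_int_fls (Abs_fps h_int) :: 'c fls"
  \<comment> \<open>Modulo 9 the integer 1 serves as 1/64, since 9 divides 63.\<close>
  have "absval (fps_nth (h_series :: 'c fps) n - of_int (1 ^ n * int ((2 * n) choose n) ^ 3)) \<le> (1 / 3) ^ 2" for n
    by (rule h_series_approx) simp
  then have hg: "gauss_norm (?h - ?g) \<le> 1 / 9"
    by (intro N_approx h_series_unit) (simp add: h_int_def power2_eq_square)
  note hS = unit_series_S[OF h_series_unit(2)] and gS = of_int_fls_S[of "Abs_fps h_int"]
  have X: "1 - fls_X = (of_int_fls (1 - fps_X) :: 'c fls)" by (simp add: of_int_fls_simps)
  have U: "1 - fls_X \<in> unit_series K" unfolding X by (rule of_int_fls_unit) simp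
  note US = unit_series_S[OF U]
  have "gauss_norm (of_int_fls (Abs_fps h_int ^ 2 * (1 - fps_X) - (1 + 3 * log_h)) :: 'c fls) \<le> (1 / 3) ^ 2"
    by (rule of_int_fls_small) (use h_int_mod_9 in simp)
  then have 1: "gauss_norm (?g ^ 2 * (1 - fls_X) - (1 + 3 * of_int_fls log_h)) \<le> 1 / 9"
    by (simp add: of_int_fls_simps power2_eq_square)
  have "gauss_norm ((?h - ?g) * (?h + ?g)) \<le> 1 / 9 * 1"
    unfolding N_mult[OF diff_S[OF hS(1) gS(1)] add_S[OF hS(1) gS(1)]]
    by (intro mult_mono hg N_add_le hS gS N_ge_0 add_S) (simp_all add: hS)
  then have 2: "gauss_norm ((?h - ?g) * (?h + ?g) * (1 - fls_X)) \<le> 1 / 9"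
    by (simp add: N_mult[OF mult_S[OF diff_S[OF hS(1) gS(1)] add_S[OF hS(1) gS(1)]] US(1)] US)
  have "gauss_norm ((?h - ?g) * (?h + ?g) * (1 - fls_X) + (?g ^ 2 * (1 - fls_X) - (1 + 3 * of_int_fls log_h))) \<le> 1 / 9"
    by (intro N_add_le 1 2 mult_S diff_S add_S power_S hS gS one_S three_S US of_int_fls_S)
  then have "gauss_norm (?h ^ 2 * (1 - fls_X) - (1 + 3 * of_int_fls log_h)) \<le> 1 / 9"
    by (simp add: algebra_simps power2_eq_square)
  then show ?thesis
    unfolding near_1_def using unit_series_mult[OF unit_series_power[OF h_series_unit(2)] U] by blast
qed

lemma near_1_A: "near_1 (fps_to_fls A_series * (1 + fls_X)) log_A"
proof -
  have A: "fps_to_fls A_series = (of_int_fls (Abs_fps A_int) :: 'c fls)" by (simp add: A_series_eq of_int_fls_def)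
  have X: "1 + fls_X = (of_int_fls (1 + fps_X) :: 'c fls)" by (simp add: of_int_fls_simps)
  have U: "1 + fls_X \<in> unit_series K" unfolding X by (rule of_int_fls_unit) simp
  have "gauss_norm (of_int_fls (Abs_fps A_int * (1 + fps_X) - (1 + 3 * log_A)) :: 'c fls) \<le> (1 / 3) ^ 2"
    by (rule of_int_fls_small) (use A_int_mod_9 in simp)
  then have "gauss_norm (fps_to_fls A_series * (1 + fls_X) - (1 + 3 * of_int_fls log_A) :: 'c fls) \<le> 1 / 9"
    by (simp add: A of_int_fls_simps power2_eq_square)
  then show ?thesis unfolding near_1_def using unit_series_mult[OF A_series_unit(2) U] by blast
qed

lemma monomial_not_analytic:
  assumes "fps_to_fls h_series powi a * fps_to_fls A_series powi b \<in> analytic"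
  shows "a = 0 \<and> b = 0"
proof (rule ccontr)
  let ?h = "fps_to_fls h_series :: 'c fls" and ?A = "fps_to_fls A_series :: 'c fls"
  assume "\<not> (a = 0 \<and> b = 0)"
  \<comment> \<open>The gcd involves 2 * b because \<open>H\<close> contains h^2 but
    \<open>B\<close> only A: the square of the monomial is H ^ a B ^ (2 b) up to rational
    factors.\<close>
  then have g0: "gcd a (2 * b) \<noteq> 0" by auto
  have "\<not> is_unit (3 :: int)" by simp
  then obtain k g where kg: "gcd a (2 * b) = 3 ^ k * g" "\<not> 3 dvd g"
    using multiplicity_decompose'[OF g0] by metis
  have "3 ^ k dvd gcd a (2 * b)" unfolding kg(1) by simp
  then obtain a' b' where ab: "a = 3 ^ k * a'" "2 * b = 3 ^ k * b'" by (meson dvdE dvd_trans gcd_dvd1 gcd_dvd2)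
  have nd: "\<not> (3 dvd a' \<and> 3 dvd b')"
  proof
    assume "3 dvd a' \<and> 3 dvd b'"
    then have "3 ^ k * 3 dvd a" "3 ^ k * 3 dvd 2 * b" unfolding ab by (auto intro: mult_dvd_mono)
    then have "3 ^ k * 3 dvd 3 ^ k * g" unfolding kg(1)[symmetric] by (rule gcd_greatest)
    then show False using kg(2) by simp
  qed
  define H where "H = ?h ^ 2 * (1 - fls_X)"
  define B where "B = ?A * (1 + fls_X)"
  define x where "x = H powi a' * B powi b'"
  define \<psi> where "\<psi> = of_int a' * log_h + of_int b' * log_A"
  have nx: "near_1 x \<psi>" unfolding x_def \<psi>_def H_def B_def
    by (intro near_1_mult near_1_power_int near_1_h near_1_A)
  note xS = unit_series_S[OF nx[unfolded near_1_def, THEN conjunct1]]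
  define y where "y = x ^ 3 ^ k"
  have pw: "(z powi i) ^ 3 ^ k = z powi (3 ^ k * i)" for z :: "'c fls" and i
    by (metis mult.commute of_nat_numeral of_nat_power power_int_mult power_int_of_nat)
  \<comment> \<open>y is the square of the given monomial times a rational function, hence analytic.
    Being close to 1 + 3 ^ Suc k * psi, it makes psi rational modulo 3.\<close>
  have "y = (?h powi a * ?A powi b) ^ 2 * (1 - fls_X) powi a * (1 + fls_X) powi (2 * b)"
  proof -
    have sq: "(z ^ 2) powi i = z powi (2 * i)" for z :: "'c fls" and i by (simp add: power_int_mult)
    have "y = H powi a * B powi (2 * b)" by (simp add: y_def x_def power_mult_distrib pw ab)
    also have "\<dots> = (?h powi (2 * a) * ?A powi (2 * b)) * (1 - fls_X) powi a * (1 + fls_X) powi (2 * b)"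
      by (simp add: H_def B_def power_int_mult_distrib sq mult.assoc)
    also have "?h powi (2 * a) * ?A powi (2 * b) = (?h powi a * ?A powi b) ^ 2"
      by (simp add: power_mult_distrib power_int_mult mult.commute[of 2])
    finally show ?thesis .
  qed
  also have "\<dots> \<in> analytic"
    by (intro an.mult_S an.power_S an.power_int_S assms an.diff_S an.add_S an.one_S rational_analytic[OF rational_X])
  finally have y: "y \<in> analytic" .
  define q where "q = (3 :: 'c fls) ^ Suc k"
  have q: "q \<in> rational_functions K" "gauss_norm q = (1 / 3) ^ Suc k"
    unfolding q_def by (intro rat.power_S N_3) (simp only: N_power[OF three_S] N_3)
  have q0: "q \<noteq> 0" by (simp add: q_def)
  define z where "z = (y - 1) / q"
  have zA: "z \<in> analytic" unfolding z_def by (intro an.divide_S an.diff_S y an.one_S rational_analytic[OF q(1)])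
  note zS = analytic_S[OF zA] and qS = rat_S[OF q(1)] and gS = of_int_fls_S[of \<psi>]
  have e: "y - (1 + q * of_int_fls \<psi>) = q * (z - of_int_fls \<psi>)" using q0 by (simp add: z_def field_simps)
  have "gauss_norm (y - (1 + q * of_int_fls \<psi>)) \<le> (1 / 3) ^ Suc (Suc k)"
    unfolding y_def q_def by (rule near_1_power_3[OF nx])
  then have "(1 / 3) ^ Suc k * gauss_norm (z - of_int_fls \<psi>) \<le> (1 / 3) ^ Suc (Suc k)"
    unfolding e N_mult[OF qS diff_S[OF zS gS(1)]] q(2) .
  then have "gauss_norm (z - of_int_fls \<psi>) < 1" by (simp add: field_simps)
  then have 1: "gauss_norm (of_int_fls \<psi> - z) < 1" using N_commute[OF zS gS(1)] by simp
  obtain r where r: "r \<in> rational_functions K" "gauss_norm (z - r) < 1" using analyticD[OF zA zero_less_one] by blast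
  have "gauss_norm (of_int_fls \<psi> - r) < 1" by (rule N_trans_less[OF gS(1) zS rat_S[OF r(1)] 1 r(2)])
  then show False using log_combination_not_rational[OF nd r(1)] by (simp add: \<psi>_def)
qed

theorem algebraic_relations:
  "\<not> alg_independent_over_analytic K h_series f_series"
  "embed_ambient K (fps_to_fls f_series / fps_to_fls h_series) \<in> analytic_elements K"
  "alg_independent_over_analytic K h_series A_series"
  "alg_independent_over_analytic K f_series A_series"
proof -
  let ?h = "fps_to_fls h_series :: 'c fls" and ?A = "fps_to_fls A_series :: 'c fls" and ?f = "fps_to_fls f_series :: 'c fls"
  note hS = unit_series_S[OF h_series_unit(2)] and AS = unit_series_S[OF A_series_unit(2)]
  define v where "v = frob3 ?h / ?h"
  define w where "w = frob3 ?A / ?A"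
  have v: "v \<in> analytic" "frob3 ?h = v * ?h"
    unfolding v_def using frob_ratio_analytic[OF h_series_unit dwork_h_series] hS(3) by auto
  have w: "w \<in> analytic" "frob3 ?A = w * ?A"
    unfolding w_def using frob_ratio_analytic[OF A_series_unit dwork_A_series] AS(3) by auto
  define u where "u = ?f / ?h"
  have u: "u \<in> analytic"
    unfolding u_def by (rule f_over_h_analytic[OF h_series_unit(2) log_deriv_analytic[OF h_series_unit(2) v(2,1)]])
  have fu: "?f = u * ?h" using hS(3) by (simp add: u_def)
  have "fps_nth (f_series :: 'c fps) 0 = 1" by (simp add: f_series_def)
  then have f0: "?f \<noteq> 0" by (metis fps_to_fls_eq_0_iff fps_zero_nth zero_neq_one)
  then have u0: "u \<noteq> 0" using fu by auto
  show "\<not> alg_independent_over_analytic K h_series f_series"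
    unfolding alg_independent_over_analytic_def fu by (rule not_alg_independent_criterion[OF u hS(1)])
  show "embed_ambient K (?f / ?h) \<in> analytic_elements K" using embed_analytic[OF u] by (simp add: u_def)
  show "alg_independent_over_analytic K h_series A_series"
    unfolding alg_independent_over_analytic_def
    by (rule alg_independent_criterion[OF h_series_unit(2) v(2,1) A_series_unit(2) w(2,1) monomial_not_analytic])
  show "alg_independent_over_analytic K f_series A_series"
    unfolding alg_independent_over_analytic_def
  \<comment> \<open>Since f = u h with u analytic, f inherits its Frobenius quotient from h, and
    monomials in f and A differ from those in h and A by a power of u.\<close>
  proof (rule alg_independent_criterion[OF f_series_unit _ _ A_series_unit(2) w(2,1)])
    show "frob3 ?f = (frob3 u * v / u) * ?f" unfolding fu using u0 by (simp add: v(2))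
    show "frob3 u * v / u \<in> analytic" by (intro an.divide_S an.mult_S frob3_analytic u v)
    fix a b assume f: "?f powi a * ?A powi b \<in> analytic"
    have "?h powi a * ?A powi b = inverse (u powi a) * (?f powi a * ?A powi b)"
      unfolding fu using u0 by (simp add: power_int_mult_distrib)
    also have "\<dots> \<in> analytic" by (intro an.mult_S an.inverse_S an.power_int_S u f)
    finally show "a = 0 \<and> b = 0" by (rule monomial_not_analytic)
  qed
qed

end

lemma absval_of_int_Cp:
  assumes "is_Cp 3 TYPE('c::ultrametric_field)"
  shows "absval (of_int n :: 'c) = (if n = 0 then 0 else (1 / 3) ^ multiplicity 3 n)"
proof -
  have "absval (of_rat (of_int n) :: 'c) = padic_abs 3 (of_int n)"
    using assms unfolding is_Cp_def by blast
  moreover have "quotient_of (of_int n) = (n, 1)" by simp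
  ultimately show ?thesis by (simp add: padic_abs_def power_int_minus power_one_over inverse_eq_divide)
qed

theorem theorem6p1:
  fixes K :: "'c::ultrametric_field set"
  assumes "is_Cp 3 TYPE('c)"
    and "frobenius_field 3 K"
  shows "\<not> alg_independent_over_analytic K h_series f_series
       \<and> embed_ambient K (fps_to_fls f_series / fps_to_fls h_series) \<in> analytic_elements K
       \<and> alg_independent_over_analytic K h_series A_series
       \<and> alg_independent_over_analytic K f_series A_series"
proof -
  interpret padic_field K
  proof (intro padic_field.intro base_field.intro padic_field_axioms.intro)
    show "subfield K ring_of_type_algebra"
      using assms(2) by (simp only: frobenius_field_def finite_padic_extension_def)
  qed (rule absval_of_int_Cp[OF assms(1)])
  show ?thesis using algebraic_relations by blast
qed

end
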